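(* Suppose $X$ is a 1-ended simply connected locally compact absolute neighborhood retract (ANR) and $G$ is a group (not necessarily finitely generated) acting as covering transformations on $X$. Assume that for each non-empty compact subset $C_0$ of $X$ there is an infinite finitely generated subgroup $J$ of $G$ so that (a) $J$ is semistable at $\infty$ in $X$ with respect to $C_0$, and (b) $J$ is co-semistable at $\infty$ in $X$ with respect to $C_0$. Then $X$ has semistable fundamental group at $\infty$.
   Context: $X$ has semistable fundamental group at $\infty$ if any two proper rays $[0,\infty)\to X$ are properly homotopic. For $A\subseteq X$, $J\cdot A=\bigcup_{j\in J}j(A)$. Semistability in $X$: for a finite generating set $J^0$ of $J$ let $\Lambda(J,J^0)$ be the Cayley graph and $z:\Lambda(J,J^0)\to X$ a $J$-equivariant map. For a compact $C_0\subset X$, $J$ is semistable at $\infty$ in $X$ with respect to $C_0$ if there exist a compact set $C$ in $X$ and some (equivalently any) finite generating set $J^0$ (and map $z$) such that for any third compact set $D$ and any proper edge path rays $r$ and $s$ in $\Lambda(J,J^0)$ based at the same vertex and such that $z(r)$ and $z(s)$ have image in $X-C$, there is a path $\delta$ in $X-D$ connecting a point of $z(r)$ to a point of $z(s)$ such that the loop determined by $\delta$ and the initial segments of $z(r)$ and $z(s)$ is homotopically trivial in $X-C_0$. Co-semistability in $X$: a subset $A$ of $X$ is $J$-bounded if $A\subset J\cdot D$ for some compact $D\subset X$, and $J$-unbounded otherwise. A proper ray is $J$-bounded if its image is. Let $C_0\subset X$ be non-empty compact and $C\supseteq C_0$ compact. For a $J$-unbounded component $U$ of $X-J\cdot C$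 and a $J$-bounded proper ray $r$ with image in $U$, $J$ is co-semistable at $\infty$ in $U$ with respect to $r$ and $C_0$ if for any compact set $D$ and any loop $\alpha:[0,1]\to U$ with $\alpha(0)=\alpha(1)=r(0)$ there are $n\ge0$ and a homotopy $H:[0,1]\times[0,n]\to X-C_0$ such that $H(t,0)=\alpha(t)$ for all $t$, $H(0,s)=H(1,s)=r(s)$ for all $s\in[0,n]$, and $H(t,n)\in X-D$ for all $t$. $J$ is co-semistable at $\infty$ in $X$ with respect to $C_0$ if there is a compact $C\supseteq C_0$ such that $J$ is co-semistable at $\infty$ in $U$ with respect to $r$ and $C_0$ for each $J$-unbounded component $U$ of $X-J\cdot C$ and each proper $J$-bounded ray $r$ in $U$. *)

theory Defs
  imports "HOL-Analysis.Analysis" "HOL-Algebra.Group_Action" "HOL-Algebra.Generated_Groups"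
begin

section \<open>Spaces, proper maps and ends\<close>

text \<open>
  Absolute neighbourhood retracts for metrizable spaces, without restriction on dimension:
  \<open>X\<close> is a neighbourhood retract of every metrizable space \<open>Y\<close> that contains it as a closed
  subset. (The constant \<^const>\<open>ANR\<close> is only meant for subsets of Euclidean spaces, since it
  tests embeddings into the type \<open>'a \<times> real\<close>.)
  A quantifier over the underlying types of all \<open>Y\<close> is not available, but the type
  \<open>'a \<Rightarrow> real\<close> is large enough: it contains the Banach space of bounded functions
  on \<open>X\<close>, in which \<open>X\<close> is isometric to a closed subset of its own convex hull
  (Kuratowski, Wojdyslawski). By Dugundji's theorem this hull is an absolute extensor for
  metrizable spaces, so a neighbourhood retraction in it yields one in every metrizable \<open>Y\<close>.
\<close>
definition metric_ANR :: "'a::topological_space set \<Rightarrow> bool" where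
  "metric_ANR X \<longleftrightarrow> metrizable_space (top_of_set X) \<and>
     (\<forall>(Y :: ('a \<Rightarrow> real) topology) S.
        metrizable_space Y \<and> closedin Y S \<and> top_of_set X homeomorphic_space subtopology Y S \<longrightarrow>
        (\<exists>U. openin Y U \<and> S \<subseteq> U \<and> S retract_of_space subtopology Y U))"

definition proper_map_on ::
  "'b::topological_space set \<Rightarrow> 'a::topological_space set \<Rightarrow> ('b \<Rightarrow> 'a) \<Rightarrow> bool" where
  "proper_map_on S X f \<longleftrightarrow> continuous_on S f \<and> f \<in> S \<rightarrow> X \<and>
     (\<forall>K. compact K \<and> K \<subseteq> X \<longrightarrow> compact (S \<inter> f -` K))"

definition proper_ray :: "'a::topological_space set \<Rightarrow> (real \<Rightarrow> 'a) \<Rightarrow> bool" where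
  "proper_ray X r \<longleftrightarrow> proper_map_on {0..} X r"

definition properly_homotopic_rays ::
  "'a::topological_space set \<Rightarrow> (real \<Rightarrow> 'a) \<Rightarrow> (real \<Rightarrow> 'a) \<Rightarrow> bool" where
  "properly_homotopic_rays X r s \<longleftrightarrow>
     (\<exists>H :: real \<times> real \<Rightarrow> 'a. proper_map_on ({0..} \<times> {0..1}) X H \<and>
        (\<forall>t\<ge>0. H (t, 0) = r t \<and> H (t, 1) = s t))"

definition semistable_fundamental_group_at_infinity :: "'a::topological_space set \<Rightarrow> bool" where
  "semistable_fundamental_group_at_infinity X \<longleftrightarrow>
     (\<forall>r s. proper_ray X r \<and> proper_ray X s \<longrightarrow> properly_homotopic_rays X r s)"

definition one_ended :: "'a::topological_space set \<Rightarrow> bool" where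
  "one_ended X \<longleftrightarrow> (\<forall>C. compact C \<and> C \<subseteq> X \<longrightarrow>
     (\<exists>!U. U \<in> components (X - C) \<and> \<not> (\<exists>K. compact K \<and> K \<subseteq> X \<and> U \<subseteq> K)))"

section \<open>Actions by covering transformations\<close>

text \<open>
  The last two conditions say that the orbit map from \<open>X\<close> to the orbit space is a covering
  projection and that the orbit space is Hausdorff. For locally compact Hausdorff \<open>X\<close> they
  amount to the action being free and properly discontinuous (only finitely many translates of
  a compact set meet a given compact set).
\<close>
definition covering_transformation_action ::
  "('g, 'm) monoid_scheme \<Rightarrow> 'a::topological_space set \<Rightarrow> ('g \<Rightarrow> 'a \<Rightarrow> 'a) \<Rightarrow> bool" where
  "covering_transformation_action G X \<phi> \<longleftrightarrow>
     group_action G X \<phi> \<and>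
     (\<forall>g\<in>carrier G. continuous_on X (\<phi> g)) \<and>
     (\<forall>x\<in>X. \<exists>U. openin (top_of_set X) U \<and> x \<in> U \<and>
        (\<forall>g\<in>carrier G. g \<noteq> \<one>\<^bsub>G\<^esub> \<longrightarrow> \<phi> g ` U \<inter> U = {})) \<and>
     (\<forall>x\<in>X. \<forall>y\<in>X. y \<notin> orbit G \<phi> x \<longrightarrow>
        (\<exists>U V. openin (top_of_set X) U \<and> x \<in> U \<and> openin (top_of_set X) V \<and> y \<in> V \<and>
           (\<forall>g\<in>carrier G. \<phi> g ` U \<inter> V = {})))"

definition translates :: "('g \<Rightarrow> 'a \<Rightarrow> 'a) \<Rightarrow> 'g set \<Rightarrow> 'a set \<Rightarrow> 'a set" where
  "translates \<phi> J A = (\<Union>j\<in>J. \<phi> j ` A)"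

definition group_bounded ::
  "'a::topological_space set \<Rightarrow> ('g \<Rightarrow> 'a \<Rightarrow> 'a) \<Rightarrow> 'g set \<Rightarrow> 'a set \<Rightarrow> bool" where
  "group_bounded X \<phi> J A \<longleftrightarrow> (\<exists>D. compact D \<and> D \<subseteq> X \<and> A \<subseteq> translates \<phi> J D)"

definition finite_generating_set :: "('g, 'm) monoid_scheme \<Rightarrow> 'g set \<Rightarrow> 'g set \<Rightarrow> bool" where
  "finite_generating_set G J J0 \<longleftrightarrow> finite J0 \<and> J0 \<subseteq> J \<and> generate G J0 = J"

definition finitely_generated_subgroup :: "('g, 'm) monoid_scheme \<Rightarrow> 'g set \<Rightarrow> bool" where
  "finitely_generated_subgroup G J \<longleftrightarrow> subgroup J G \<and> (\<exists>J0. finite_generating_set G J J0)"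

section \<open>Semistability of a subgroup at infinity\<close>

text \<open>
  The Cayley graph of \<open>J\<close> with respect to \<open>J0\<close> has vertex set \<open>J\<close> and, for all \<open>g \<in> J\<close> and
  \<open>s \<in> J0\<close>, one edge from \<open>g\<close> to \<open>g s\<close>, on which \<open>J\<close> acts by left multiplication.
  An equivariant map \<open>z\<close> from its geometric realization to \<open>X\<close> is given by its restriction \<open>zv\<close>
  to the vertices and its restriction \<open>ze g s\<close> to each closed edge, parametrized by the unit
  interval from \<open>g\<close> to \<open>g s\<close>.
\<close>
definition equivariant_cayley_map ::
  "('g, 'm) monoid_scheme \<Rightarrow> 'a::topological_space set \<Rightarrow> ('g \<Rightarrow> 'a \<Rightarrow> 'a) \<Rightarrow> 'g set \<Rightarrow> 'g set \<Rightarrow>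
   ('g \<Rightarrow> 'a) \<Rightarrow> ('g \<Rightarrow> 'g \<Rightarrow> real \<Rightarrow> 'a) \<Rightarrow> bool" where
  "equivariant_cayley_map G X \<phi> J J0 zv ze \<longleftrightarrow>
     (\<forall>g\<in>J. zv g \<in> X) \<and>
     (\<forall>g\<in>J. \<forall>s\<in>J0. path (ze g s) \<and> path_image (ze g s) \<subseteq> X \<and>
        pathstart (ze g s) = zv g \<and> pathfinish (ze g s) = zv (g \<otimes>\<^bsub>G\<^esub> s)) \<and>
     (\<forall>h\<in>J. \<forall>g\<in>J. zv (h \<otimes>\<^bsub>G\<^esub> g) = \<phi> h (zv g)) \<and>
     (\<forall>h\<in>J. \<forall>g\<in>J. \<forall>s\<in>J0. \<forall>t\<in>{0..1}. ze (h \<otimes>\<^bsub>G\<^esub> g) s t = \<phi> h (ze g s t))"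

text \<open>
  \<open>(g, s, True)\<close> is the edge from \<open>g\<close> to \<open>g s\<close> traversed from \<open>g\<close> to \<open>g s\<close>, and
  \<open>(g, s, False)\<close> is the same edge traversed backwards.
\<close>
type_synonym 'g oriented_edge = "'g \<times> 'g \<times> bool"

fun edge_source :: "('g, 'm) monoid_scheme \<Rightarrow> 'g oriented_edge \<Rightarrow> 'g" where
  "edge_source G (g, s, fwd) = (if fwd then g else g \<otimes>\<^bsub>G\<^esub> s)"

fun edge_target :: "('g, 'm) monoid_scheme \<Rightarrow> 'g oriented_edge \<Rightarrow> 'g" where
  "edge_target G (g, s, fwd) = (if fwd then g \<otimes>\<^bsub>G\<^esub> s else g)"

fun edge_image :: "('g \<Rightarrow> 'g \<Rightarrow> real \<Rightarrow> 'a::topological_space) \<Rightarrow> 'g oriented_edge \<Rightarrow> real \<Rightarrow> 'a" where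
  "edge_image ze (g, s, fwd) = (if fwd then ze g s else reversepath (ze g s))"

text \<open>
  Since the Cayley graph is locally finite, an edge path ray is proper iff it visits each vertex
  only finitely often.
\<close>
definition proper_edge_path_ray ::
  "('g, 'm) monoid_scheme \<Rightarrow> 'g set \<Rightarrow> 'g set \<Rightarrow> (nat \<Rightarrow> 'g oriented_edge) \<Rightarrow> bool" where
  "proper_edge_path_ray G J J0 e \<longleftrightarrow>
     (\<forall>n. e n \<in> J \<times> J0 \<times> UNIV) \<and>
     (\<forall>n. edge_target G (e n) = edge_source G (e (Suc n))) \<and>
     (\<forall>v\<in>J. finite {n. edge_source G (e n) = v})"

text \<open>The image \<open>z(r)\<close> of an edge path ray, running through the \<open>n\<close>-th edge on \<open>[n, n + 1]\<close>.\<close>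
definition ray_image ::
  "('g \<Rightarrow> 'g \<Rightarrow> real \<Rightarrow> 'a::topological_space) \<Rightarrow> (nat \<Rightarrow> 'g oriented_edge) \<Rightarrow> real \<Rightarrow> 'a" where
  "ray_image ze e t = edge_image ze (e (nat \<lfloor>t\<rfloor>)) (frac t)"

definition semistable_in ::
  "('g, 'm) monoid_scheme \<Rightarrow> 'a::topological_space set \<Rightarrow> ('g \<Rightarrow> 'a \<Rightarrow> 'a) \<Rightarrow> 'g set \<Rightarrow> 'a set \<Rightarrow> bool"
  where
  "semistable_in G X \<phi> J C0 \<longleftrightarrow>
     (\<exists>C J0 zv ze. compact C \<and> C \<subseteq> X \<and> finite_generating_set G J J0 \<and>
        equivariant_cayley_map G X \<phi> J J0 zv ze \<and>
        (\<forall>D r s. compact D \<and> D \<subseteq> X \<and>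
           proper_edge_path_ray G J J0 r \<and> proper_edge_path_ray G J J0 s \<and>
           edge_source G (r 0) = edge_source G (s 0) \<and>
           ray_image ze r ` {0..} \<subseteq> X - C \<and> ray_image ze s ` {0..} \<subseteq> X - C \<longrightarrow>
           (\<exists>a\<ge>0. \<exists>b\<ge>0. \<exists>\<delta>. path \<delta> \<and> path_image \<delta> \<subseteq> X - D \<and>
              pathstart \<delta> = ray_image ze r a \<and> pathfinish \<delta> = ray_image ze s b \<and>
              homotopic_paths (X - C0)
                ((\<lambda>t. ray_image ze r (a * t)) +++ \<delta> +++
                  reversepath (\<lambda>t. ray_image ze s (b * t)))
                (\<lambda>_. ray_image ze r 0))))"

section \<open>Co-semistability of a subgroup at infinity\<close>

definition co_semistable_in_component ::
  "'a::topological_space set \<Rightarrow> 'a set \<Rightarrow> (real \<Rightarrow> 'a) \<Rightarrow> 'a set \<Rightarrow> bool" where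
  "co_semistable_in_component X U r C0 \<longleftrightarrow>
     (\<forall>D \<alpha>. compact D \<and> D \<subseteq> X \<and> path \<alpha> \<and> path_image \<alpha> \<subseteq> U \<and>
        pathstart \<alpha> = r 0 \<and> pathfinish \<alpha> = r 0 \<longrightarrow>
        (\<exists>n\<ge>0. \<exists>H :: real \<times> real \<Rightarrow> 'a.
           continuous_on ({0..1} \<times> {0..n}) H \<and> H \<in> {0..1} \<times> {0..n} \<rightarrow> X - C0 \<and>
           (\<forall>t\<in>{0..1}. H (t, 0) = \<alpha> t) \<and>
           (\<forall>s\<in>{0..n}. H (0, s) = r s \<and> H (1, s) = r s) \<and>
           (\<forall>t\<in>{0..1}. H (t, n) \<in> X - D)))"

definition co_semistable_in ::
  "'a::topological_space set \<Rightarrow> ('g \<Rightarrow> 'a \<Rightarrow> 'a) \<Rightarrow> 'g set \<Rightarrow> 'a set \<Rightarrow> bool" where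
  "co_semistable_in X \<phi> J C0 \<longleftrightarrow>
     (\<exists>C. compact C \<and> C \<subseteq> X \<and> C0 \<subseteq> C \<and>
        (\<forall>U r. U \<in> components (X - translates \<phi> J C) \<and> \<not> group_bounded X \<phi> J U \<and>
           proper_ray X r \<and> r ` {0..} \<subseteq> U \<and> group_bounded X \<phi> J (r ` {0..}) \<longrightarrow>
           co_semistable_in_component X U r C0))"

end

theory Submission imports Defs begin

text \<open>
  Fix a compact set \<open>C0\<close>, a subgroup \<open>J\<close> that is semistable and co-semistable with respect to it,
  and put \<open>Y = X - C0\<close>. The heart of the proof is that loops far out, based at a point near
  infinity, can be pushed in \<open>Y\<close> as far out as one likes (\<open>loops_push_out\<close>). Since \<open>X\<close> is one-ended,
  two proper rays can be connected far out by paths; pushing the loops formed by consecutive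
  connecting paths and the rays makes them bound squares far out, and together these squares
  form a proper homotopy between the rays (\<open>ray_step\<close>, \<open>rays_properly_homotopic\<close>).

  To push loops, think of paths in \<open>Y\<close> from a fixed point as points of the universal cover of \<open>Y\<close>,
  and call \<open>u\<close> and \<open>v\<close> joined in \<open>F\<close> if they lie in one path component of the preimage of \<open>F\<close>. A
  path \<open>u\<close> that ends near the orbit \<open>J \<cdot> zv \<one>\<close> but far from \<open>C0\<close> picks an end of the universal
  cover: continue it to a nearby vertex of the Cayley graph, and then along any ray of the
  graph. Semistability says that the choice of the ray does not matter. As an edge followed by a
  ray is a ray, the end also stays the same when \<open>u\<close> is prolonged along edges. A path inside the
  translates of a precompact set is homotopic to such an edge path with uniform control, because
  \<open>X\<close> is simply connected and locally trivial (\<open>compact_paths_homotopic\<close>). Hence prolonging \<open>u\<close> by a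
  path that stays in these translates and avoids some compact set \<open>E\<close> does not change its end
  (\<open>end_invariant\<close>).

  Now let \<open>p\<close> be a loop off \<open>E\<close> at a vertex far out. Enclose the translates of a compact set in a
  connected closed set \<open>N\<close> of the same kind. The part of \<open>p\<close> in \<open>N\<close> and in the \<open>J\<close>-bounded components
  of \<open>X - N\<close> runs through translates of one precompact set, so it does not affect the end.
  It remains to treat an excursion of \<open>p\<close> into a \<open>J\<close>-unbounded component \<open>W\<close>. A simply connected
  space is unicoherent, so the frontier of \<open>W\<close> is connected (\<open>component_frontier\<close>); as \<open>X\<close> is
  one-ended, it is not compact (\<open>unbounded_frontier\<close>). A locally finite cover of the frontier by small
  sets (\<open>layer_exists\<close>) is therefore an infinite connected graph, and deleting the finitely
  many sets that meet \<open>E\<close> leaves finitely many pieces next to the gap. Enlarge \<open>E\<close> so that two such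
  pieces that can be linked off \<open>E\<close> and off the translates can be linked arbitrarily far out. Then the
  excursion can be closed up to a loop by paths in the layer and a path far out, neither of which
  changes the end. Koenig's lemma provides a \<open>J\<close>-bounded ray in the layer, and co-semistability
  slides the loop along this ray to infinity, so the loop does not change the end either.

  So the constant path and \<open>p\<close> have the same end. This means that, off any given compact
  set \<open>D\<close>, they are joined, in other words that \<open>p\<close> is homotopic in \<open>Y\<close> to a path off \<open>D\<close>.
\<close>

section \<open>Isometric embedding in a normed space\<close>

text \<open>
  Kuratowski's embedding. Subtracting the distance to one arbitrary point, here \<open>undefined\<close>,
  makes the functions bounded.
\<close>
definition kuratowski :: "'a::metric_space \<Rightarrow> ('a \<Rightarrow>\<^sub>C real)" where
  "kuratowski x = Bcontfun (\<lambda>y. dist x y - dist undefined y)"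

lemma apply_kuratowski: "apply_bcontfun (kuratowski x) = (\<lambda>y. dist x y - dist undefined y)"
proof -
  have "norm (dist x y - dist undefined y) \<le> dist x undefined" for y
    using abs_dist_diff_le[of x y undefined] by (simp add: dist_commute)
  then have "bounded (range (\<lambda>y. dist x y - dist undefined y))"
    unfolding bounded_iff by blast
  then show ?thesis
    unfolding kuratowski_def
    by (intro Bcontfun_inverse) (auto simp: bcontfun_def intro!: continuous_intros)
qed

lemma dist_kuratowski [simp]: "dist (kuratowski x) (kuratowski y) = dist x y"
proof (rule antisym)
  show "dist (kuratowski x) (kuratowski y) \<le> dist x y"
    using abs_dist_diff_le[of x _ y]
    by (intro dist_bound) (simp add: apply_kuratowski dist_real_def dist_commute)
  have "dist (kuratowski x x) (kuratowski y x) \<le> dist (kuratowski x) (kuratowski y)"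
    by (rule dist_bounded)
  then show "dist x y \<le> dist (kuratowski x) (kuratowski y)"
    by (simp add: apply_kuratowski dist_real_def dist_commute)
qed

lemma inj_kuratowski: "inj kuratowski"
  by (metis dist_eq_0_iff dist_kuratowski injI)

lemma continuous_on_kuratowski [continuous_intros]: "continuous_on S kuratowski"
  unfolding continuous_on_iff by auto

lemma continuous_on_inv_kuratowski: "continuous_on (kuratowski ` S) (inv_into UNIV kuratowski)"
  unfolding continuous_on_iff by (auto simp: inv_f_f[OF inj_kuratowski])

lemma inv_kuratowski [simp]: "inv_into UNIV kuratowski (kuratowski x) = x"
  by (simp add: inv_f_f[OF inj_kuratowski])

lemma inv_kuratowski_comp [simp]: "inv_into UNIV kuratowski \<circ> (kuratowski \<circ> p) = p"
  by (simp add: fun_eq_iff)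

lemma homeomorphism_kuratowski: "homeomorphism S (kuratowski ` S) kuratowski (inv_into UNIV kuratowski)"
  by (intro homeomorphismI) (auto intro: continuous_on_kuratowski continuous_on_inv_kuratowski)

lemma homeomorphic_kuratowski: "S homeomorphic (kuratowski ` S)"
  using homeomorphism_kuratowski homeomorphic_def by blast

text \<open>
  Homotopies can be carried back from the isometric image, which lies in a normed space. This
  yields the groupoid laws for homotopy classes of paths in a metric space.
\<close>
lemma homotopic_paths_kuratowski:
  "homotopic_paths (kuratowski ` S) (kuratowski \<circ> p) (kuratowski \<circ> q) \<Longrightarrow> homotopic_paths S p q"
  using homotopic_paths_continuous_image[of "kuratowski ` S" "kuratowski \<circ> p" "kuratowski \<circ> q" "inv_into UNIV kuratowski" S]
    continuous_on_inv_kuratowski[of S]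
  by fastforce

lemma kuratowski_comp_const [simp]: "kuratowski \<circ> (\<lambda>_. a) = (\<lambda>_. kuratowski a)"
  by auto

lemma path_kuratowski: "path p \<Longrightarrow> path (kuratowski \<circ> p)"
  by (simp add: continuous_on_kuratowski path_continuous_image)

lemma path_image_kuratowski: "path_image p \<subseteq> S \<Longrightarrow> path_image (kuratowski \<circ> p) \<subseteq> kuratowski ` S"
  by (auto simp: path_image_def)

lemma homotopic_paths_rconst:
  fixes p :: "real \<Rightarrow> 'a::metric_space"
  assumes "path p" "path_image p \<subseteq> S"
  shows "homotopic_paths S (p +++ (\<lambda>_. pathfinish p)) p"
proof (rule homotopic_paths_kuratowski)
  have "homotopic_paths (kuratowski ` S) ((kuratowski \<circ> p) +++ linepath (pathfinish (kuratowski \<circ> p)) (pathfinish (kuratowski \<circ> p))) (kuratowski \<circ> p)"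
    using assms by (intro homotopic_paths_rid path_kuratowski path_image_kuratowski)
  then show "homotopic_paths (kuratowski ` S) (kuratowski \<circ> (p +++ (\<lambda>_. pathfinish p))) (kuratowski \<circ> p)"
    by (simp add: path_compose_join pathfinish_compose linepath_refl)
qed

lemma homotopic_paths_lconst:
  fixes p :: "real \<Rightarrow> 'a::metric_space"
  assumes "path p" "path_image p \<subseteq> S"
  shows "homotopic_paths S ((\<lambda>_. pathstart p) +++ p) p"
proof (rule homotopic_paths_kuratowski)
  have "homotopic_paths (kuratowski ` S) (linepath (pathstart (kuratowski \<circ> p)) (pathstart (kuratowski \<circ> p)) +++ (kuratowski \<circ> p)) (kuratowski \<circ> p)"
    using assms by (intro homotopic_paths_lid path_kuratowski path_image_kuratowski)
  then show "homotopic_paths (kuratowski ` S) (kuratowski \<circ> ((\<lambda>_. pathstart p) +++ p)) (kuratowski \<circ> p)"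
    by (simp add: path_compose_join pathstart_compose linepath_refl)
qed

lemma homotopic_paths_rinverse:
  fixes p :: "real \<Rightarrow> 'a::metric_space"
  assumes "path p" "path_image p \<subseteq> S"
  shows "homotopic_paths S (p +++ reversepath p) (\<lambda>_. pathstart p)"
proof (rule homotopic_paths_kuratowski)
  have "homotopic_paths (kuratowski ` S) ((kuratowski \<circ> p) +++ reversepath (kuratowski \<circ> p)) (linepath (pathstart (kuratowski \<circ> p)) (pathstart (kuratowski \<circ> p)))"
    using assms by (intro homotopic_paths_rinv path_kuratowski path_image_kuratowski)
  then show "homotopic_paths (kuratowski ` S) (kuratowski \<circ> (p +++ reversepath p)) (kuratowski \<circ> (\<lambda>_. pathstart p))"
    by (simp add: path_compose_join path_compose_reversepath pathstart_compose linepath_refl)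
qed

lemma homotopic_paths_linverse:
  fixes p :: "real \<Rightarrow> 'a::metric_space"
  assumes "path p" "path_image p \<subseteq> S"
  shows "homotopic_paths S (reversepath p +++ p) (\<lambda>_. pathfinish p)"
  using homotopic_paths_rinverse[of "reversepath p" S] assms by simp

lemma homotopic_loops_null_imp_paths:
  fixes p :: "real \<Rightarrow> 'a::metric_space"
  assumes "homotopic_loops S (p +++ reversepath q) (\<lambda>_. a)" "path q"
  shows "homotopic_paths S p q"
proof (rule homotopic_paths_kuratowski, rule homotopic_paths_loop_parts)
  have "homotopic_loops (kuratowski ` S) (kuratowski \<circ> (p +++ reversepath q)) (kuratowski \<circ> (\<lambda>_. a))"
    by (rule homotopic_loops_continuous_image[OF assms(1)]) (auto intro: continuous_on_kuratowski)
  then show "homotopic_loops (kuratowski ` S) ((kuratowski \<circ> p) +++ reversepath (kuratowski \<circ> q)) (linepath (kuratowski a) (kuratowski a))"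
    by (simp add: path_compose_join path_compose_reversepath linepath_refl)
qed (simp add: assms path_kuratowski)

section \<open>Simply connected metric spaces\<close>

lemma simply_connected_path_connected:
  fixes X :: "'a::metric_space set"
  assumes "simply_connected X"
  shows "path_connected X"
  by (meson assms homeomorphic_kuratowski homeomorphic_path_connectedness homeomorphic_simply_connected
      simply_connected_imp_path_connected)

lemma simply_connected_homotopic_paths:
  fixes X :: "'a::metric_space set"
  assumes "simply_connected X" "path p" "path q" "path_image p \<subseteq> X" "path_image q \<subseteq> X"
    "pathstart p = pathstart q" "pathfinish p = pathfinish q"
  shows "homotopic_paths X p q"
proof (rule homotopic_loops_null_imp_paths)
  have "pathstart p \<in> X"
    using assms by (meson pathstart_in_path_image subsetD)
  then have "path (\<lambda>_. pathstart p)" "path_image (\<lambda>_. pathstart p) \<subseteq> X"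
    by (auto simp: path_def path_image_def)
  moreover have "path (p +++ reversepath q)" "path_image (p +++ reversepath q) \<subseteq> X"
    using assms by (auto intro: path_join_imp simp: path_image_join)
  ultimately show "homotopic_loops X (p +++ reversepath q) (\<lambda>_. pathstart p)"
    using assms(1,6) unfolding simply_connected_def
    by (simp add: pathstart_def pathfinish_def joinpaths_def reversepath_def)
qed (fact assms)

lemma continuous_integer_valued_constant:
  fixes f :: "'a::topological_space \<Rightarrow> real"
  assumes "connected S" "continuous_on S f" "\<And>x. x \<in> S \<Longrightarrow> f x \<in> \<int>"
  shows "f constant_on S"
proof (rule continuous_discrete_range_constant[OF assms(1,2)])
  show "\<exists>e>0. \<forall>y. y \<in> S \<and> f y \<noteq> f x \<longrightarrow> e \<le> norm (f y - f x)" if "x \<in> S" for x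
    using that assms(3) by (intro exI[of _ 1]) (auto intro: Ints_nonzero_abs_ge1)
qed

lemma simply_connected_continuous_logarithm:
  fixes X :: "'a::metric_space set" and f :: "'a \<Rightarrow> complex"
  assumes X: "simply_connected X" "locally path_connected X"
    and f: "continuous_on X f" "\<And>x. x \<in> X \<Longrightarrow> f x \<noteq> 0"
  obtains g where "continuous_on X g" "\<And>x. x \<in> X \<Longrightarrow> f x = exp (g x)"
proof -
  have sc: "simply_connected (kuratowski ` X)"
    using X homeomorphic_kuratowski homeomorphic_simply_connected by blast
  have lpc: "locally path_connected (kuratowski ` X)"
    using X(2) homeomorphic_locally[OF homeomorphic_kuratowski[of X], of path_connected path_connected]
    by (simp add: homeomorphic_path_connectedness)
  have "continuous_on (kuratowski ` X) (f \<circ> inv_into UNIV kuratowski)"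
    using f(1) by (intro continuous_on_compose continuous_on_inv_kuratowski) (auto simp: image_image)
  then obtain g where g: "continuous_on (kuratowski ` X) g"
    "\<And>y. y \<in> kuratowski ` X \<Longrightarrow> (f \<circ> inv_into UNIV kuratowski) y = exp (g y)"
    by (rule continuous_logarithm_on_simply_connected[OF _ sc lpc]) (use f(2) in auto)
  show ?thesis
  proof
    show "continuous_on X (g \<circ> kuratowski)"
      using g(1) by (intro continuous_on_compose continuous_on_kuratowski)
    show "f x = exp ((g \<circ> kuratowski) x)" if "x \<in> X" for x
      using g(2)[of "kuratowski x"] that by simp
  qed
qed

text \<open>
  Suppose that \<open>S \<inter> T\<close> splits into \<open>A\<close> and \<open>B\<close>, and let \<open>u\<close> be a Urysohn function that is \<open>0\<close> on \<open>A\<close>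
  and \<open>1\<close> on \<open>B\<close>. The map to the circle with angle \<open>pi * u\<close> on \<open>S\<close> and \<open>- pi * u\<close> on \<open>T\<close> goes once
  around on the way from \<open>A\<close> through \<open>S\<close> to \<open>B\<close> and back through \<open>T\<close>. But it has a continuous
  logarithm, whose imaginary part differs from these angles by constants on \<open>S\<close> and on \<open>T\<close>. The two
  constants agree on \<open>A\<close> and differ on \<open>B\<close>.
\<close>
lemma simply_connected_unicoherent:
  fixes X :: "'a::metric_space set"
  assumes X: "simply_connected X" "locally path_connected X"
  shows "unicoherent X"
proof
  fix S T assume ST: "connected S" "connected T" "X = S \<union> T"
    "closedin (top_of_set X) S" "closedin (top_of_set X) T"
  show "connected (S \<inter> T)"
  proof (rule ccontr)
    assume "\<not> connected (S \<inter> T)"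
    then obtain A B where AB: "closedin (top_of_set (S \<inter> T)) A" "closedin (top_of_set (S \<inter> T)) B"
      "A \<union> B = S \<inter> T" "A \<inter> B = {}" "A \<noteq> {}" "B \<noteq> {}"
      unfolding connected_closedin_eq by blast
    have cl: "closedin (top_of_set X) A" "closedin (top_of_set X) B"
      using AB ST closedin_trans by blast+
    define u where "u x = infdist x A / (infdist x A + infdist x B)" for x
    have pos: "infdist x A + infdist x B > 0" if "x \<in> X" for x
    proof -
      have "x \<notin> A \<or> x \<notin> B" using AB by blast
      moreover have "x \<in> C" if C: "closedin (top_of_set X) C" "infdist x C = 0" "C \<noteq> {}" for C
      proof -
        obtain F where "closed F" "C = X \<inter> F" using C(1) by (auto simp: closedin_closed)
        moreover have "x \<in> closure C" using C in_closure_iff_infdist_zero[of C x] by simp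
        ultimately show ?thesis using \<open>x \<in> X\<close> closure_minimal[of C F] by blast
      qed
      ultimately show ?thesis
        using cl AB(5,6) infdist_nonneg[of x A] infdist_nonneg[of x B]
        by (smt (verit))
    qed
    have u: "continuous_on X u" "\<And>x. x \<in> A \<Longrightarrow> u x = 0" "\<And>x. x \<in> B \<Longrightarrow> u x = 1"
    proof -
      show "continuous_on X u"
        unfolding u_def using pos by (intro continuous_intros) (metis less_irrefl)
      show "u x = 0" if "x \<in> A" for x using that by (simp add: u_def)
      show "u x = 1" if "x \<in> B" for x
      proof -
        have "x \<in> X" using that cl(2) closedin_imp_subset by blast
        then show ?thesis using pos[of x] that by (simp add: u_def)
      qed
    qed
    define f where "f x = (if x \<in> S then cis (pi * u x) else cis (- pi * u x))" for x
    have "continuous_on (S \<union> T) f"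
      unfolding f_def
    proof (rule continuous_on_cases_local)
      show "closedin (top_of_set (S \<union> T)) S" "closedin (top_of_set (S \<union> T)) T"
        using ST by auto
      show "continuous_on S (\<lambda>x. cis (pi * u x))" "continuous_on T (\<lambda>x. cis (- pi * u x))"
        using ST(3) u(1) by (auto intro!: continuous_intros intro: continuous_on_subset)
      fix x assume "x \<in> S \<and> x \<notin> S \<or> x \<in> T \<and> x \<in> S"
      then have "u x = 0 \<or> u x = 1" using AB u(2,3)[of x] by auto
      then show "cis (pi * u x) = cis (- pi * u x)"
        by (auto simp: cis.ctr complex_eq_iff)
    qed
    moreover have "f x \<noteq> 0" for x by (simp add: f_def)
    ultimately obtain g where g: "continuous_on X g" "\<And>x. x \<in> X \<Longrightarrow> f x = exp (g x)"
      using simply_connected_continuous_logarithm[OF X, of f] ST(3) by metis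
    have int: "\<exists>n::int. Im (g x) = a + 2 * of_int n * pi" if "f x = cis a" "x \<in> X" for x a
    proof -
      have "exp (g x) = exp (\<i> * of_real a)"
        using that g(2) by (simp add: cis_conv_exp)
      then show ?thesis unfolding exp_eq by auto
    qed
    define hS where "hS x = (Im (g x) - pi * u x) / (2 * pi)" for x
    define hT where "hT x = (Im (g x) + pi * u x) / (2 * pi)" for x
    have "hS x \<in> \<int>" if "x \<in> S" for x
      using int[of x "pi * u x"] that ST(3) by (auto simp: f_def hS_def)
    moreover have "continuous_on S hS"
      unfolding hS_def using ST(3) u(1) g(1) by (auto intro!: continuous_intros intro: continuous_on_subset)
    moreover have "hT x \<in> \<int>" if "x \<in> T" for x
    proof -
      have "f x = cis (- pi * u x)"
      proof (cases "x \<in> S")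
        case True
        then have "u x = 0 \<or> u x = 1" using AB u(2,3)[of x] that by auto
        then show ?thesis using True by (auto simp: f_def cis.ctr complex_eq_iff)
      qed (simp add: f_def)
      then show ?thesis using int[of x "- pi * u x"] that ST(3) by (auto simp: hT_def)
    qed
    moreover have "continuous_on T hT"
      unfolding hT_def using ST(3) u(1) g(1) by (auto intro!: continuous_intros intro: continuous_on_subset)
    ultimately have "hS constant_on S" "hT constant_on T"
      using ST(1,2) by (auto intro: continuous_integer_valued_constant)
    then obtain c d where c: "\<And>x. x \<in> S \<Longrightarrow> hS x = c" and d: "\<And>x. x \<in> T \<Longrightarrow> hT x = d"
      unfolding constant_on_def by metis
    obtain a b where ab: "a \<in> A" "b \<in> B" using AB by blast
    then have "a \<in> S" "a \<in> T" "b \<in> S" "b \<in> T" "u a = 0" "u b = 1"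
      using AB u(2,3) by auto
    then show False
      using c[of a] c[of b] d[of a] d[of b] by (simp add: hS_def hT_def field_simps)
  qed
qed

section \<open>Local triviality of absolute neighbourhood retracts\<close>

text \<open>
  Let \<open>h\<close> be a convex combination of the images of points \<open>x\<close>, with weights \<open>u\<close>. Evaluated at \<open>a\<close>,
  the difference of \<open>h\<close> and the image of \<open>a\<close> is the weighted mean of the distances \<open>dist x a\<close>. So if the
  image of \<open>a\<close> is close to \<open>h\<close>, then \<open>a\<close> is close to every \<open>x\<close> of positive weight, and a limit \<open>h\<close>
  of such images is the image of \<open>x\<close>.
\<close>
lemma closedin_kuratowski_convex_hull:
  "closedin (top_of_set (convex hull (kuratowski ` X))) (kuratowski ` X)"
proof -
  have "h \<in> kuratowski ` X" if h: "h \<in> convex hull (kuratowski ` X)" and cl: "h \<in> closure (kuratowski ` X)" for h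
  proof -
    obtain S u where S: "finite S" "S \<subseteq> kuratowski ` X" and u: "\<And>f. f \<in> S \<Longrightarrow> 0 \<le> u f" "sum u S = 1"
      and h_eq: "h = (\<Sum>f\<in>S. u f *\<^sub>R f)"
      using h unfolding convex_hull_explicit by blast
    obtain f where f: "f \<in> S" "u f > 0"
      using u by (metis less_eq_real_def not_one_le_zero sum_nonpos order_refl)
    obtain x where x: "x \<in> X" "f = kuratowski x"
      using f S by auto
    have near: "u f * dist x a \<le> dist (kuratowski a) h" for a
    proof -
      have "apply_bcontfun h a = (\<Sum>f\<in>S. u f * apply_bcontfun f a)"
        unfolding h_eq by (induction S rule: infinite_finite_induct) auto
      also have "\<dots> = (\<Sum>f\<in>S. u f * (dist (inv_into UNIV kuratowski f) a - dist undefined a))"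
        using S by (intro sum.cong refl) (auto simp: apply_kuratowski)
      also have "\<dots> = (\<Sum>f\<in>S. u f * dist (inv_into UNIV kuratowski f) a) - dist undefined a"
        using u(2) by (simp add: right_diff_distrib sum_subtractf flip: sum_distrib_right)
      finally have "apply_bcontfun h a - apply_bcontfun (kuratowski a) a
          = (\<Sum>f\<in>S. u f * dist (inv_into UNIV kuratowski f) a)"
        by (simp add: apply_kuratowski)
      moreover have "u f * dist x a \<le> (\<Sum>f\<in>S. u f * dist (inv_into UNIV kuratowski f) a)"
        using member_le_sum[of f S "\<lambda>f. u f * dist (inv_into UNIV kuratowski f) a"] f S(1) u x by auto
      moreover have "\<bar>apply_bcontfun h a - apply_bcontfun (kuratowski a) a\<bar> \<le> dist (kuratowski a) h"
        using dist_bounded[of "kuratowski a" a h] by (simp add: dist_real_def)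
      ultimately show ?thesis by linarith
    qed
    have "dist h f \<le> 0"
    proof (rule field_le_epsilon)
      fix e :: real assume "e > 0"
      define d where "d = min (e/2) (u f * (e/2))"
      have "d > 0" using \<open>e > 0\<close> f by (simp add: d_def)
      then obtain a where a: "a \<in> X" "dist (kuratowski a) h < d"
        using cl unfolding closure_approachable by auto
      have "u f * dist x a < u f * (e/2)"
        using near[of a] a by (simp add: d_def)
      then have "dist x a < e/2" using f by simp
      then have "dist (kuratowski x) (kuratowski a) < e/2" by simp
      then have "dist h f < e/2 + e/2"
        using a dist_triangle[of h f "kuratowski a"] unfolding x(2) d_def
        by (simp add: dist_commute)
      then show "dist h f \<le> 0 + e" by simp
    qed
    then show ?thesis using x by auto
  qed
  then show ?thesis
    unfolding closedin_limpt using hull_subset[of "kuratowski ` X"] by (auto simp: closure_def)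
qed

text \<open>
  The neighbourhood retract property speaks of topologies on \<open>'a \<Rightarrow> real\<close>; the convex hull becomes
  one of these by forgetting that its elements are bounded and continuous.
\<close>
lemma metric_ANR_retraction:
  fixes X :: "'a::metric_space set"
  assumes "metric_ANR X"
  obtains U \<rho> where "openin (top_of_set (convex hull (kuratowski ` X))) U" "kuratowski ` X \<subseteq> U"
    "continuous_on U \<rho>" "\<rho> \<in> U \<rightarrow> X" "\<And>x. x \<in> X \<Longrightarrow> \<rho> (kuratowski x) = x"
proof -
  define H where "H = convex hull (kuratowski ` X)"
  define Y :: "('a \<Rightarrow> real) topology" where "Y = pullback_topology (apply_bcontfun ` H) Bcontfun (top_of_set H)"
  define S where "S = apply_bcontfun ` kuratowski ` X"
  have KH: "kuratowski ` X \<subseteq> H" by (simp add: H_def hull_subset)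
  have topY: "topspace Y = apply_bcontfun ` H"
    by (auto simp: Y_def topspace_pullback_topology apply_bcontfun_inverse)
  have cB: "continuous_map Y (top_of_set H) Bcontfun"
    unfolding Y_def using continuous_map_pullback[OF continuous_map_id, of _ Bcontfun "top_of_set H"] by simp
  have cA: "continuous_map (top_of_set H) Y apply_bcontfun"
    unfolding Y_def
    by (rule continuous_map_pullback') (auto simp: o_def apply_bcontfun_inverse)
  have hom: "homeomorphic_maps (top_of_set H) Y apply_bcontfun Bcontfun"
    unfolding homeomorphic_maps_def using cA cB topY by (auto simp: apply_bcontfun_inverse)
  have homY: "homeomorphic_map (top_of_set H) Y apply_bcontfun"
    using hom homeomorphic_maps_map by blast
  have "metrizable_space Y"
    using homeomorphic_metrizable_space[OF homeomorphic_map_imp_homeomorphic_space[OF homY]]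
    by (simp add: metrizable_space_subtopology metrizable_space_euclidean)
  moreover have "closedin Y S"
    unfolding S_def using homY closedin_kuratowski_convex_hull[of X] KH
    by (simp add: homeomorphic_map_closedness_eq H_def[symmetric])
  moreover have "top_of_set X homeomorphic_space subtopology Y S"
  proof -
    have "top_of_set X homeomorphic_space top_of_set (kuratowski ` X)"
      unfolding homeomorphic_space_def
      by (intro exI[of _ kuratowski] exI[of _ "inv_into UNIV kuratowski"])
        (auto simp: homeomorphic_maps_def continuous_map_in_subtopology
          intro: continuous_on_kuratowski continuous_on_inv_kuratowski)
    also have "top_of_set (kuratowski ` X) = subtopology (top_of_set H) (kuratowski ` X)"
      using KH by (simp add: subtopology_subtopology Int_absorb1)
    also have "\<dots> homeomorphic_space subtopology Y S"
    proof (rule homeomorphic_map_imp_homeomorphic_space, rule homeomorphic_map_subtopologies[OF homY])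
      have "S \<subseteq> topspace Y" "topspace (top_of_set H) \<inter> kuratowski ` X = kuratowski ` X"
        using KH topY by (auto simp: S_def)
      then show "apply_bcontfun ` (topspace (top_of_set H) \<inter> kuratowski ` X) = topspace Y \<inter> S"
        by (simp add: S_def Int_absorb1)
    qed
    finally show ?thesis .
  qed
  ultimately have "metrizable_space Y \<and> closedin Y S \<and> top_of_set X homeomorphic_space subtopology Y S"
    by (intro conjI)
  from conjunct2[OF assms[unfolded metric_ANR_def], rule_format, OF this]
  obtain U where U: "openin Y U" "S \<subseteq> U" "S retract_of_space subtopology Y U"
    by (elim exE conjE)
  obtain r where r: "continuous_map (subtopology Y U) (subtopology (subtopology Y U) S) r"
    "\<And>f. f \<in> S \<Longrightarrow> r f = f"
    using U(3) unfolding retract_of_space_def by blast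
  define U' where "U' = {h \<in> H. apply_bcontfun h \<in> U}"
  define \<rho> where "\<rho> = inv_into UNIV kuratowski \<circ> (Bcontfun \<circ> (r \<circ> apply_bcontfun))"
  show ?thesis
  proof
    show "openin (top_of_set (convex hull (kuratowski ` X))) U'"
      unfolding U'_def H_def[symmetric] using openin_continuous_map_preimage[OF cA U(1)] by simp
    show "kuratowski ` X \<subseteq> U'"
      using KH U(2) by (auto simp: U'_def S_def)
    have 1: "continuous_map (top_of_set U') (subtopology Y U) apply_bcontfun"
    proof -
      have "continuous_map (subtopology (top_of_set H) U') Y apply_bcontfun"
        using cA continuous_map_from_subtopology by blast
      moreover have "subtopology (top_of_set H) U' = top_of_set U'"
        by (simp add: subtopology_subtopology Int_absorb1 U'_def)
      moreover have "apply_bcontfun \<in> U' \<rightarrow> U"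
        by (auto simp: U'_def)
      ultimately show ?thesis
        by (simp add: continuous_map_in_subtopology)
    qed
    have 2: "continuous_map (subtopology (subtopology Y U) S) (top_of_set (kuratowski ` X)) Bcontfun"
    proof -
      have "continuous_map (subtopology (subtopology Y U) S) (top_of_set H) Bcontfun"
        using cB continuous_map_from_subtopology by blast
      then have "continuous_map (subtopology (subtopology Y U) S) euclidean Bcontfun"
        by (simp add: continuous_map_in_subtopology)
      then show ?thesis
        by (auto simp: continuous_map_in_subtopology S_def apply_bcontfun_inverse)
    qed
    have 3: "continuous_map (top_of_set (kuratowski ` X)) (top_of_set X) (inv_into UNIV kuratowski)"
      using continuous_on_inv_kuratowski by (auto simp: continuous_map_in_subtopology)
    have "continuous_map (top_of_set U') (top_of_set X) \<rho>"
      unfolding \<rho>_def by (intro continuous_map_compose[OF _ 3] continuous_map_compose[OF _ 2]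
          continuous_map_compose[OF 1 r(1)])
    then show "continuous_on U' \<rho>" "\<rho> \<in> U' \<rightarrow> X"
      by (auto simp: continuous_map_in_subtopology)
    show "\<rho> (kuratowski x) = x" if "x \<in> X" for x
      using that r(2) by (simp add: \<rho>_def S_def apply_bcontfun_inverse)
  qed
qed

text \<open>
  Small balls of the convex hull are convex, so a homotopy along straight segments in such a ball,
  followed by the retraction, stays close to the given point of \<open>X\<close>.
\<close>
lemma metric_ANR_locally_trivial:
  fixes X :: "'a::metric_space set"
  assumes ANR: "metric_ANR X" and V: "openin (top_of_set X) V" "x \<in> V"
  obtains W where "openin (top_of_set X) W" "x \<in> W" "W \<subseteq> V"
    "\<And>y. y \<in> W \<Longrightarrow> \<exists>p. path p \<and> path_image p \<subseteq> V \<and> pathstart p = x \<and> pathfinish p = y"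
    "\<And>p q. \<lbrakk>path p; path q; path_image p \<subseteq> W; path_image q \<subseteq> W; pathstart p = pathstart q;
       pathfinish p = pathfinish q\<rbrakk> \<Longrightarrow> homotopic_paths V p q"
proof -
  obtain U \<rho> where U: "openin (top_of_set (convex hull (kuratowski ` X))) U" "kuratowski ` X \<subseteq> U"
    and \<rho>: "continuous_on U \<rho>" "\<rho> \<in> U \<rightarrow> X" "\<And>x. x \<in> X \<Longrightarrow> \<rho> (kuratowski x) = x"
    using metric_ANR_retraction[OF ANR] by metis
  define H where "H = convex hull (kuratowski ` X)"
  have "x \<in> X" using V openin_imp_subset by blast
  have "openin (top_of_set U) (U \<inter> \<rho> -` V)"
    using continuous_openin_preimage[OF \<rho>(1) \<rho>(2) V(1)] .
  then have "openin (top_of_set H) (U \<inter> \<rho> -` V)"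
    using U(1) openin_trans unfolding H_def by blast
  moreover have "kuratowski x \<in> U \<inter> \<rho> -` V"
    using \<open>x \<in> X\<close> U(2) \<rho>(3) V by auto
  ultimately obtain e where e: "e > 0" "ball (kuratowski x) e \<inter> H \<subseteq> U \<inter> \<rho> -` V"
    unfolding openin_contains_ball by blast
  define B where "B = ball (kuratowski x) e \<inter> H"
  have B: "convex B" "B \<subseteq> U" "\<rho> ` B \<subseteq> V"
    using e unfolding B_def H_def by (auto intro: convex_Int)
  have c\<rho>: "continuous_on B \<rho>" using \<rho>(1) B continuous_on_subset by blast
  define W where "W = X \<inter> ball x e"
  have KW: "kuratowski y \<in> B" if "y \<in> W" for y
    using that hull_subset[of "kuratowski ` X" convex] by (auto simp: W_def B_def H_def)
  show ?thesis
  proof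
    show "openin (top_of_set X) W" by (simp add: W_def openin_open_Int)
    show "x \<in> W" using \<open>x \<in> X\<close> e by (simp add: W_def)
    then have xB: "kuratowski x \<in> B" by (rule KW)
    show "W \<subseteq> V"
    proof
      fix y assume "y \<in> W"
      then show "y \<in> V" using KW[of y] B(3) \<rho>(3)[of y] by (auto simp: W_def image_subset_iff)
    qed
    show "\<exists>p. path p \<and> path_image p \<subseteq> V \<and> pathstart p = x \<and> pathfinish p = y" if "y \<in> W" for y
    proof (intro exI conjI)
      let ?p = "\<rho> \<circ> linepath (kuratowski x) (kuratowski y)"
      have sub: "path_image (linepath (kuratowski x) (kuratowski y)) \<subseteq> B"
        using xB KW[OF that] B(1) by (simp add: closed_segment_subset)
      then show "path ?p"
        using c\<rho> continuous_on_subset by (intro path_continuous_image) auto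
      show "path_image ?p \<subseteq> V" using sub B(3) by (auto simp: path_image_compose)
      show "pathstart ?p = x" "pathfinish ?p = y"
        using \<rho>(3) that \<open>x \<in> X\<close> by (auto simp: pathstart_compose pathfinish_compose W_def)
    qed
    show "homotopic_paths V p q"
      if p: "path p" "path q" "path_image p \<subseteq> W" "path_image q \<subseteq> W" "pathstart p = pathstart q"
        "pathfinish p = pathfinish q" for p q
    proof -
      have KB: "kuratowski (p t) \<in> B" "kuratowski (q t) \<in> B" if "t \<in> {0..1}" for t
        using that p(3,4) KW by (auto simp: path_image_def image_subset_iff)
      have "homotopic_paths B (kuratowski \<circ> p) (kuratowski \<circ> q)"
        using p KB B(1) by (intro homotopic_paths_linear path_kuratowski)
          (auto simp: pathstart_compose pathfinish_compose closed_segment_subset)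
      then have "homotopic_paths V (\<rho> \<circ> (kuratowski \<circ> p)) (\<rho> \<circ> (kuratowski \<circ> q))"
        by (rule homotopic_paths_continuous_image[where h = \<rho>]) (use c\<rho> B(3) in auto)
      then have *: "homotopic_paths V (\<rho> \<circ> (kuratowski \<circ> p)) q" if "\<forall>t\<in>{0..1}. (\<rho> \<circ> (kuratowski \<circ> q)) t = q t"
        using that homotopic_paths_trans homotopic_paths_eq homotopic_paths_imp_path homotopic_paths_imp_subset
        by meson
      have eq: "\<forall>t\<in>{0..1}. (\<rho> \<circ> (kuratowski \<circ> q)) t = q t" "\<forall>t\<in>{0..1}. p t = (\<rho> \<circ> (kuratowski \<circ> p)) t"
        using p(3,4) \<rho>(3) by (auto simp: path_image_def W_def image_subset_iff)
      have "homotopic_paths V p (\<rho> \<circ> (kuratowski \<circ> p))"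
        using p(1,3) \<open>W \<subseteq> V\<close> eq(2) by (intro homotopic_paths_eq) auto
      then show ?thesis using *[OF eq(1)] homotopic_paths_trans by blast
    qed
  qed
qed

lemma metric_ANR_locally_path_connected:
  fixes X :: "'a::metric_space set"
  assumes "metric_ANR X"
  shows "locally path_connected X"
  unfolding locally_path_connected_im_kleinen
proof (intro allI impI, elim conjE)
  fix V x assume "openin (top_of_set X) V" "x \<in> V"
  from metric_ANR_locally_trivial[OF assms this] show
    "\<exists>u. openin (top_of_set X) u \<and> x \<in> u \<and> u \<subseteq> V \<and>
          (\<forall>y. y \<in> u \<longrightarrow> (\<exists>p. path p \<and> path_image p \<subseteq> V \<and> pathstart p = x \<and> pathfinish p = y))"
    by metis
qed

section \<open>The fundamental groupoid\<close>

definition path_in :: "'a::topological_space set \<Rightarrow> (real \<Rightarrow> 'a) \<Rightarrow> bool" where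
  "path_in S p \<longleftrightarrow> path p \<and> path_image p \<subseteq> S"

lemma path_in_join [simp, intro]:
  "\<lbrakk>path_in S p; path_in S q; pathfinish p = pathstart q\<rbrakk> \<Longrightarrow> path_in S (p +++ q)"
  by (simp add: path_in_def path_image_join)

lemma path_in_joinD:
  "\<lbrakk>path_in S (p +++ q); pathfinish p = pathstart q\<rbrakk> \<Longrightarrow> path_in S p \<and> path_in S q"
  by (simp add: path_in_def path_image_join)

lemma path_in_reversepath [simp]: "path_in S (reversepath p) \<longleftrightarrow> path_in S p"
  by (simp add: path_in_def)

lemma path_in_const [simp]: "path_in S (\<lambda>_. a) \<longleftrightarrow> a \<in> S"
  by (auto simp: path_in_def path_def path_image_def)

lemma pathstart_const [simp]: "pathstart (\<lambda>_. a) = a" and pathfinish_const [simp]: "pathfinish (\<lambda>_. a) = a"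
  by (auto simp: pathstart_def pathfinish_def)

lemma path_in_mono: "\<lbrakk>path_in S p; S \<subseteq> T\<rbrakk> \<Longrightarrow> path_in T p"
  by (auto simp: path_in_def)

lemma path_in_ends: "path_in S p \<Longrightarrow> pathstart p \<in> S" "path_in S p \<Longrightarrow> pathfinish p \<in> S"
  by (auto simp: path_in_def)

lemma path_in_pathD: "path_in S p \<Longrightarrow> t \<in> {0..1} \<Longrightarrow> p t \<in> S"
  by (auto simp: path_in_def path_image_def)

lemma path_in_compose:
  "\<lbrakk>path_in S p; continuous_on S f; f \<in> S \<rightarrow> T\<rbrakk> \<Longrightarrow> path_in T (f \<circ> p)"
  by (auto simp: path_in_def path_image_compose intro: path_continuous_image continuous_on_subset)

lemma path_connected_path_in:
  "path_connected S \<Longrightarrow> x \<in> S \<Longrightarrow> y \<in> S \<Longrightarrow> \<exists>p. path_in S p \<and> pathstart p = x \<and> pathfinish p = y"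
  unfolding path_connected_def path_in_def by blast

text \<open>
  The piece of \<open>r\<close> from parameter \<open>a\<close> to \<open>b\<close>, traversed backwards if \<open>b < a\<close>.
\<close>
definition seg :: "(real \<Rightarrow> 'a) \<Rightarrow> real \<Rightarrow> real \<Rightarrow> real \<Rightarrow> 'a" where
  "seg r a b = r \<circ> linepath a b"

lemma pathstart_seg [simp]: "pathstart (seg r a b) = r a" and pathfinish_seg [simp]: "pathfinish (seg r a b) = r b"
  by (simp_all add: seg_def pathstart_compose pathfinish_compose)

lemma seg_0: "seg r 0 b = (\<lambda>t. r (b * t))"
  by (simp add: seg_def linepath_def fun_eq_iff mult.commute)

lemma seg_refl [simp]: "seg r a a = (\<lambda>_. r a)"
  by (simp add: seg_def linepath_refl fun_eq_iff)

lemma seg_0_1 [simp]: "seg r 0 1 = r"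
  by (simp add: seg_def fun_eq_iff linepath_def)

lemma reversepath_seg [simp]: "reversepath (seg r a b) = seg r b a"
  by (simp add: seg_def flip: path_compose_reversepath)

lemma path_image_seg: "path_image (seg r a b) = r ` closed_segment a b"
  by (simp add: seg_def path_image_compose)

lemma path_in_seg:
  assumes "continuous_on I r" "r ` closed_segment a b \<subseteq> S" "closed_segment a b \<subseteq> I"
  shows "path_in S (seg r a b)"
  using assms unfolding path_in_def path_image_seg
  by (auto simp: seg_def intro!: path_continuous_image intro: continuous_on_subset)

lemma path_in_seg_path: "\<lbrakk>path_in S p; a \<in> {0..1}; b \<in> {0..1}\<rbrakk> \<Longrightarrow> path_in S (seg p a b)"
  using path_in_seg[of "{0..1}" p a b S] closed_segment_subset[of a "{0..1}" b]
  by (auto simp: path_in_def path_def path_image_def image_subset_iff)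

lemma homotopic_seg_join:
  assumes r: "continuous_on I r" "r ` I \<subseteq> S" and I: "convex I" "a \<in> I" "b \<in> I" "c \<in> I"
  shows "homotopic_paths S (seg r a b +++ seg r b c) (seg r a c)"
proof -
  have "closed_segment ((linepath a b +++ linepath b c) t) (linepath a c t) \<subseteq> I" if "t \<in> {0..1}" for t
  proof (rule closed_segment_subset[OF _ _ I(1)])
    have "path_image (linepath a b +++ linepath b c) \<subseteq> I" "path_image (linepath a c) \<subseteq> I"
      using I by (auto simp: path_image_join closed_segment_subset)
    then show "(linepath a b +++ linepath b c) t \<in> I" "linepath a c t \<in> I"
      using that by (auto simp: path_image_def)
  qed
  then have "homotopic_paths I (linepath a b +++ linepath b c) (linepath a c)"
    by (intro homotopic_paths_linear) auto
  then have "homotopic_paths S (r \<circ> (linepath a b +++ linepath b c)) (r \<circ> linepath a c)"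
    by (rule homotopic_paths_continuous_image) (use r in auto)
  then show ?thesis by (simp add: seg_def path_compose_join)
qed

lemma path_locally_in_open:
  assumes \<gamma>: "path_in S \<gamma>" and V: "openin (top_of_set S) V" and t: "t \<in> {0..1}" "\<gamma> t \<in> V"
  obtains \<epsilon> where "\<epsilon> > 0" "\<And>s. s \<in> {0..1} \<inter> ball t \<epsilon> \<Longrightarrow> path_in V (seg \<gamma> t s)"
proof -
  have cont: "continuous_on {0..1} \<gamma>" and "\<gamma> \<in> {0..1} \<rightarrow> S"
    using \<gamma> by (auto simp: path_in_def path_def path_image_def)
  then have "openin (top_of_set {0..1}) ({0..1} \<inter> \<gamma> -` V)"
    using V by (rule continuous_openin_preimage)
  moreover have "t \<in> {0..1} \<inter> \<gamma> -` V" using t by simp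
  ultimately obtain \<epsilon> where \<epsilon>: "\<epsilon> > 0" "ball t \<epsilon> \<inter> {0..1} \<subseteq> {0..1} \<inter> \<gamma> -` V"
    unfolding openin_contains_ball by blast
  have "path_in V (seg \<gamma> t s)" if "s \<in> {0..1} \<inter> ball t \<epsilon>" for s
  proof (rule path_in_seg[OF cont])
    have "closed_segment t s \<subseteq> ball t \<epsilon> \<inter> {0..1}"
      using that t(1) \<epsilon>(1) by (intro closed_segment_subset) (auto intro: convex_Int)
    then show "closed_segment t s \<subseteq> {0..1}" "\<gamma> ` closed_segment t s \<subseteq> V"
      using \<epsilon>(2) by auto
  qed
  then show ?thesis using that \<epsilon>(1) by blast
qed

lemma homotopic_seg_join_path:
  "\<lbrakk>path_in S p; a \<in> {0..1}; b \<in> {0..1}; c \<in> {0..1}\<rbrakk>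
    \<Longrightarrow> homotopic_paths S (seg p a b +++ seg p b c) (seg p a c)"
  by (rule homotopic_seg_join[of "{0..1}"]) (auto simp: path_in_def path_def path_image_def)

lemma homotopic_paths_path_in: "homotopic_paths S p q \<Longrightarrow> path_in S p \<and> path_in S q"
  using homotopic_paths_imp_path homotopic_paths_imp_subset unfolding path_in_def by blast

lemma homotopic_paths_ends:
  "homotopic_paths S p q \<Longrightarrow> pathstart p = pathstart q \<and> pathfinish p = pathfinish q"
  using homotopic_paths_imp_pathstart homotopic_paths_imp_pathfinish by blast

lemma hom_refl: "path_in S p \<Longrightarrow> homotopic_paths S p p"
  by (simp add: path_in_def)

lemma hom_assoc:
  "\<lbrakk>path_in S p; path_in S q; path_in S r; pathfinish p = pathstart q; pathfinish q = pathstart r\<rbrakk>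
    \<Longrightarrow> homotopic_paths S ((p +++ q) +++ r) (p +++ (q +++ r))"
  by (simp add: path_in_def homotopic_paths_assoc homotopic_paths_sym)

lemma hom_rconst:
  fixes p :: "real \<Rightarrow> 'a::metric_space"
  shows "\<lbrakk>path_in S p; a = pathfinish p\<rbrakk> \<Longrightarrow> homotopic_paths S (p +++ (\<lambda>_. a)) p"
  by (simp add: path_in_def homotopic_paths_rconst)

lemma hom_lconst:
  fixes p :: "real \<Rightarrow> 'a::metric_space"
  shows "\<lbrakk>path_in S p; a = pathstart p\<rbrakk> \<Longrightarrow> homotopic_paths S ((\<lambda>_. a) +++ p) p"
  by (simp add: path_in_def homotopic_paths_lconst)

lemma hom_left: "\<lbrakk>homotopic_paths S q q'; path_in S p; pathfinish p = pathstart q\<rbrakk>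
    \<Longrightarrow> homotopic_paths S (p +++ q) (p +++ q')"
  by (rule homotopic_paths_join) (auto simp: path_in_def)

lemma hom_right: "\<lbrakk>homotopic_paths S p p'; path_in S q; pathfinish p = pathstart q\<rbrakk>
    \<Longrightarrow> homotopic_paths S (p +++ q) (p' +++ q)"
  by (rule homotopic_paths_join) (auto simp: path_in_def)

lemma hom_rinv:
  fixes p :: "real \<Rightarrow> 'a::metric_space"
  assumes "path_in S u" "path_in S p" "pathfinish u = pathstart p"
  shows "homotopic_paths S ((u +++ p) +++ reversepath p) u"
proof -
  have "homotopic_paths S ((u +++ p) +++ reversepath p) (u +++ (p +++ reversepath p))"
    using assms by (intro hom_assoc) auto
  also have "homotopic_paths S \<dots> (u +++ (\<lambda>_. pathstart p))"
    using assms by (intro hom_left homotopic_paths_rinverse) (auto simp: path_in_def)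
  also have "homotopic_paths S \<dots> u"
    using assms by (intro hom_rconst) auto
  finally show ?thesis .
qed

lemma hom_linv:
  fixes p :: "real \<Rightarrow> 'a::metric_space"
  assumes "path_in S u" "path_in S p" "pathfinish p = pathstart u"
  shows "homotopic_paths S (reversepath p +++ (p +++ u)) u"
proof -
  have "homotopic_paths S (reversepath p +++ (p +++ u)) ((reversepath p +++ p) +++ u)"
    using assms by (intro homotopic_paths_sym[OF hom_assoc]) auto
  also have "homotopic_paths S \<dots> ((\<lambda>_. pathfinish p) +++ u)"
    using assms by (intro hom_right homotopic_paths_linverse) (auto simp: path_in_def)
  also have "homotopic_paths S \<dots> u"
    using assms by (intro hom_lconst) auto
  finally show ?thesis .
qed

lemma hom_move_right:
  fixes p :: "real \<Rightarrow> 'a::metric_space"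
  assumes "homotopic_paths S (u +++ p) v" "path_in S u" "path_in S p" "pathfinish u = pathstart p"
  shows "homotopic_paths S u (v +++ reversepath p)"
proof -
  have "homotopic_paths S u ((u +++ p) +++ reversepath p)"
    using hom_rinv[OF assms(2-4)] homotopic_paths_sym by blast
  also have "homotopic_paths S \<dots> (v +++ reversepath p)"
    using assms by (intro hom_right) auto
  finally show ?thesis .
qed

lemma hom_cancel_left:
  fixes p :: "real \<Rightarrow> 'a::metric_space"
  assumes "homotopic_paths S (p +++ q) (p +++ r)" "path_in S p" "path_in S q" "path_in S r"
    "pathfinish p = pathstart q" "pathfinish p = pathstart r"
  shows "homotopic_paths S q r"
proof -
  have "homotopic_paths S q (reversepath p +++ (p +++ q))"
    using hom_linv[of S q p] assms(2,3,5) homotopic_paths_sym by metis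
  also have "homotopic_paths S \<dots> (reversepath p +++ (p +++ r))"
    using assms by (intro hom_left[OF assms(1)]) simp_all
  also have "homotopic_paths S \<dots> r"
    using assms(2,4,6) by (intro hom_linv) simp_all
  finally show ?thesis .
qed

text \<open>
  A homotopy sweeps out a compact set only.
\<close>
lemma hom_compact_image:
  assumes "homotopic_paths S p q"
  obtains K where "compact K" "K \<subseteq> S" "homotopic_paths K p q"
proof -
  obtain h where h: "continuous_on ({0..1} \<times> {0..1}) h" "h \<in> ({0..1} \<times> {0..1}) \<rightarrow> S"
    "\<forall>x \<in> {0..1}. h (0,x) = p x" "\<forall>x \<in> {0..1}. h (1,x) = q x"
    "\<forall>t \<in> {0..1::real}. pathstart (h \<circ> Pair t) = pathstart p \<and> pathfinish (h \<circ> Pair t) = pathfinish p"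
    using assms unfolding homotopic_paths by auto
  show ?thesis
  proof
    show "compact (h ` ({0..1} \<times> {0..1}))"
      by (intro compact_continuous_image h(1) compact_Times) auto
    show "h ` ({0..1} \<times> {0..1}) \<subseteq> S" using h(2) by auto
    show "homotopic_paths (h ` ({0..1} \<times> {0..1})) p q"
      unfolding homotopic_paths using h by (intro exI[of _ h]) auto
  qed
qed

section \<open>Homotopies with compact room\<close>

locale tame_space =
  fixes X :: "'a::metric_space set"
  assumes simply_connected: "simply_connected X"
    and locally_compact: "locally compact X"
    and ANR: "metric_ANR X"
begin

abbreviation cpt :: "'a set \<Rightarrow> bool" where "cpt K \<equiv> compact K \<and> K \<subseteq> X"
abbreviation open_X :: "'a set \<Rightarrow> bool" where "open_X U \<equiv> openin (top_of_set X) U"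

lemma locally_path_connected: "locally path_connected X"
  by (rule metric_ANR_locally_path_connected[OF ANR])

lemma path_connected: "path_connected X"
  by (rule simply_connected_path_connected[OF simply_connected])

lemma path_connected_neighbourhood:
  assumes "open_X V" "x \<in> V"
  obtains W where "open_X W" "path_connected W" "x \<in> W" "W \<subseteq> V"
  using locally_path_connected[unfolded Homotopy.locally_path_connected, rule_format, of V x] assms by blast

lemma open_X_subset: "open_X U \<Longrightarrow> U \<subseteq> X"
  by (rule openin_imp_subset)

lemma small_neighbourhood:
  assumes "open_X V" "x \<in> V"
  obtains W K where "open_X W" "x \<in> W" "W \<subseteq> V" "path_connected W" "cpt K" "W \<subseteq> K"
    "\<And>p q. \<lbrakk>path_in W p; path_in W q; pathstart p = pathstart q; pathfinish p = pathfinish q\<rbrakk>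
       \<Longrightarrow> homotopic_paths K p q"
proof -
  have "x \<in> X" using assms open_X_subset by blast
  then obtain N K where N: "x \<in> N" "N \<subseteq> K" "cpt K" "open_X N"
    using bspec[OF locally_compact[unfolded Homotopy.locally_compact], of x] by blast
  obtain W1 where W1: "open_X W1" "x \<in> W1" "W1 \<subseteq> V \<inter> N"
    and hp: "\<And>p q. \<lbrakk>path p; path q; path_image p \<subseteq> W1; path_image q \<subseteq> W1; pathstart p = pathstart q;
       pathfinish p = pathfinish q\<rbrakk> \<Longrightarrow> homotopic_paths (V \<inter> N) p q"
    using metric_ANR_locally_trivial[OF ANR, of "V \<inter> N" x] assms N by (metis IntI openin_Int)
  obtain W where W: "open_X W" "path_connected W" "x \<in> W" "W \<subseteq> W1"
    using path_connected_neighbourhood[OF W1(1,2)] .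
  show ?thesis
  proof (rule that[OF W(1,3) _ W(2) N(3)])
    show "W \<subseteq> V" "W \<subseteq> K" using W W1 N by auto
    show "homotopic_paths K p q"
      if "path_in W p" "path_in W q" "pathstart p = pathstart q" "pathfinish p = pathfinish q" for p q
      using hp[of p q] that W(4) N(2) unfolding path_in_def
      by (meson homotopic_paths_subset le_infI2 order_trans)
  qed
qed

text \<open>
  Every compact set is covered by finitely many small sets, and up to homotopy there are only
  finitely many ways of joining two of these through a base point. So the homotopies that compare
  a path with a standard one need only a compact amount of room.
\<close>
lemma compact_paths_homotopic:
  assumes M: "cpt M"
  obtains K where "cpt K" "M \<subseteq> K"
    "\<And>p q. \<lbrakk>path_in M p; path_in M q; pathstart p = pathstart q; pathfinish p = pathfinish q\<rbrakk>
       \<Longrightarrow> homotopic_paths K p q"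
proof (cases "M = {}")
  case True
  show ?thesis
    by (rule that[of "{}"]) (auto simp: True path_in_def)
next
  case False
  then obtain x0 where x0: "x0 \<in> M" by blast
  define small where "small y W K \<longleftrightarrow> open_X W \<and> y \<in> W \<and> path_connected W \<and> cpt K \<and> W \<subseteq> K \<and>
      (\<forall>p q. path_in W p \<and> path_in W q \<and> pathstart p = pathstart q \<and> pathfinish p = pathfinish q \<longrightarrow>
        homotopic_paths K p q)" for y W K
  have "\<exists>W K. small y W K" if "y \<in> M" for y
  proof -
    have "open_X X" "y \<in> X" using M that by auto
    then obtain W K where "open_X W" "y \<in> W" "W \<subseteq> X" "path_connected W" "cpt K" "W \<subseteq> K"
      "\<And>p q. \<lbrakk>path_in W p; path_in W q; pathstart p = pathstart q; pathfinish p = pathfinish q\<rbrakk>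
         \<Longrightarrow> homotopic_paths K p q" by (rule small_neighbourhood) blast
    then have "small y W K" by (simp add: small_def)
    then show ?thesis by blast
  qed
  then obtain W K0 where WK: "\<And>y. y \<in> M \<Longrightarrow> small y (W y) (K0 y)" by metis
  then have W: "\<And>y. y \<in> M \<Longrightarrow> open_X (W y)" "\<And>y. y \<in> M \<Longrightarrow> y \<in> W y"
    "\<And>y. y \<in> M \<Longrightarrow> path_connected (W y)" "\<And>y. y \<in> M \<Longrightarrow> cpt (K0 y)" "\<And>y. y \<in> M \<Longrightarrow> W y \<subseteq> K0 y"
    and W_hom: "\<And>y p q. \<lbrakk>y \<in> M; path_in (W y) p; path_in (W y) q; pathstart p = pathstart q;
        pathfinish p = pathfinish q\<rbrakk> \<Longrightarrow> homotopic_paths (K0 y) p q"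
    unfolding small_def by simp_all
  have "\<exists>e>0. X \<inter> cball y e \<subseteq> W y" if "y \<in> M" for y
    using W(1,2)[OF that] unfolding openin_contains_cball by (metis inf_commute)
  then obtain e where e: "\<And>y. y \<in> M \<Longrightarrow> e y > 0" "\<And>y. y \<in> M \<Longrightarrow> X \<inter> cball y (e y) \<subseteq> W y"
    by metis
  have "\<exists>c. path_in X c \<and> pathstart c = x0 \<and> pathfinish c = y" if "y \<in> M" for y
    using path_connected_path_in[OF path_connected] x0 M that by blast
  then obtain c where c: "\<And>y. y \<in> M \<Longrightarrow> path_in X (c y)" "\<And>y. y \<in> M \<Longrightarrow> pathstart (c y) = x0"
    "\<And>y. y \<in> M \<Longrightarrow> pathfinish (c y) = y" by metis
  have "\<exists>d. path_in (W y) d \<and> pathstart d = y \<and> pathfinish d = x" if "y \<in> M" "x \<in> W y" for y x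
    using path_connected_path_in W(2,3)[of y] that by blast
  then obtain d where d: "\<And>y x. y \<in> M \<Longrightarrow> x \<in> W y \<Longrightarrow> path_in (W y) (d y x)"
    "\<And>y x. y \<in> M \<Longrightarrow> x \<in> W y \<Longrightarrow> pathstart (d y x) = y"
    "\<And>y x. y \<in> M \<Longrightarrow> x \<in> W y \<Longrightarrow> pathfinish (d y x) = x" by metis
  define K1 where "K1 y = K0 y \<union> path_image (c y)" for y
  have K1: "cpt (K1 y)" "W y \<subseteq> K1 y" "path_in (K1 y) (c y)" if "y \<in> M" for y
    using W(4,5)[OF that] c(1)[OF that] by (auto simp: K1_def path_in_def compact_path_image)
  define \<kappa> where "\<kappa> y x = c y +++ d y x" for y x
  have \<kappa>: "path_in (K1 y) (\<kappa> y x)" "pathstart (\<kappa> y x) = x0" "pathfinish (\<kappa> y x) = x" if "y \<in> M" "x \<in> W y" for y x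
    using K1(2,3)[OF that(1)] c[OF that(1)] d[OF that] by (auto simp: \<kappa>_def intro: path_in_mono)
  obtain I where I: "finite I" "I \<subseteq> M" "M \<subseteq> (\<Union>y\<in>I. ball y (e y))"
    using compactE_image[of M M "\<lambda>y. ball y (e y)"] M e(1)
    by (metis (no_types, lifting) UN_I centre_in_ball open_ball subsetI)
  \<comment> \<open>The balls are closed, so that a point close to \<open>x\<close> lies only in balls that also contain \<open>x\<close>.\<close>
  define P where "P x i \<longleftrightarrow> i \<in> I \<and> x \<in> cball i (e i)" for x i
  have P: "i \<in> M" "x \<in> W i" if "P x i" "x \<in> M" for x i
    using that I e(2)[of i] M by (auto simp: P_def subset_iff)
  define idx where "idx x = (SOME i. P x i)" for x
  have "\<exists>i. P x i" if "x \<in> M" for x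
    using that I(3) by (force simp: P_def)
  then have idx: "P x (idx x)" if "x \<in> M" for x
    unfolding idx_def by (rule someI_ex) (rule that)
  define near where "near x Q L \<longleftrightarrow> open_X Q \<and> x \<in> Q \<and> path_connected Q \<and> cpt L \<and>
     (\<forall>\<eta> i. path_in Q \<eta> \<and> pathstart \<eta> = x \<and> pathfinish \<eta> \<in> M \<and> P (pathfinish \<eta>) i \<longrightarrow>
        homotopic_paths L (\<kappa> (idx x) x +++ \<eta>) (\<kappa> i (pathfinish \<eta>)))" for x Q L
  have "\<exists>Q L. near x Q L" if x: "x \<in> M" for x
  proof -
    have "x \<in> X" using x M by blast
    define Ix where "Ix = {i \<in> I. x \<in> cball i (e i)}"
    have PIx: "P x i" "i \<in> M" "x \<in> W i" if "i \<in> Ix" for i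
      using that P[of x i] x by (auto simp: Ix_def P_def)
    define V where "V = X \<inter> (\<Inter>i\<in>Ix. W i) \<inter> (X - (\<Union>i\<in>I - Ix. cball i (e i)))"
    have "open_X (X \<inter> (\<Inter>i\<in>Ix. W i))"
    proof (rule openin_Int[OF openin_subtopology_self openin_Inter])
      show "finite (W ` Ix)" "W ` Ix \<noteq> {}" using I(1) idx[OF x] by (auto simp: Ix_def P_def)
      show "open_X U" if "U \<in> W ` Ix" for U using that PIx(2) W(1) by auto
    qed
    moreover have "open_X (X - (\<Union>i\<in>I - Ix. cball i (e i)))"
      using I(1) by (metis Diff_eq openin_open_Int open_Compl closed_UN closed_cball finite_Diff)
    ultimately have "open_X V" unfolding V_def by (rule openin_Int)
    moreover have "x \<in> V" using \<open>x \<in> X\<close> PIx(3) by (auto simp: V_def Ix_def)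
    ultimately obtain Q where Q: "open_X Q" "path_connected Q" "x \<in> Q" "Q \<subseteq> V"
      by (rule path_connected_neighbourhood)
    have "\<exists>L. cpt L \<and> homotopic_paths L (\<kappa> (idx x) x) (\<kappa> i x)" if "i \<in> Ix" for i
    proof -
      have "homotopic_paths X (\<kappa> (idx x) x) (\<kappa> i x)"
      proof (rule simply_connected_homotopic_paths[OF simply_connected])
        have i: "i \<in> M" "x \<in> W i" using PIx that by auto
        have i': "idx x \<in> M" "x \<in> W (idx x)" using P[OF idx[OF x] x] .
        show "path (\<kappa> (idx x) x)" "path (\<kappa> i x)" "path_image (\<kappa> (idx x) x) \<subseteq> X" "path_image (\<kappa> i x) \<subseteq> X"
          "pathstart (\<kappa> (idx x) x) = pathstart (\<kappa> i x)" "pathfinish (\<kappa> (idx x) x) = pathfinish (\<kappa> i x)"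
          using \<kappa>[OF i] \<kappa>[OF i'] K1(1)[OF i(1)] K1(1)[OF i'(1)] by (auto simp: path_in_def)
      qed
      then show ?thesis using hom_compact_image by metis
    qed
    then obtain L where L: "\<And>i. i \<in> Ix \<Longrightarrow> cpt (L i)" "\<And>i. i \<in> Ix \<Longrightarrow> homotopic_paths (L i) (\<kappa> (idx x) x) (\<kappa> i x)"
      by metis
    define L' where "L' = (\<Union>i\<in>Ix. L i \<union> K1 i)"
    have finIx: "finite Ix" using I(1) by (simp add: Ix_def)
    have "cpt L'"
      unfolding L'_def using L(1) K1(1) PIx(2) finIx by (auto intro!: compact_UN compact_Un)
    moreover have "homotopic_paths L' (\<kappa> (idx x) x +++ \<eta>) (\<kappa> i (pathfinish \<eta>))"
      if \<eta>: "path_in Q \<eta>" "pathstart \<eta> = x" "pathfinish \<eta> \<in> M" "P (pathfinish \<eta>) i" for \<eta> i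
    proof -
      have "pathfinish \<eta> \<in> V" using path_in_ends[OF \<eta>(1)] Q(4) by blast
      then have i: "i \<in> Ix" using \<eta>(4) by (auto simp: V_def P_def)
      have sub: "L i \<subseteq> L'" "K1 i \<subseteq> L'" using i by (auto simp: L'_def)
      have QW: "Q \<subseteq> W i" using Q(4) i by (auto simp: V_def)
      note iM = PIx(2)[OF i] and xW = PIx(3)[OF i]
      have fW: "pathfinish \<eta> \<in> W i" using path_in_ends[OF \<eta>(1)] QW by blast
      have \<eta>W: "path_in (W i) \<eta>" using \<eta>(1) QW path_in_mono by blast
      have inK: "path_in L' q" if "path_in (W i) q" for q
        using that K1(2)[OF iM] sub(2) path_in_mono by blast
      have cL: "path_in L' (c i)" using K1(3)[OF iM] sub(2) path_in_mono by blast
      note dx = d[OF iM xW] and df = d[OF iM fW] and ci = c(2,3)[OF iM]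
      have "homotopic_paths L' (\<kappa> (idx x) x +++ \<eta>) (\<kappa> i x +++ \<eta>)"
        using homotopic_paths_subset[OF L(2)[OF i] sub(1)] inK[OF \<eta>W] \<eta>(2) \<kappa>(3)[OF P[OF idx[OF x] x]]
        by (intro hom_right) auto
      also have "homotopic_paths L' \<dots> (c i +++ (d i x +++ \<eta>))"
        unfolding \<kappa>_def using cL inK[OF dx(1)] inK[OF \<eta>W] ci dx \<eta>(2) by (intro hom_assoc) auto
      also have "homotopic_paths L' \<dots> (c i +++ d i (pathfinish \<eta>))"
      proof (rule hom_left)
        have "homotopic_paths (K0 i) (d i x +++ \<eta>) (d i (pathfinish \<eta>))"
          using dx df \<eta>W \<eta>(2) by (intro W_hom iM) auto
        then show "homotopic_paths L' (d i x +++ \<eta>) (d i (pathfinish \<eta>))"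
          using sub(2) unfolding K1_def by (meson homotopic_paths_subset le_sup_iff)
      qed (use cL ci dx in auto)
      finally show ?thesis by (simp add: \<kappa>_def)
    qed
    ultimately have "near x Q L'" using Q by (simp add: near_def)
    then show ?thesis by blast
  qed
  then obtain Q L where "\<And>x. x \<in> M \<Longrightarrow> near x (Q x) (L x)" by metis
  then have Q: "\<And>x. x \<in> M \<Longrightarrow> open_X (Q x)" "\<And>x. x \<in> M \<Longrightarrow> x \<in> Q x"
    "\<And>x. x \<in> M \<Longrightarrow> path_connected (Q x)" "\<And>x. x \<in> M \<Longrightarrow> cpt (L x)"
    and QL: "\<And>x \<eta> i. \<lbrakk>x \<in> M; path_in (Q x) \<eta>; pathstart \<eta> = x; pathfinish \<eta> \<in> M; P (pathfinish \<eta>) i\<rbrakk>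
        \<Longrightarrow> homotopic_paths (L x) (\<kappa> (idx x) x +++ \<eta>) (\<kappa> i (pathfinish \<eta>))"
    by (simp_all add: near_def)
  have "\<exists>T. open T \<and> Q x = X \<inter> T" if "x \<in> M" for x
    using Q(1)[OF that] unfolding openin_open by blast
  then obtain T where T: "\<And>x. x \<in> M \<Longrightarrow> open (T x)" "\<And>x. x \<in> M \<Longrightarrow> Q x = X \<inter> T x" by metis
  obtain A where A: "finite A" "A \<subseteq> M" "M \<subseteq> (\<Union>x\<in>A. T x)"
    using compactE_image[of M M T] M T Q(2) by (metis (no_types, lifting) IntD2 UN_I subsetI)
  define K where "K = M \<union> (\<Union>x\<in>A. L x) \<union> (\<Union>i\<in>I. K1 i)"
  have cptK: "cpt K"
  proof
    show "compact K"
      using M A Q(4) K1(1) I by (auto simp: K_def intro!: compact_Un compact_UN)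
    have "L x \<subseteq> X" "K1 i \<subseteq> X" if "x \<in> A" "i \<in> I" for x i
      using that Q(4) K1(1) A(2) I(2) by blast+
    then show "K \<subseteq> X" using M Q(4) K1(1) A(2) I(2) unfolding K_def by blast
  qed
  define k where "k x = \<kappa> (idx x) x" for x
  have kK: "path_in K (k x)" "pathfinish (k x) = x" "pathstart (k x) = x0" if "x \<in> M" for x
    using \<kappa>[OF P[OF idx[OF that] that]] idx[OF that]
    by (auto simp: k_def K_def P_def intro: path_in_mono)
  have main: "homotopic_paths K (k (pathstart \<gamma>) +++ \<gamma>) (k (pathfinish \<gamma>))" if \<gamma>: "path_in M \<gamma>" for \<gamma>
  proof -
    have \<gamma>M: "\<gamma> t \<in> M" if "t \<in> {0..1}" for t using \<gamma> that by (rule path_in_pathD)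
    have MK: "M \<subseteq> K" by (auto simp: K_def)
    have sK: "path_in K (seg \<gamma> s t)" if "s \<in> {0..1}" "t \<in> {0..1}" for s t
      using path_in_seg_path[OF \<gamma> that] MK path_in_mono by blast
    have ss: "homotopic_paths K (seg \<gamma> a b +++ seg \<gamma> b c) (seg \<gamma> a c)"
      if "a \<in> {0..1}" "b \<in> {0..1}" "c \<in> {0..1}" for a b c
      using homotopic_seg_join_path[OF path_in_mono[OF \<gamma> MK] that] .
    \<comment> \<open>\<open>R\<close> is an equivalence relation on the interval with open classes.\<close>
    define R where "R s t \<longleftrightarrow> homotopic_paths K (k (\<gamma> s) +++ seg \<gamma> s t) (k (\<gamma> t))" for s t
    have comp: "homotopic_paths K ((k (\<gamma> a) +++ seg \<gamma> a b) +++ seg \<gamma> b c) (k (\<gamma> a) +++ seg \<gamma> a c)"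
      if "a \<in> {0..1}" "b \<in> {0..1}" "c \<in> {0..1}" for a b c
    proof -
      have "homotopic_paths K ((k (\<gamma> a) +++ seg \<gamma> a b) +++ seg \<gamma> b c) (k (\<gamma> a) +++ (seg \<gamma> a b +++ seg \<gamma> b c))"
        using that kK[OF \<gamma>M] sK by (intro hom_assoc) auto
      also have "homotopic_paths K \<dots> (k (\<gamma> a) +++ seg \<gamma> a c)"
        using that kK[OF \<gamma>M] ss by (intro hom_left) auto
      finally show ?thesis .
    qed
    have "R 0 1"
    proof (rule connected_equivalence_relation[of "{0..1::real}"])
      show "R t s" if "R s t" "s \<in> {0..1}" "t \<in> {0..1}" for s t
      proof -
        have "homotopic_paths K (k (\<gamma> t) +++ seg \<gamma> t s) ((k (\<gamma> s) +++ seg \<gamma> s t) +++ seg \<gamma> t s)"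
          using that kK[OF \<gamma>M] sK by (intro hom_right) (auto simp: R_def intro: homotopic_paths_sym)
        also have "homotopic_paths K \<dots> (k (\<gamma> s) +++ seg \<gamma> s s)" using comp that by blast
        also have "homotopic_paths K \<dots> (k (\<gamma> s))"
          using kK[OF \<gamma>M[OF that(2)]] by (simp add: hom_rconst)
        finally show ?thesis by (simp add: R_def)
      qed
      show "R a c" if "R a b" "R b c" "a \<in> {0..1}" "b \<in> {0..1}" "c \<in> {0..1}" for a b c
      proof -
        have "homotopic_paths K (k (\<gamma> a) +++ seg \<gamma> a c) ((k (\<gamma> a) +++ seg \<gamma> a b) +++ seg \<gamma> b c)"
          using comp that homotopic_paths_sym by blast
        also have "homotopic_paths K \<dots> (k (\<gamma> b) +++ seg \<gamma> b c)"
          using that kK[OF \<gamma>M] sK by (intro hom_right) (auto simp: R_def)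
        also have "homotopic_paths K \<dots> (k (\<gamma> c))" using that by (simp add: R_def)
        finally show ?thesis by (simp add: R_def)
      qed
      show "\<exists>U. openin (top_of_set {0..1}) U \<and> t \<in> U \<and> (\<forall>s\<in>U. R t s)" if t: "t \<in> {0..1}" for t
      proof -
        obtain x where x: "x \<in> A" "\<gamma> t \<in> T x" using A(3) \<gamma>M[OF t] by blast
        have xM: "x \<in> M" using x A by blast
        have "path_in X \<gamma>" "\<gamma> t \<in> Q x"
          using \<gamma> M x(2) T(2)[OF xM] \<gamma>M[OF t] by (auto intro: path_in_mono)
        then obtain \<epsilon> where \<epsilon>: "\<epsilon> > 0" "\<And>s. s \<in> {0..1} \<inter> ball t \<epsilon> \<Longrightarrow> path_in (Q x) (seg \<gamma> t s)"
          using path_locally_in_open[OF _ Q(1)[OF xM] t] by metis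
        have "R t s" if s: "s \<in> {0..1} \<inter> ball t \<epsilon>" for s
        proof -
          note sQ = \<epsilon>(2)[OF s]
          obtain \<eta> where \<eta>: "path_in (Q x) \<eta>" "pathstart \<eta> = x" "pathfinish \<eta> = \<gamma> t"
            using path_connected_path_in[OF Q(3)[OF xM] Q(2)[OF xM], of "\<gamma> t"] path_in_ends[OF sQ] by auto
          have LK: "L x \<subseteq> K" using x by (auto simp: K_def)
          have 1: "homotopic_paths K (k x +++ \<eta>) (k (\<gamma> t))"
            using QL[OF xM \<eta>(1,2), of "idx (\<gamma> t)"] \<eta>(3) \<gamma>M[OF t] idx[OF \<gamma>M[OF t]] LK
            by (auto simp: k_def intro: homotopic_paths_subset)
          have 2: "homotopic_paths K (k x +++ (\<eta> +++ seg \<gamma> t s)) (k (\<gamma> s))"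
            using QL[OF xM, of "\<eta> +++ seg \<gamma> t s" "idx (\<gamma> s)"] sQ \<eta> \<gamma>M[of s] idx[OF \<gamma>M, of s] s LK
            by (auto simp: k_def intro: homotopic_paths_subset)
          have \<eta>K: "path_in K \<eta>"
            using homotopic_paths_path_in[OF 1] path_in_joinD[of K "k x" \<eta>] kK(2)[OF xM] \<eta>(2) by simp
          have "homotopic_paths K (k (\<gamma> t) +++ seg \<gamma> t s) ((k x +++ \<eta>) +++ seg \<gamma> t s)"
            using 1 s t \<eta> sK kK(2)[OF \<gamma>M] by (intro hom_right) (auto intro: homotopic_paths_sym)
          also have "homotopic_paths K \<dots> (k x +++ (\<eta> +++ seg \<gamma> t s))"
            using s t \<eta> \<eta>K sK kK[OF xM] by (intro hom_assoc) auto
          also note 2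
          finally show ?thesis by (simp add: R_def)
        qed
        then show ?thesis using t \<epsilon>(1) by (intro exI[of _ "{0..1} \<inter> ball t \<epsilon>"]) (auto simp: openin_open_Int)
      qed
    qed auto
    then show ?thesis by (simp add: R_def pathstart_def pathfinish_def)
  qed
  show ?thesis
  proof (rule that[OF cptK])
    show MK: "M \<subseteq> K" by (auto simp: K_def)
    show "homotopic_paths K p q"
      if "path_in M p" "path_in M q" "pathstart p = pathstart q" "pathfinish p = pathfinish q" for p q
    proof (rule hom_cancel_left[of K "k (pathstart p)"])
      have "pathstart p \<in> M" using that path_in_ends by blast
      then show "path_in K (k (pathstart p))" "pathfinish (k (pathstart p)) = pathstart p"
        "pathfinish (k (pathstart p)) = pathstart q"
        using kK that by auto
      show "homotopic_paths K (k (pathstart p) +++ p) (k (pathstart p) +++ q)"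
        using main[OF that(1)] main[OF that(2)] that(3,4) homotopic_paths_sym homotopic_paths_trans by metis
    qed (use that MK path_in_mono in blast)+
  qed
qed

end

section \<open>Rays in locally finite graphs\<close>

text \<open>
  The start \<open>v\<close> is always included, even if it does not belong to \<open>A\<close>.
\<close>
definition reach :: "('v \<times> 'v) set \<Rightarrow> 'v set \<Rightarrow> 'v \<Rightarrow> 'v set" where
  "reach E A v = (E \<inter> A \<times> A)\<^sup>* `` {v}"

lemma reach_self [simp, intro]: "v \<in> reach E A v"
  by (simp add: reach_def)

lemma reach_subset: "v \<in> A \<Longrightarrow> reach E A v \<subseteq> A"
proof
  fix y assume "v \<in> A" "y \<in> reach E A v"
  then have "(v, y) \<in> (E \<inter> A \<times> A)\<^sup>*" by (simp add: reach_def)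
  then show "y \<in> A" using \<open>v \<in> A\<close> by (induction rule: rtrancl_induct) auto
qed

lemma reach_mono: "A \<subseteq> B \<Longrightarrow> reach E A v \<subseteq> reach E B v"
  unfolding reach_def by (intro Image_mono rtrancl_mono) auto

lemma reach_step: "\<lbrakk>y \<in> reach E A v; (y, z) \<in> E; y \<in> A; z \<in> A\<rbrakk> \<Longrightarrow> z \<in> reach E A v"
  unfolding reach_def by (auto intro: rtrancl.rtrancl_into_rtrancl)

lemma reach_trans: "\<lbrakk>y \<in> reach E A v; z \<in> reach E A y\<rbrakk> \<Longrightarrow> z \<in> reach E A v"
  unfolding reach_def by (auto intro: rtrancl_trans)

lemma reach_sym: "\<lbrakk>sym E; y \<in> reach E A v\<rbrakk> \<Longrightarrow> v \<in> reach E A y"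
proof -
  assume "sym E" "y \<in> reach E A v"
  moreover have "sym (E \<inter> A \<times> A)" using \<open>sym E\<close> by (auto simp: sym_def)
  ultimately show ?thesis unfolding reach_def by (auto dest: symD[OF sym_rtrancl])
qed

lemma reach_eq: "\<lbrakk>sym E; y \<in> reach E A v\<rbrakk> \<Longrightarrow> reach E A y = reach E A v"
  using reach_sym reach_trans by (metis subsetI subset_antisym)

lemma reach_induct [consumes 1, case_names self step]:
  assumes "y \<in> reach E A v" "P v"
    "\<And>y z. \<lbrakk>y \<in> reach E A v; (y, z) \<in> E; y \<in> A; z \<in> A; P y\<rbrakk> \<Longrightarrow> P z"
  shows "P y"
proof -
  have "(v, y) \<in> (E \<inter> A \<times> A)\<^sup>*" using assms(1) by (simp add: reach_def)
  then show ?thesis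
    by (induction rule: rtrancl_induct) (use assms in \<open>auto simp: reach_def\<close>)
qed

lemma reach_avoiding_start:
  assumes "y \<in> reach E A v" "y \<noteq> v" "v \<in> A"
  shows "\<exists>u. (v, u) \<in> E \<and> u \<in> A - {v} \<and> y \<in> reach E (A - {v}) u"
  using assms(1,2)
proof (induction rule: reach_induct)
  case (step y z)
  show ?case
  proof (cases "y = v")
    case True
    then show ?thesis using step by (intro exI[of _ z]) auto
  next
    case False
    then obtain u where u: "(v, u) \<in> E" "u \<in> A - {v}" "y \<in> reach E (A - {v}) u"
      using step by blast
    then have "z \<in> reach E (A - {v}) u"
      using step False by (intro reach_step[OF u(3)]) auto
    then show ?thesis using u by blast
  qed
qed simp

text \<open>
  Koenig's lemma: if infinitely many vertices can be reached from \<open>v\<close>, then, the degree being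
  finite, infinitely many of them can be reached from some neighbour without returning to \<open>v\<close>.
\<close>
lemma infinite_reach_ray:
  assumes fin: "\<And>x. x \<in> A \<Longrightarrow> finite (E `` {x})" and v: "v \<in> A" "infinite (reach E A v)"
  obtains f :: "nat \<Rightarrow> 'v" where "f 0 = v" "\<And>n. f n \<in> A" "\<And>n. (f n, f (Suc n)) \<in> E" "inj f"
proof -
  define P where "P n s \<longleftrightarrow> (case s of (B, x) \<Rightarrow> x \<in> B \<and> B \<subseteq> A \<and> infinite (reach E B x) \<and> (n = 0 \<longrightarrow> x = v))"
    for n :: nat and s :: "'v set \<times> 'v"
  define Q where "Q s t \<longleftrightarrow> fst t = fst s - {snd s} \<and> (snd s, snd t) \<in> E" for s t :: "'v set \<times> 'v"
  have "\<exists>g. \<forall>n. P n (g n) \<and> Q (g n) (g (Suc n))"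
  proof (rule dependent_nat_choice)
    show "\<exists>s. P 0 s" using v by (intro exI[of _ "(A, v)"]) (auto simp: P_def)
    fix s n assume "P n s"
    then obtain B x where s: "s = (B, x)" "x \<in> B" "B \<subseteq> A" "infinite (reach E B x)"
      by (cases s) (auto simp: P_def)
    define N where "N = {u. (x, u) \<in> E \<and> u \<in> B - {x}}"
    have "finite N" using fin[of x] s by (auto simp: N_def intro: finite_subset[of _ "E `` {x}"])
    moreover have "reach E B x - {x} \<subseteq> (\<Union>u\<in>N. reach E (B - {x}) u)"
      using reach_avoiding_start[of _ E B x] s(2) by (auto simp: N_def)
    moreover have "infinite (reach E B x - {x})" using s(4) by simp
    ultimately obtain u where "u \<in> N" "infinite (reach E (B - {x}) u)"
      by (meson finite_UN finite_subset)
    then show "\<exists>t. P (Suc n) t \<and> Q s t"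
      using s by (intro exI[of _ "(B - {x}, u)"]) (auto simp: P_def Q_def N_def)
  qed
  then obtain g where g: "\<And>n. P n (g n)" "\<And>n. Q (g n) (g (Suc n))" by blast
  have dec: "fst (g (Suc m + k)) \<subseteq> fst (g m) - {snd (g m)}" for m k
    by (induction k) (use g(2) in \<open>force simp: Q_def\<close>)+
  have mem: "snd (g n) \<in> fst (g n)" "fst (g n) \<subseteq> A" for n
    using g(1)[of n] by (auto simp: P_def split: prod.splits)
  show ?thesis
  proof
    show "snd (g 0) = v" using g(1)[of 0] by (auto simp: P_def split: prod.splits)
    show "snd (g n) \<in> A" for n using mem by blast
    show "(snd (g n), snd (g (Suc n))) \<in> E" for n using g(2) by (simp add: Q_def)
    have "snd (g m) \<noteq> snd (g n)" if "m < n" for m n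
      using dec[of m "n - Suc m"] mem(1)[of n] that by auto
    then show "inj (\<lambda>n. snd (g n))" by (intro linorder_injI) auto
  qed
qed

lemma reach_meets_boundary:
  assumes "f \<in> reach E V x" "x \<in> V - F" "f \<in> F"
  shows "\<exists>y\<in>reach E (V - F) x. \<exists>f'\<in>F. (y, f') \<in> E"
proof -
  have "z \<in> reach E (V - F) x \<or> (\<exists>y\<in>reach E (V - F) x. \<exists>f'\<in>F. (y, f') \<in> E)" if "z \<in> reach E V x" for z
    using that
  proof (induction rule: reach_induct)
    case (step y z)
    then show ?case
      using reach_step[of y E "V - F" x z] reach_subset[OF assms(2), of E] by blast
  qed simp
  moreover have "f \<notin> reach E (V - F) x" using reach_subset[OF assms(2), of E] assms(3) by auto
  ultimately show ?thesis using assms(1) by blast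
qed

text \<open>
  The union of the finite components of \<open>V - F\<close> that are adjacent to \<open>F\<close> is finite, because each of
  them contains one of the finitely many neighbours of \<open>F\<close>.
\<close>
lemma finite_bounded_components:
  assumes "sym E" "finite F" "\<And>x. x \<in> F \<Longrightarrow> finite (E `` {x})"
  shows "finite {x \<in> V. finite (reach E (V - F) x) \<and> (\<exists>y\<in>reach E (V - F) x. \<exists>f\<in>F. (y, f) \<in> E)}"
    (is "finite ?S")
proof -
  have "?S \<subseteq> (\<Union>f\<in>F. \<Union>y\<in>E `` {f}. if finite (reach E (V - F) y) then reach E (V - F) y else {})"
  proof
    fix x assume "x \<in> ?S"
    then obtain y f where y: "finite (reach E (V - F) x)" "y \<in> reach E (V - F) x" "f \<in> F" "(y, f) \<in> E"
      by blast
    then have "reach E (V - F) y = reach E (V - F) x" "(f, y) \<in> E"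
      using reach_eq[OF assms(1)] symD[OF assms(1)] by blast+
    then show "x \<in> (\<Union>f\<in>F. \<Union>y\<in>E `` {f}. if finite (reach E (V - F) y) then reach E (V - F) y else {})"
      using y by force
  qed
  moreover have "finite \<dots>" using assms by auto
  ultimately show ?thesis by (rule finite_subset)
qed

text \<open>
  In a connected graph every component of \<open>V - F\<close> is adjacent to \<open>F\<close>, unless \<open>F\<close> is empty. With
  Koenig's lemma this shows that all but finitely many vertices start a ray that avoids \<open>F\<close>.
\<close>
lemma finite_trapped_vertices:
  assumes "sym E" "finite F" "\<And>x. x \<in> V \<Longrightarrow> finite (E `` {x})" "F \<subseteq> V" "infinite V"
    and conn: "\<And>x y. x \<in> V \<Longrightarrow> y \<in> V \<Longrightarrow> y \<in> reach E V x"
  shows "finite {x \<in> V. finite (reach E (V - F) x)}"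
proof (cases "F = {}")
  case True
  have "reach E (V - F) x = V" if "x \<in> V" for x
    using conn[OF that] reach_subset[OF that, of E] True by auto
  then have "{x \<in> V. finite (reach E (V - F) x)} = {}" using \<open>infinite V\<close> by auto
  then show ?thesis by (simp only: finite.emptyI)
next
  case False
  then obtain f where f: "f \<in> F" by blast
  have "{x \<in> V. finite (reach E (V - F) x)} \<subseteq> F \<union>
    {x \<in> V. finite (reach E (V - F) x) \<and> (\<exists>y\<in>reach E (V - F) x. \<exists>f\<in>F. (y, f) \<in> E)}"
  proof
    fix x assume x: "x \<in> {x \<in> V. finite (reach E (V - F) x)}"
    show "x \<in> F \<union> {x \<in> V. finite (reach E (V - F) x) \<and> (\<exists>y\<in>reach E (V - F) x. \<exists>f\<in>F. (y, f) \<in> E)}"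
    proof (cases "x \<in> F")
      case False
      have "f \<in> reach E V x" using conn x f assms(4) by auto
      from reach_meets_boundary[OF this _ f] show ?thesis using x False by simp
    qed simp
  qed
  moreover have "finite (F \<union>
    {x \<in> V. finite (reach E (V - F) x) \<and> (\<exists>y\<in>reach E (V - F) x. \<exists>f\<in>F. (y, f) \<in> E)})"
    using finite_bounded_components[OF assms(1,2), of V] assms(2,3,4) by (auto simp: subset_iff)
  ultimately show ?thesis by (rule finite_subset)
qed

section \<open>Infinite concatenations\<close>

text \<open>
  The map \<open>f n\<close> is used on \<open>[T n, T (n + 1)] \<times> Z\<close>, where \<open>0 = T 0 < T 1 < \<dots>\<close> tends to infinity.
\<close>
definition glued :: "(nat \<Rightarrow> real) \<Rightarrow> (nat \<Rightarrow> real \<times> 'z \<Rightarrow> 'a) \<Rightarrow> real \<times> 'z \<Rightarrow> 'a" where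
  "glued T f = (\<lambda>(t, z). f (LEAST n. t < T (Suc n)) (t, z))"

locale gluing =
  fixes T :: "nat \<Rightarrow> real" and Z :: "'z::metric_space set" and f :: "nat \<Rightarrow> real \<times> 'z \<Rightarrow> 'a::metric_space"
  assumes T0: "T 0 = 0" and T_step: "\<And>n. T n + 1 \<le> T (Suc n)"
    and cont: "\<And>n. continuous_on ({T n..T (Suc n)} \<times> Z) (f n)"
    and match: "\<And>n z. z \<in> Z \<Longrightarrow> f n (T (Suc n), z) = f (Suc n) (T (Suc n), z)"
begin

lemma T_ge: "real n \<le> T n"
proof (induction n)
  case (Suc n)
  then show ?case using T_step[of n] by simp
qed (simp add: T0)

lemma T_mono:
  assumes "m \<le> n"
  shows "T m \<le> T n"
proof -
  have "T k \<le> T (Suc k)" for k using T_step[of k] by simp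
  then show ?thesis using assms by (rule lift_Suc_mono_le)
qed

lemma glued_on_piece:
  assumes "z \<in> Z" "T n \<le> t" "t \<le> T (Suc n)"
  shows "glued T f (t, z) = f n (t, z)"
proof (cases "t = T (Suc n)")
  case True
  have "(LEAST k. t < T (Suc k)) = Suc n"
  proof (rule Least_equality)
    show "t < T (Suc (Suc n))" using T_step[of "Suc n"] True by simp
    show "Suc n \<le> k" if "t < T (Suc k)" for k
      using that T_mono[of "Suc k" "Suc n"] True by (cases "Suc n \<le> k") auto
  qed
  then show ?thesis using match[OF assms(1), of n] True by (simp add: glued_def)
next
  case False
  have "(LEAST k. t < T (Suc k)) = n"
  proof (rule Least_equality)
    show "t < T (Suc n)" using False assms by simp
    show "n \<le> k" if "t < T (Suc k)" for k
      using that T_mono[of "Suc k" n] assms by (cases "n \<le> k") auto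
  qed
  then show ?thesis by (simp add: glued_def)
qed

lemma piece_exists:
  assumes "t \<ge> 0"
  obtains n where "T n \<le> t" "t \<le> T (Suc n)"
proof -
  define n where "n = (LEAST n. t < T (Suc n))"
  obtain k :: nat where "t < real k" using reals_Archimedean2 by blast
  then have "t < T (Suc k)" using T_ge[of k] T_step[of k] by linarith
  then have less: "t < T (Suc n)" unfolding n_def by (rule LeastI)
  have "T n \<le> t"
  proof (cases n)
    case 0
    then show ?thesis using assms T0 by simp
  next
    case (Suc m)
    then have "\<not> t < T (Suc m)" using not_less_Least[of m "\<lambda>n. t < T (Suc n)"] by (simp add: n_def)
    then show ?thesis using Suc by simp
  qed
  then show ?thesis using that[of n] less by simp
qed

lemma continuous_on_glued: "continuous_on ({0..} \<times> Z) (glued T f)"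
proof -
  have piece: "continuous_on ({T n..T (Suc n)} \<times> Z) (glued T f)" for n
    by (rule continuous_on_eq[OF cont[of n]]) (auto simp: glued_on_piece)
  have upto: "continuous_on ({0..T n} \<times> Z) (glued T f)" for n
  proof (induction n)
    case 0
    show ?case by (rule continuous_on_subset[OF piece[of 0]]) (use T_mono[of 0 1] T0 in auto)
  next
    case (Suc n)
    have eq: "{0..T (Suc n)} \<times> Z = {0..T n} \<times> Z \<union> {T n..T (Suc n)} \<times> Z"
      using T_mono[of n "Suc n"] T_mono[of 0 n] T0 by auto
    have "closedin (top_of_set ({0..T (Suc n)} \<times> Z)) ({0..T n} \<times> Z)"
      "closedin (top_of_set ({0..T (Suc n)} \<times> Z)) ({T n..T (Suc n)} \<times> Z)"
      using T_mono[of n "Suc n"] T_mono[of 0 n] T0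
      by (intro closedin_Times closedin_subtopology_refl[THEN iffD2]; force intro: closed_subset)+
    then show ?case unfolding eq by (intro continuous_on_Un_local Suc piece)
  qed
  show ?thesis
    unfolding continuous_on_def
  proof
    fix x :: "real \<times> 'z" assume x: "x \<in> {0..} \<times> Z"
    obtain n where "fst x < real n" using reals_Archimedean2 by blast
    then have n: "fst x < T n" using T_ge[of n] by linarith
    have "at x within {0..} \<times> Z = at x within {0..T n} \<times> Z"
      by (rule at_within_nhd[of x "{..<T n} \<times> UNIV"])
        (use n in \<open>auto intro: open_Times simp: mem_Times_iff\<close>)
    moreover have "x \<in> {0..T n} \<times> Z" using x n by (auto simp: mem_Times_iff)
    ultimately show "(glued T f \<longlongrightarrow> glued T f x) (at x within {0..} \<times> Z)"
      using upto[of n] unfolding continuous_on_def by metis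
  qed
qed

lemma proper_map_on_glued:
  assumes Z: "compact Z" and X: "\<And>n. f n ` ({T n..T (Suc n)} \<times> Z) \<subseteq> X"
    and fin: "\<And>K. \<lbrakk>compact K; K \<subseteq> X\<rbrakk> \<Longrightarrow> \<exists>N. \<forall>n\<ge>N. f n ` ({T n..T (Suc n)} \<times> Z) \<inter> K = {}"
  shows "proper_map_on ({0..} \<times> Z) X (glued T f)"
  unfolding proper_map_on_def
proof (intro conjI allI impI)
  show "continuous_on ({0..} \<times> Z) (glued T f)" by (rule continuous_on_glued)
  have val: "\<exists>n. T n \<le> t \<and> t \<le> T (Suc n) \<and> glued T f (t, z) \<in> f n ` ({T n..T (Suc n)} \<times> Z)" if "z \<in> Z" "t \<ge> 0" for t z
  proof -
    obtain n where "T n \<le> t" "t \<le> T (Suc n)" using piece_exists[OF \<open>t \<ge> 0\<close>] .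
    then show ?thesis using glued_on_piece[OF that(1)] that(1) by (intro exI[of _ n]) auto
  qed
  show "glued T f \<in> {0..} \<times> Z \<rightarrow> X" using val X by fastforce
  fix K assume K: "compact K \<and> K \<subseteq> X"
  then obtain N where N: "\<And>n. n \<ge> N \<Longrightarrow> f n ` ({T n..T (Suc n)} \<times> Z) \<inter> K = {}" using fin by blast
  have "t \<le> T N" if tz: "t \<ge> 0" "z \<in> Z" "glued T f (t, z) \<in> K" for t z
  proof (rule ccontr)
    assume tN: "\<not> t \<le> T N"
    obtain n where n: "T n \<le> t" "t \<le> T (Suc n)" "glued T f (t, z) \<in> f n ` ({T n..T (Suc n)} \<times> Z)"
      using val[OF tz(2,1)] by blast
    have "N \<le> n" using T_mono[of "Suc n" N] tN n by (cases "N \<le> n") auto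
    then show False using N[of n] n(3) tz(3) by blast
  qed
  then have eq: "{0..} \<times> Z \<inter> glued T f -` K = ({0..T N} \<times> Z) \<inter> glued T f -` K" by auto
  have "closedin (top_of_set ({0..T N} \<times> Z)) (({0..T N} \<times> Z) \<inter> glued T f -` K)"
    using K by (intro continuous_closedin_preimage continuous_on_subset[OF continuous_on_glued] compact_imp_closed) auto
  then show "compact ({0..} \<times> Z \<inter> glued T f -` K)"
    unfolding eq by (rule closedin_compact[OF compact_Times[OF compact_Icc Z]])
qed

end

lemma proper_ray_concatenation:
  fixes p :: "nat \<Rightarrow> real \<Rightarrow> 'a::metric_space"
  assumes p: "\<And>n. path_in S (p n)" "\<And>n. pathfinish (p n) = pathstart (p (Suc n))" and "S \<subseteq> X"
    and fin: "\<And>K. \<lbrakk>compact K; K \<subseteq> X\<rbrakk> \<Longrightarrow> \<exists>N. \<forall>n\<ge>N. path_image (p n) \<inter> K = {}"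
  shows "proper_ray X (\<lambda>t. p (nat \<lfloor>t\<rfloor>) (frac t))" "(\<lambda>t. p (nat \<lfloor>t\<rfloor>) (frac t)) ` {0..} \<subseteq> S"
proof -
  define f where "f n = (\<lambda>(t, z::real). p n (t - real n))" for n
  have im: "f n ` ({real n..real (Suc n)} \<times> {0}) = path_image (p n)" for n
  proof -
    have "f n ` ({real n..real (Suc n)} \<times> {0}) = p n ` (\<lambda>t. t - real n) ` {real n..real (Suc n)}"
      by (auto simp: f_def image_image image_def)
    moreover have "(\<lambda>t. t - real n) ` {real n..real (Suc n)} = {0..1}" by simp
    ultimately show ?thesis by (simp add: path_image_def)
  qed
  interpret gluing real "{0::real}" f
  proof
    show "continuous_on ({real n..real (Suc n)} \<times> {0}) (f n)" for n
    proof -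
      have "continuous_on ({real n..real (Suc n)} \<times> {0}) (p n \<circ> (\<lambda>x. fst x - real n))"
        using p(1)[of n] by (intro continuous_on_compose continuous_intros)
          (auto simp: path_in_def path_def elim!: continuous_on_subset)
      then show ?thesis by (simp add: f_def o_def case_prod_unfold)
    qed
    show "f n (real (Suc n), z) = f (Suc n) (real (Suc n), z)" for n z
      using p(2) by (simp add: f_def pathfinish_def pathstart_def)
  qed simp_all
  have "proper_map_on ({0..} \<times> {0}) X (glued real f)"
  proof (rule proper_map_on_glued)
    show "f n ` ({real n..real (Suc n)} \<times> {0}) \<subseteq> X" for n
      unfolding im using p(1)[of n] \<open>S \<subseteq> X\<close> by (auto simp: path_in_def)
    show "\<exists>N. \<forall>n\<ge>N. f n ` ({real n..real (Suc n)} \<times> {0}) \<inter> K = {}" if "compact K" "K \<subseteq> X" for K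
      unfolding im using fin[OF that] .
  qed simp
  then have F: "continuous_on ({0..} \<times> {0}) (glued real f)" "glued real f \<in> {0..} \<times> {0} \<rightarrow> X"
    "\<And>K. compact K \<Longrightarrow> K \<subseteq> X \<Longrightarrow> compact ({0..} \<times> {0} \<inter> glued real f -` K)"
    by (auto simp: proper_map_on_def)
  have g: "glued real f (t, 0) = p (nat \<lfloor>t\<rfloor>) (frac t)" if "t \<ge> 0" for t
  proof -
    have "real (nat \<lfloor>t\<rfloor>) = of_int \<lfloor>t\<rfloor>" using that by simp
    then have "real (nat \<lfloor>t\<rfloor>) \<le> t" "t \<le> real (Suc (nat \<lfloor>t\<rfloor>))" "t - real (nat \<lfloor>t\<rfloor>) = frac t"
      by (simp_all add: frac_def) linarith+
    then show ?thesis using glued_on_piece[of 0 "nat \<lfloor>t\<rfloor>" t] by (simp add: f_def)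
  qed
  show "(\<lambda>t. p (nat \<lfloor>t\<rfloor>) (frac t)) ` {0..} \<subseteq> S"
  proof clarify
    fix t :: real
    show "p (nat \<lfloor>t\<rfloor>) (frac t) \<in> S"
      using frac_ge_0[of t] frac_lt_1[of t] by (intro path_in_pathD[OF p(1)]) auto
  qed
  show "proper_ray X (\<lambda>t. p (nat \<lfloor>t\<rfloor>) (frac t))"
    unfolding proper_ray_def proper_map_on_def
  proof (intro conjI allI impI)
    have "continuous_on {0..} (glued real f \<circ> (\<lambda>t. (t, 0)))"
      by (intro continuous_on_compose continuous_on_subset[OF F(1)] continuous_intros) auto
    then show "continuous_on {0..} (\<lambda>t. p (nat \<lfloor>t\<rfloor>) (frac t))"
      by (rule continuous_on_eq) (simp add: g)
    show "(\<lambda>t. p (nat \<lfloor>t\<rfloor>) (frac t)) \<in> {0..} \<rightarrow> X"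
      using F(2) by (auto simp flip: g)
    fix K assume "compact K \<and> K \<subseteq> X"
    then have "compact (fst ` ({0..} \<times> {0} \<inter> glued real f -` K))"
      by (intro compact_continuous_image[OF _ F(3)] continuous_intros) auto
    moreover have "fst ` ({0..} \<times> {0} \<inter> glued real f -` K) = {0..} \<inter> (\<lambda>t. p (nat \<lfloor>t\<rfloor>) (frac t)) -` K"
      by (force simp: g)
    ultimately show "compact ({0..} \<inter> (\<lambda>t. p (nat \<lfloor>t\<rfloor>) (frac t)) -` K)" by simp
  qed
qed

section \<open>Compact subsets of a connected locally compact space\<close>

context tame_space
begin

definition precompact :: "'a set \<Rightarrow> bool" where
  "precompact A \<longleftrightarrow> (\<exists>K. cpt K \<and> A \<subseteq> K)"

lemma precompact_cpt [intro]: "cpt K \<Longrightarrow> precompact K"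
  by (auto simp: precompact_def)

lemma cpt_Un: "\<lbrakk>cpt A; cpt B\<rbrakk> \<Longrightarrow> cpt (A \<union> B)"
  by (auto intro: compact_Un)

lemma cpt_UN: "\<lbrakk>finite I; \<And>i. i \<in> I \<Longrightarrow> cpt (A i)\<rbrakk> \<Longrightarrow> cpt (\<Union>i\<in>I. A i)"
  by (auto intro!: compact_UN)

lemma precompact_empty [simp]: "precompact {}"
  by (rule precompact_cpt) simp

lemma precompact_subset: "precompact B \<Longrightarrow> A \<subseteq> B \<Longrightarrow> precompact A"
  by (auto simp: precompact_def)

lemma precompact_Un: "precompact A \<Longrightarrow> precompact B \<Longrightarrow> precompact (A \<union> B)"
  unfolding precompact_def by (metis Un_mono Un_least compact_Un)

lemma precompact_UN: "finite I \<Longrightarrow> (\<And>i. i \<in> I \<Longrightarrow> precompact (A i)) \<Longrightarrow> precompact (\<Union>i\<in>I. A i)"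
  by (induction I rule: finite_induct) (auto intro: precompact_Un precompact_cpt)

lemma precompact_closure: "precompact A \<Longrightarrow> cpt (closure A)"
proof -
  assume "precompact A"
  then obtain K where K: "cpt K" "A \<subseteq> K" by (auto simp: precompact_def)
  then have "closure A \<subseteq> K" by (simp add: closure_minimal compact_imp_closed)
  then show ?thesis using K compact_Int_closed[of K "closure A"] by (auto simp: Int_absorb1)
qed

lemma point_precompact_neighbourhood:
  assumes "open_X V" "x \<in> V"
  obtains W where "open_X W" "x \<in> W" "W \<subseteq> V" "path_connected W" "precompact W"
  by (rule small_neighbourhood[OF assms]) (auto simp: precompact_def)

text \<open>
  Lying in a common open path-connected precompact set is an equivalence relation with open
  classes, hence it relates any two points. So finitely many small sets that cover \<open>K\<close> can be
  connected with each other.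
\<close>
lemma compact_in_connected_open:
  assumes "cpt K" "x0 \<in> X"
  obtains U where "open_X U" "path_connected U" "precompact U" "K \<subseteq> U" "x0 \<in> U"
proof -
  define good where "good U \<longleftrightarrow> open_X U \<and> path_connected U \<and> precompact U" for U
  have good_Un: "good (U \<union> V)" if "good U" "good V" "U \<inter> V \<noteq> {}" for U V
    using that by (auto simp: good_def path_connected_Un precompact_Un)
  have nbhd: "\<exists>W. good W \<and> x \<in> W" if "x \<in> X" for x
    using point_precompact_neighbourhood[of X x] that unfolding good_def by (metis openin_subtopology_self)
  have pair: "\<exists>U. good U \<and> x \<in> U \<and> y \<in> U" if "x \<in> X" "y \<in> X" for x y
  proof (rule connected_equivalence_relation[OF path_connected_imp_connected[OF path_connected] that])
    show "\<exists>U. good U \<and> y \<in> U \<and> x \<in> U" if "\<exists>U. good U \<and> x \<in> U \<and> y \<in> U" for x y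
      using that by blast
    show "\<exists>U. good U \<and> x \<in> U \<and> z \<in> U" if "\<exists>U. good U \<and> x \<in> U \<and> y \<in> U" "\<exists>U. good U \<and> y \<in> U \<and> z \<in> U" for x y z
      using that good_Un by (metis IntI Un_iff empty_iff)
    show "\<exists>T. open_X T \<and> a \<in> T \<and> (\<forall>x\<in>T. \<exists>U. good U \<and> a \<in> U \<and> x \<in> U)" if "a \<in> X" for a
      using nbhd[OF that] unfolding good_def by blast
  qed
  obtain W where W: "\<And>x. x \<in> X \<Longrightarrow> good (W x)" "\<And>x. x \<in> X \<Longrightarrow> x \<in> W x"
    using nbhd by metis
  have "\<exists>T. open T \<and> W x = X \<inter> T" if "x \<in> X" for x
    using W(1)[OF that] unfolding good_def openin_open by blast
  then obtain T where T: "\<And>x. x \<in> X \<Longrightarrow> open (T x)" "\<And>x. x \<in> X \<Longrightarrow> W x = X \<inter> T x" by metis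
  have "K \<subseteq> (\<Union>x\<in>K. T x)" using assms W(2) T(2) by blast
  then obtain F where F: "F \<subseteq> K" "finite F" "K \<subseteq> (\<Union>x\<in>F. T x)"
    using compactE_image[of K K T] assms T(1) by (metis subsetD)
  have "\<exists>U. good U \<and> x0 \<in> U \<and> (\<Union>x\<in>F. W x) \<subseteq> U"
    using F(2,1)
  proof (induction F)
    case empty
    show ?case using pair[OF assms(2) assms(2)] by auto
  next
    case (insert x F)
    then obtain U where U: "good U" "x0 \<in> U" "(\<Union>x\<in>F. W x) \<subseteq> U" by auto
    have x: "x \<in> X" using insert assms by blast
    then obtain V where V: "good V" "x0 \<in> V" "x \<in> V" using pair[OF assms(2) x] by blast
    have "good (V \<union> W x)" using V(1) W(1)[OF x] V(3) W(2)[OF x] by (intro good_Un) blast+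
    then have "good (U \<union> (V \<union> W x))" using U(1,2) V(2) by (intro good_Un[of U]) blast+
    then show ?case using U by (intro exI[of _ "U \<union> (V \<union> W x)"]) auto
  qed
  then obtain U where U: "good U" "x0 \<in> U" "(\<Union>x\<in>F. W x) \<subseteq> U" by blast
  have "K \<subseteq> U"
  proof
    fix y assume "y \<in> K"
    then obtain x where "x \<in> F" "y \<in> T x" using F by blast
    then have "y \<in> W x" using T(2)[of x] F assms \<open>y \<in> K\<close> by auto
    then show "y \<in> U" using U \<open>x \<in> F\<close> by blast
  qed
  then show ?thesis using U that unfolding good_def by blast
qed

text \<open>
  A connected, locally compact metric space is exhausted by compact sets. Let \<open>\<rho> x\<close> be the
  (truncated) radius up to which balls about \<open>x\<close> are compact. The set of points \<open>y\<close> at distance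
  less than \<open>\<rho> x / 2\<close> from some \<open>x\<close> in a compact set is again precompact, and iterating this
  step from one point reaches an open and closed set.
\<close>
lemma compact_exhaustion:
  obtains K :: "nat \<Rightarrow> 'a set" where "\<And>n. cpt (K n)" "\<And>n. K n \<subseteq> K (Suc n)"
    "\<And>C. cpt C \<Longrightarrow> \<exists>n. C \<subseteq> K n"
proof (cases "X = {}")
  case True
  show ?thesis by (rule that[of "\<lambda>_. {}"]) (use True in auto)
next
  case False
  then obtain x0 where x0: "x0 \<in> X" by blast
  define R where "R x = {e. 0 < e \<and> e \<le> 1 \<and> compact (X \<inter> cball x e)}" for x
  define \<rho> where "\<rho> x = Sup (R x)" for x
  have bdd: "bdd_above (R x)" for x by (auto simp: R_def bdd_above_def)
  have R_ne: "\<exists>e. e \<in> R x" if "x \<in> X" for x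
  proof -
    obtain W where W: "open_X W" "x \<in> W" "precompact W"
      using point_precompact_neighbourhood[of X x] \<open>x \<in> X\<close> by auto
    then obtain K where K: "cpt K" "W \<subseteq> K" by (auto simp: precompact_def)
    obtain e where e: "e > 0" "cball x e \<inter> X \<subseteq> W" using W unfolding openin_contains_cball by blast
    have "cball x (min e 1) \<subseteq> cball x e" by (intro subset_cball) auto
    then have "X \<inter> cball x (min e 1) = K \<inter> cball x (min e 1)" using e K by blast
    then have "min e 1 \<in> R x" using e K by (simp add: R_def compact_Int_closed)
    then show ?thesis by blast
  qed
  have pos: "\<rho> x > 0" if "x \<in> X" for x
    using R_ne[OF that] cSup_upper[OF _ bdd[of x]] unfolding \<rho>_def R_def by force
  have cpt_ball: "compact (X \<inter> cball x e)" if "x \<in> X" "e < \<rho> x" for x e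
  proof -
    obtain e' where e': "e' \<in> R x" "e < e'"
      using less_cSup_iff[of "R x" e] R_ne[OF \<open>x \<in> X\<close>] bdd[of x] \<open>e < \<rho> x\<close> unfolding \<rho>_def by blast
    have "X \<inter> cball x e = (X \<inter> cball x e') \<inter> cball x e" using e'(2) by auto
    moreover have "compact ((X \<inter> cball x e') \<inter> cball x e)"
      using e' by (rule_tac compact_Int_closed) (auto simp: R_def)
    ultimately show ?thesis by simp
  qed
  have lip: "\<rho> y \<ge> \<rho> x - dist x y" if "x \<in> X" "y \<in> X" for x y
  proof (rule field_le_epsilon)
    fix d :: real assume "d > 0"
    obtain e where e: "e \<in> R x" "\<rho> x - d < e"
      using less_cSup_iff[of "R x" "\<rho> x - d"] R_ne[OF \<open>x \<in> X\<close>] bdd[of x] \<open>d > 0\<close> unfolding \<rho>_def by auto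
    show "\<rho> x - dist x y \<le> \<rho> y + d"
    proof (cases "dist x y < e")
      case True
      have "X \<inter> cball y (e - dist x y) = (X \<inter> cball x e) \<inter> cball y (e - dist x y)"
      proof -
        have "dist x z \<le> e" if "dist y z \<le> e - dist x y" for z
          using dist_triangle[of x z y] that by linarith
        then show ?thesis by auto
      qed
      moreover have "compact ((X \<inter> cball x e) \<inter> cball y (e - dist x y))"
        using e by (rule_tac compact_Int_closed) (auto simp: R_def)
      ultimately have "e - dist x y \<in> R y"
        using e(1) True zero_le_dist[of x y] unfolding R_def by (auto simp del: zero_le_dist)
      then have "e - dist x y \<le> \<rho> y" unfolding \<rho>_def by (rule cSup_upper) (rule bdd)
      then show ?thesis using e(2) by linarith
    next
      case False
      then show ?thesis using pos[OF that(2)] e(2) by linarith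
    qed
  qed
  define N where "N C = {y \<in> X. \<exists>x\<in>C. dist x y < \<rho> x / 2}" for C
  have N_pre: "precompact (N C)" if C: "cpt C" for C
  proof -
    have "C \<subseteq> (\<Union>c\<in>C. ball c (\<rho> c / 8))" using pos C by force
    then obtain I where I: "I \<subseteq> C" "finite I" "C \<subseteq> (\<Union>c\<in>I. ball c (\<rho> c / 8))"
      using compactE_image[of C C "\<lambda>c. ball c (\<rho> c / 8)"] C by (metis open_ball)
    have "N C \<subseteq> (\<Union>c\<in>I. X \<inter> cball c (\<rho> c * (3/4)))"
    proof
      fix y assume "y \<in> N C"
      then obtain x where x: "y \<in> X" "x \<in> C" "dist x y < \<rho> x / 2" by (auto simp: N_def)
      then obtain c where c: "c \<in> I" "dist c x < \<rho> c / 8" using I by force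
      have "c \<in> X" "x \<in> X" using c x I C by auto
      then have "\<rho> x \<le> \<rho> c + dist c x" using lip[of x c] by (simp add: dist_commute)
      then have "dist c y \<le> \<rho> c * (3/4)"
        using c(2) x(3) dist_triangle[of c y x] pos[OF \<open>c \<in> X\<close>] by (simp add: dist_commute)
      then show "y \<in> (\<Union>c\<in>I. X \<inter> cball c (\<rho> c * (3/4)))" using c x by auto
    qed
    moreover have "precompact (\<Union>c\<in>I. X \<inter> cball c (\<rho> c * (3/4)))"
    proof (rule precompact_UN[OF I(2)])
      fix c assume "c \<in> I"
      then have "c \<in> X" using I C by blast
      then show "precompact (X \<inter> cball c (\<rho> c * (3/4)))"
        using cpt_ball[of c "\<rho> c * (3/4)"] pos[of c] by (intro precompact_cpt) auto
    qed
    ultimately show ?thesis using precompact_subset by blast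
  qed
  have N_open: "open_X (N C)" if "C \<subseteq> X" for C
  proof -
    have "N C = (\<Union>x\<in>C. X \<inter> ball x (\<rho> x / 2))" by (auto simp: N_def)
    then show ?thesis by (auto intro!: openin_Union openin_open_Int)
  qed
  have N_sup: "C \<subseteq> N C" if "C \<subseteq> X" for C
    using that pos by (force simp: N_def)
  have "\<exists>K. \<forall>n::nat. (cpt (K n) \<and> (n = 0 \<longrightarrow> K n = {x0})) \<and> N (K n) \<subseteq> K (Suc n)"
  proof (rule dependent_nat_choice)
    show "\<exists>C. cpt C \<and> (0 = (0::nat) \<longrightarrow> C = {x0})" using x0 by auto
    show "\<exists>C'. (cpt C' \<and> (Suc n = 0 \<longrightarrow> C' = {x0})) \<and> N C \<subseteq> C'"
      if "cpt C \<and> (n = 0 \<longrightarrow> C = {x0})" for C n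
      using N_pre[of C] that unfolding precompact_def by auto
  qed
  then obtain K where "\<And>n::nat. (cpt (K n) \<and> (n = 0 \<longrightarrow> K n = {x0})) \<and> N (K n) \<subseteq> K (Suc n)" by blast
  then have K: "\<And>n::nat. cpt (K n)" "K 0 = {x0}" "\<And>n. N (K n) \<subseteq> K (Suc n)" by simp_all
  define A where "A = (\<Union>n. N (K n))"
  have "open_X A" unfolding A_def using N_open K(1) by auto
  moreover have "closedin (top_of_set X) A"
    unfolding closedin_limpt
  proof (intro conjI allI impI)
    show "A \<subseteq> X" by (auto simp: A_def N_def)
    fix y assume y: "y islimpt A \<and> y \<in> X"
    then have "\<rho> y / 4 > 0" using pos by simp
    then obtain x where x: "x \<in> A" "dist x y < \<rho> y / 4" using y unfolding islimpt_approachable by blast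
    then obtain n where n: "x \<in> N (K n)" by (auto simp: A_def)
    have "x \<in> K (Suc n)" "x \<in> X" using n K(3) K(1)[of "Suc n"] by blast+
    have "\<rho> x \<ge> \<rho> y - dist y x" using lip y \<open>x \<in> X\<close> by blast
    then have "dist x y < \<rho> x / 2" using x pos[of x] \<open>x \<in> X\<close> y pos[of y] by (simp add: dist_commute)
    then have "y \<in> N (K (Suc n))" using y \<open>x \<in> K (Suc n)\<close> unfolding N_def by blast
    then show "y \<in> A" by (auto simp: A_def)
  qed
  moreover have "x0 \<in> A" using N_sup[of "K 0"] x0 K(2) unfolding A_def by (metis UN_I UNIV_I empty_subsetI insert_subset)
  ultimately have A: "A = X"
    using path_connected_imp_connected[OF path_connected] unfolding connected_clopen by blast
  have mono: "K n \<subseteq> K (Suc n)" for n using N_sup[of "K n"] K by blast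
  have "\<exists>n. C \<subseteq> K n" if C: "cpt C" for C
  proof -
    have "\<exists>T. open T \<and> N (K n) = X \<inter> T" for n
      using N_open[of "K n"] K(1) unfolding openin_open by blast
    then obtain T where T: "\<And>n. open (T n)" "\<And>n. N (K n) = X \<inter> T n" by metis
    have "C \<subseteq> (\<Union>n. T n)" using C A T(2) unfolding A_def by blast
    then obtain I where I: "finite I" "C \<subseteq> (\<Union>n\<in>I. T n)"
      using compactE_image[of C UNIV T] C T(1) by metis
    have "C \<subseteq> K (Suc (Max (insert 0 I)))"
    proof
      fix y assume y: "y \<in> C"
      then obtain n where n: "n \<in> I" "y \<in> T n" using I by blast
      then have "y \<in> K (Suc n)" using T(2)[of n] K(3) C y by blast
      moreover have "n \<le> Max (insert 0 I)" using n I by simp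
      ultimately show "y \<in> K (Suc (Max (insert 0 I)))"
        using lift_Suc_mono_le[of K, OF mono] by (meson Suc_le_mono subsetD)
    qed
    then show ?thesis by blast
  qed
  then show ?thesis using that K(1) mono by blast
qed

end

section \<open>Ends of the universal cover\<close>

text \<open>
  Paths in \<open>Y\<close> with a common start represent points of the universal cover of \<open>Y\<close>. In these terms \<open>u\<close> and
  \<open>v\<close> lie in the same path component of the preimage of \<open>F\<close>: the lift of \<open>q\<close> connects them.
\<close>
definition joined :: "'a::metric_space set \<Rightarrow> 'a set \<Rightarrow> (real \<Rightarrow> 'a) \<Rightarrow> (real \<Rightarrow> 'a) \<Rightarrow> bool" where
  "joined Y F u v \<longleftrightarrow> path_in Y u \<and> path_in Y v \<and>
     (\<exists>q. path_in Y q \<and> path_in F q \<and> pathstart q = pathfinish u \<and> homotopic_paths Y (u +++ q) v)"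

lemma joined_extend:
  "\<lbrakk>path_in Y u; path_in Y q; path_in F q; pathstart q = pathfinish u\<rbrakk> \<Longrightarrow> joined Y F u (u +++ q)"
  unfolding joined_def by (metis hom_refl path_in_join)

lemma joined_homotopic:
  assumes "homotopic_paths Y u v" "pathfinish u \<in> F"
  shows "joined Y F u v"
proof -
  have p: "path_in Y u" "path_in Y v" using assms(1) homotopic_paths_path_in by blast+
  have "homotopic_paths Y (u +++ (\<lambda>_. pathfinish u)) v"
    using hom_rconst[OF p(1) refl] assms(1) homotopic_paths_trans by blast
  then show ?thesis
    unfolding joined_def using p assms(2) path_in_ends(2)[OF p(1)]
    by (intro conjI exI[of _ "\<lambda>_. pathfinish u"]) auto
qed

lemma joined_sym: "joined Y F u v \<Longrightarrow> joined Y F v u"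
proof -
  assume "joined Y F u v"
  then obtain q where q: "path_in Y u" "path_in Y v" "path_in Y q" "path_in F q" "pathstart q = pathfinish u"
    "homotopic_paths Y (u +++ q) v" unfolding joined_def by blast
  then have "homotopic_paths Y u (v +++ reversepath q)" using hom_move_right by metis
  then have "homotopic_paths Y (v +++ reversepath q) u" by (rule homotopic_paths_sym)
  moreover have "pathfinish v = pathfinish q" using homotopic_paths_ends[OF q(6)] by simp
  ultimately show ?thesis
    unfolding joined_def using q by (intro conjI exI[of _ "reversepath q"]) auto
qed

lemma joined_trans: "\<lbrakk>joined Y F u v; joined Y F v w\<rbrakk> \<Longrightarrow> joined Y F u w"
proof -
  assume "joined Y F u v" "joined Y F v w"
  then obtain q q' where q: "path_in Y u" "path_in Y v" "path_in Y q" "path_in F q" "pathstart q = pathfinish u"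
    "homotopic_paths Y (u +++ q) v" and q': "path_in Y w" "path_in Y q'" "path_in F q'" "pathstart q' = pathfinish v"
    "homotopic_paths Y (v +++ q') w" unfolding joined_def by blast
  have f: "pathfinish q = pathstart q'" using homotopic_paths_ends[OF q(6)] q' by simp
  have "homotopic_paths Y (u +++ (q +++ q')) ((u +++ q) +++ q')"
    using q q' f by (intro homotopic_paths_sym[OF hom_assoc]) auto
  also have "homotopic_paths Y \<dots> (v +++ q')" using q q' f by (intro hom_right) auto
  also note q'(5)
  finally show ?thesis
    unfolding joined_def using q q' f by (intro conjI exI[of _ "q +++ q'"]) auto
qed

lemma joined_finish_far: "joined Y F u v \<Longrightarrow> pathfinish u \<in> F \<and> pathfinish v \<in> F"
  unfolding joined_def using path_in_ends homotopic_paths_ends by (metis pathfinish_join)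

definition ray_in :: "'a::topological_space set \<Rightarrow> (real \<Rightarrow> 'a) \<Rightarrow> bool" where
  "ray_in S \<rho> \<longleftrightarrow> continuous_on {0..} \<rho> \<and> \<rho> ` {0..} \<subseteq> S"

lemma ray_in_seg: "\<lbrakk>ray_in S \<rho>; a \<ge> 0; b \<ge> 0\<rbrakk> \<Longrightarrow> path_in S (seg \<rho> a b)"
proof -
  assume r: "ray_in S \<rho>" and ab: "a \<ge> 0" "b \<ge> 0"
  have "closed_segment a b \<subseteq> {0..}" using ab by (auto simp: closed_segment_eq_real_ivl)
  then show ?thesis using r by (intro path_in_seg[of "{0..}"]) (auto simp: ray_in_def)
qed

lemma ray_in_mono: "ray_in S \<rho> \<Longrightarrow> S \<subseteq> T \<Longrightarrow> ray_in T \<rho>"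
  by (auto simp: ray_in_def)

lemma ray_seg_join: "\<lbrakk>ray_in S \<rho>; a \<ge> 0; b \<ge> 0; c \<ge> 0\<rbrakk>
    \<Longrightarrow> homotopic_paths S (seg \<rho> a b +++ seg \<rho> b c) (seg \<rho> a c)"
  by (rule homotopic_seg_join[of "{0..}"]) (auto simp: ray_in_def)

text \<open>
  The lifts of the rays \<open>\<rho>\<close> and \<open>\<sigma>\<close> that start at the points \<open>u\<close> and \<open>v\<close> of the universal cover of \<open>Y\<close>
  finally stay in the same path component of the preimage of \<open>F\<close>. If this holds for all
  complements \<open>F\<close> of compact sets, the lifts converge to the same end.
\<close>
definition agree :: "'a::metric_space set \<Rightarrow> 'a set \<Rightarrow> (real \<Rightarrow> 'a) \<Rightarrow> (real \<Rightarrow> 'a) \<Rightarrow> (real \<Rightarrow> 'a) \<Rightarrow> (real \<Rightarrow> 'a) \<Rightarrow> bool"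
  where "agree Y F u \<rho> v \<sigma> \<longleftrightarrow> path_in Y u \<and> path_in Y v \<and> ray_in Y \<rho> \<and> ray_in Y \<sigma> \<and>
     pathfinish u = \<rho> 0 \<and> pathfinish v = \<sigma> 0 \<and>
     (\<exists>a\<ge>0. \<exists>b\<ge>0. \<rho> ` {a..} \<subseteq> F \<and> \<sigma> ` {b..} \<subseteq> F \<and> joined Y F (u +++ seg \<rho> 0 a) (v +++ seg \<sigma> 0 b))"

lemma joined_along_ray:
  assumes u: "path_in Y u" "pathfinish u = \<rho> 0" "ray_in Y \<rho>" and ab: "a \<ge> 0" "b \<ge> 0" "\<rho> ` closed_segment a b \<subseteq> F"
  shows "joined Y F (u +++ seg \<rho> 0 a) (u +++ seg \<rho> 0 b)"
  unfolding joined_def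
proof (intro conjI exI[of _ "seg \<rho> a b"])
  have "closed_segment a b \<subseteq> {0..}" using ab by (auto simp: closed_segment_eq_real_ivl)
  then show "path_in F (seg \<rho> a b)"
    using u(3) ab by (intro path_in_seg[of "{0..}"]) (auto simp: ray_in_def)
  have s: "path_in Y (seg \<rho> x y)" if "x \<ge> 0" "y \<ge> 0" for x y
    using ray_in_seg[OF u(3) that] .
  have "homotopic_paths Y ((u +++ seg \<rho> 0 a) +++ seg \<rho> a b) (u +++ (seg \<rho> 0 a +++ seg \<rho> a b))"
    using u s ab by (intro hom_assoc) auto
  also have "homotopic_paths Y \<dots> (u +++ seg \<rho> 0 b)"
    using u ab by (intro hom_left[OF ray_seg_join[OF u(3)]]) auto
  finally show "homotopic_paths Y ((u +++ seg \<rho> 0 a) +++ seg \<rho> a b) (u +++ seg \<rho> 0 b)" .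
  show "path_in Y (u +++ seg \<rho> 0 a)" "path_in Y (u +++ seg \<rho> 0 b)" "path_in Y (seg \<rho> a b)"
    using u s ab by auto
qed simp

lemma agree_sym: "agree Y F u \<rho> v \<sigma> \<Longrightarrow> agree Y F v \<sigma> u \<rho>"
  unfolding agree_def using joined_sym by blast

lemma agree_refl:
  assumes "path_in Y u" "ray_in Y \<rho>" "pathfinish u = \<rho> 0" "a \<ge> 0" "\<rho> ` {a..} \<subseteq> F"
  shows "agree Y F u \<rho> u \<rho>"
  unfolding agree_def using assms joined_along_ray[of Y u \<rho> a a F] by auto

lemma agree_trans:
  assumes "agree Y F u \<rho> v \<sigma>" "agree Y F v \<sigma> w \<tau>"
  shows "agree Y F u \<rho> w \<tau>"
proof -
  obtain a b where ab: "a \<ge> 0" "b \<ge> 0" "\<rho> ` {a..} \<subseteq> F" "\<sigma> ` {b..} \<subseteq> F"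
    "joined Y F (u +++ seg \<rho> 0 a) (v +++ seg \<sigma> 0 b)" using assms(1) unfolding agree_def by blast
  obtain b' c where c: "b' \<ge> 0" "c \<ge> 0" "\<sigma> ` {b'..} \<subseteq> F" "\<tau> ` {c..} \<subseteq> F"
    "joined Y F (v +++ seg \<sigma> 0 b') (w +++ seg \<tau> 0 c)" using assms(2) unfolding agree_def by blast
  have "\<sigma> ` closed_segment b b' \<subseteq> F"
    using ab(4) c(3) by (auto simp: closed_segment_eq_real_ivl split: if_splits)
  then have "joined Y F (v +++ seg \<sigma> 0 b) (v +++ seg \<sigma> 0 b')"
    using assms(1) ab(2) c(1) by (intro joined_along_ray) (auto simp: agree_def)
  then have "joined Y F (u +++ seg \<rho> 0 a) (w +++ seg \<tau> 0 c)"
    using ab(5) c(5) joined_trans by blast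
  then show ?thesis using assms ab(1,3) c(2,4) unfolding agree_def by blast
qed

lemma agree_homotopic:
  assumes "agree Y F u \<rho> v \<sigma>" "homotopic_paths Y u u'"
  shows "agree Y F u' \<rho> v \<sigma>"
proof -
  obtain a b where ab: "a \<ge> 0" "b \<ge> 0" "\<rho> ` {a..} \<subseteq> F" "\<sigma> ` {b..} \<subseteq> F"
    "joined Y F (u +++ seg \<rho> 0 a) (v +++ seg \<sigma> 0 b)" using assms(1) unfolding agree_def by blast
  have "homotopic_paths Y (u +++ seg \<rho> 0 a) (u' +++ seg \<rho> 0 a)"
    using assms ab(1) by (intro hom_right) (auto simp: agree_def ray_in_seg)
  then have "joined Y F (u +++ seg \<rho> 0 a) (u' +++ seg \<rho> 0 a)"
    using ab(1,3) by (intro joined_homotopic) auto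
  then have "joined Y F (u' +++ seg \<rho> 0 a) (v +++ seg \<sigma> 0 b)"
    using ab(5) joined_sym joined_trans by blast
  moreover have "path_in Y u'" "pathfinish u' = pathfinish u"
    using homotopic_paths_path_in[OF assms(2)] homotopic_paths_ends[OF assms(2)] by auto
  ultimately show ?thesis using assms(1) ab(1-4) unfolding agree_def by metis
qed

lemma joined_agree:
  assumes "joined Y F u v" "ray_in Y \<rho>" "ray_in F \<rho>" "ray_in Y \<sigma>" "ray_in F \<sigma>" "pathfinish u = \<rho> 0" "pathfinish v = \<sigma> 0"
  shows "agree Y F u \<rho> v \<sigma>"
proof -
  have p: "path_in Y u" "path_in Y v" using assms(1) by (auto simp: joined_def)
  have F: "\<rho> ` {0..} \<subseteq> F" "\<sigma> ` {0..} \<subseteq> F" using assms(3,5) by (auto simp: ray_in_def)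
  have "homotopic_paths Y u (u +++ seg \<rho> 0 0)" "homotopic_paths Y v (v +++ seg \<sigma> 0 0)"
    using hom_rconst[OF p(1), of "\<rho> 0"] hom_rconst[OF p(2), of "\<sigma> 0"] assms by (auto intro: homotopic_paths_sym)
  then have "joined Y F u (u +++ seg \<rho> 0 0)" "joined Y F v (v +++ seg \<sigma> 0 0)"
    using joined_homotopic joined_finish_far[OF assms(1)] by blast+
  then have "joined Y F (u +++ seg \<rho> 0 0) (v +++ seg \<sigma> 0 0)"
    using assms(1) joined_sym joined_trans by blast
  then show ?thesis unfolding agree_def using assms p F by blast
qed

lemma agree_joined:
  assumes "agree Y F u \<rho> v \<sigma>" "ray_in F \<rho>" "ray_in F \<sigma>"
  shows "joined Y F u v"
proof -
  obtain a b where ab: "a \<ge> 0" "b \<ge> 0" "joined Y F (u +++ seg \<rho> 0 a) (v +++ seg \<sigma> 0 b)"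
    using assms(1) unfolding agree_def by blast
  have "joined Y F u (u +++ seg \<rho> 0 a)" "joined Y F v (v +++ seg \<sigma> 0 b)"
    using assms ab(1,2) by (auto intro!: joined_extend ray_in_seg simp: agree_def)
  then show ?thesis using ab(3) joined_sym joined_trans by blast
qed

lemma proper_ray_in: "proper_ray X r \<Longrightarrow> ray_in X r"
  by (auto simp: proper_ray_def proper_map_on_def ray_in_def)

lemma proper_ray_tail:
  assumes "proper_ray X r" "compact K" "K \<subseteq> X"
  obtains a where "a \<ge> 0" "r ` {a..} \<subseteq> X - K"
proof -
  have "compact ({0..} \<inter> r -` K)" and r: "r \<in> {0..} \<rightarrow> X"
    using assms unfolding proper_ray_def proper_map_on_def by auto
  then obtain b where b: "\<And>t. t \<in> {0..} \<inter> r -` K \<Longrightarrow> \<bar>t\<bar> \<le> b"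
    using compact_imp_bounded[of "{0..} \<inter> r -` K"] unfolding bounded_iff real_norm_def by blast
  have "r t \<in> X - K" if "t \<ge> max 0 (b + 1)" for t
    using b[of t] that r by fastforce
  then show ?thesis by (intro that[of "max 0 (b + 1)"]) auto
qed

section \<open>Proper actions\<close>

locale acting = tame_space X + group G for X :: "'a::metric_space set" and G (structure) +
  fixes \<phi> :: "'g \<Rightarrow> 'a \<Rightarrow> 'a"
  assumes covering_action: "covering_transformation_action G X \<phi>"
begin

lemma action: "group_action G X \<phi>"
  using covering_action by (simp add: covering_transformation_action_def)

lemma act_in: "\<lbrakk>g \<in> carrier G; x \<in> X\<rbrakk> \<Longrightarrow> \<phi> g x \<in> X"
  using group_action.element_image[OF action] by blast

lemma act_mult: "\<lbrakk>g \<in> carrier G; h \<in> carrier G; x \<in> X\<rbrakk> \<Longrightarrow> \<phi> (g \<otimes> h) x = \<phi> g (\<phi> h x)"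
  using group_action.composition_rule[OF action] by blast

lemma act_one: "x \<in> X \<Longrightarrow> \<phi> \<one> x = x"
  using group_action.id_eq_one[OF action] by (metis restrict_apply')

lemma act_inv: "\<lbrakk>g \<in> carrier G; x \<in> X\<rbrakk> \<Longrightarrow> \<phi> (inv g) (\<phi> g x) = x"
  using act_mult[of "inv g" g x] act_one by simp

lemma act_inv': "\<lbrakk>g \<in> carrier G; x \<in> X\<rbrakk> \<Longrightarrow> \<phi> g (\<phi> (inv g) x) = x"
  using act_mult[of g "inv g" x] act_one by simp

lemma act_continuous: "g \<in> carrier G \<Longrightarrow> continuous_on X (\<phi> g)"
  using covering_action by (simp add: covering_transformation_action_def)

lemma act_subset: "\<lbrakk>g \<in> carrier G; A \<subseteq> X\<rbrakk> \<Longrightarrow> \<phi> g ` A \<subseteq> X"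
  using act_in by blast

lemma act_image_iff: "\<lbrakk>g \<in> carrier G; A \<subseteq> X; x \<in> X\<rbrakk> \<Longrightarrow> x \<in> \<phi> g ` A \<longleftrightarrow> \<phi> (inv g) x \<in> A"
proof -
  assume g: "g \<in> carrier G" and A: "A \<subseteq> X" and x: "x \<in> X"
  have "\<phi> (inv g) x \<in> A" if "x \<in> \<phi> g ` A"
  proof -
    from that obtain a where a: "a \<in> A" "x = \<phi> g a" by (rule imageE)
    then show ?thesis using act_inv[OF g, of a] A by auto
  qed
  moreover have "x \<in> \<phi> g ` A" if "\<phi> (inv g) x \<in> A"
    using that act_inv'[OF g x] image_eqI[of x "\<phi> g" "\<phi> (inv g) x"] by simp
  ultimately show ?thesis by blast
qed

lemma act_image_mult: "\<lbrakk>g \<in> carrier G; h \<in> carrier G; A \<subseteq> X\<rbrakk> \<Longrightarrow> \<phi> (g \<otimes> h) ` A = \<phi> g ` \<phi> h ` A"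
  by (auto simp: act_mult subset_iff image_image)

lemma act_image_one: "A \<subseteq> X \<Longrightarrow> \<phi> \<one> ` A = A"
  by (auto simp: act_one subset_iff image_iff)

lemma act_open: "\<lbrakk>g \<in> carrier G; open_X U\<rbrakk> \<Longrightarrow> open_X (\<phi> g ` U)"
proof -
  assume g: "g \<in> carrier G" and U: "open_X U"
  have "open_X (X \<inter> \<phi> (inv g) -` U)"
    by (rule continuous_openin_preimage[OF act_continuous _ U]) (use g act_in in auto)
  moreover have "X \<inter> \<phi> (inv g) -` U = \<phi> g ` U"
    using act_image_iff[OF g open_X_subset[OF U]] act_subset[OF g open_X_subset[OF U]] by blast
  ultimately show ?thesis by simp
qed

lemma act_cpt: "\<lbrakk>g \<in> carrier G; cpt K\<rbrakk> \<Longrightarrow> cpt (\<phi> g ` K)"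
  using act_continuous act_subset by (meson compact_continuous_image continuous_on_subset)

lemma act_precompact: "\<lbrakk>g \<in> carrier G; precompact A\<rbrakk> \<Longrightarrow> precompact (\<phi> g ` A)"
  unfolding precompact_def using act_cpt by (meson image_mono)

lemma act_path: "\<lbrakk>g \<in> carrier G; path_in A p; A \<subseteq> X\<rbrakk> \<Longrightarrow> path_in (\<phi> g ` A) (\<phi> g \<circ> p)"
  using act_continuous continuous_on_subset by (intro path_in_compose) blast+

lemma act_path_connected: "\<lbrakk>g \<in> carrier G; path_connected A; A \<subseteq> X\<rbrakk> \<Longrightarrow> path_connected (\<phi> g ` A)"
  using act_continuous continuous_on_subset by (intro path_connected_continuous_image) blast+

lemma act_connected: "\<lbrakk>g \<in> carrier G; connected A; A \<subseteq> X\<rbrakk> \<Longrightarrow> connected (\<phi> g ` A)"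
  using act_continuous continuous_on_subset by (intro connected_continuous_image) blast+

lemma act_homotopic:
  "\<lbrakk>g \<in> carrier G; homotopic_paths A p q; A \<subseteq> X\<rbrakk> \<Longrightarrow> homotopic_paths (\<phi> g ` A) (\<phi> g \<circ> p) (\<phi> g \<circ> q)"
  by (rule homotopic_paths_continuous_image[where h = "\<phi> g" and S = A])
    (auto intro: act_continuous continuous_on_subset)

lemma act_meet_shift:
  assumes "g \<in> carrier G" "h \<in> carrier G" "A \<subseteq> X" "B \<subseteq> X"
  shows "\<phi> g ` A \<inter> \<phi> h ` B \<noteq> {} \<longleftrightarrow> A \<inter> \<phi> (inv g \<otimes> h) ` B \<noteq> {}"
proof -
  have "\<phi> h b \<in> \<phi> g ` A \<longleftrightarrow> \<phi> (inv g \<otimes> h) b \<in> A" if "b \<in> B" for b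
    using act_image_iff[OF assms(1,3), of "\<phi> h b"] act_in[OF assms(2), of b] act_mult[of "inv g" h b]
      subsetD[OF assms(4) that] assms(1,2) by simp
  then have "(\<exists>b\<in>B. \<phi> h b \<in> \<phi> g ` A) \<longleftrightarrow> (\<exists>b\<in>B. \<phi> (inv g \<otimes> h) b \<in> A)" by simp
  moreover have "C \<inter> \<phi> k ` B \<noteq> {} \<longleftrightarrow> (\<exists>b\<in>B. \<phi> k b \<in> C)" for C k by auto
  ultimately show ?thesis by simp
qed

text \<open>
  If \<open>y = \<phi> h x\<close>, a neighbourhood that is disjoint from its translates and its image under \<open>\<phi> h\<close> will
  do. For points of different orbits the orbit space separates them.
\<close>
lemma point_pair_proper:
  assumes "x \<in> X" "y \<in> X"
  shows "\<exists>U V. open_X U \<and> x \<in> U \<and> open_X V \<and> y \<in> V \<and> finite {g \<in> carrier G. \<phi> g ` U \<inter> V \<noteq> {}}"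
proof (cases "y \<in> orbit G \<phi> x")
  case True
  then obtain h where h: "h \<in> carrier G" "y = \<phi> h x" by (auto simp: orbit_def)
  obtain U where U: "open_X U" "x \<in> U" "\<And>g. \<lbrakk>g \<in> carrier G; g \<noteq> \<one>\<rbrakk> \<Longrightarrow> \<phi> g ` U \<inter> U = {}"
    using covering_action assms(1) unfolding covering_transformation_action_def by metis
  have sub: "{g \<in> carrier G. \<phi> g ` U \<inter> \<phi> h ` U \<noteq> {}} \<subseteq> {h}"
  proof clarify
    fix g assume g: "g \<in> carrier G" and ne: "\<phi> g ` U \<inter> \<phi> h ` U \<noteq> {}"
    then have "U \<inter> \<phi> (inv g \<otimes> h) ` U \<noteq> {}"
      using act_meet_shift[of g h U U] h open_X_subset[OF U(1)] by blast
    then have "inv g \<otimes> h = \<one>" using U(3)[of "inv g \<otimes> h"] g h by blast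
    then show "g = h" using g h by (metis inv_inv inv_closed inv_equality)
  qed
  then have "finite {g \<in> carrier G. \<phi> g ` U \<inter> \<phi> h ` U \<noteq> {}}" by (rule finite_subset) simp
  then show ?thesis using U h act_open[OF h(1) U(1)] by blast
next
  case False
  have "\<forall>x\<in>X. \<forall>y\<in>X. y \<notin> orbit G \<phi> x \<longrightarrow>
        (\<exists>U V. open_X U \<and> x \<in> U \<and> open_X V \<and> y \<in> V \<and> (\<forall>g\<in>carrier G. \<phi> g ` U \<inter> V = {}))"
    using covering_action by (simp add: covering_transformation_action_def)
  from this[rule_format, OF assms False] obtain U V where
    UV: "open_X U" "x \<in> U" "open_X V" "y \<in> V" "\<forall>g\<in>carrier G. \<phi> g ` U \<inter> V = {}" by auto
  have "finite {g \<in> carrier G. \<phi> g ` U \<inter> V \<noteq> {}}"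
    using UV(5) by (simp cong: conj_cong)
  then show ?thesis using UV by blast
qed

text \<open>Freeness near each point and a Hausdorff orbit space make the action properly discontinuous.\<close>
lemma proper_action:
  assumes "precompact A" "precompact B"
  shows "finite {g \<in> carrier G. \<phi> g ` A \<inter> B \<noteq> {}}"
proof -
  obtain K L where K: "cpt K" "A \<subseteq> K" and L: "cpt L" "B \<subseteq> L" using assms by (auto simp: precompact_def)
  define fin where "fin U V \<longleftrightarrow> finite {g \<in> carrier G. \<phi> g ` U \<inter> V \<noteq> {}}" for U V
  have fin_mono: "fin U V" if "fin U' V'" "U \<subseteq> U'" "V \<subseteq> V'" for U V U' V'
    using that(1) unfolding fin_def by (rule rev_finite_subset) (use that in blast)
  have point: "\<exists>T. open T \<and> x \<in> T \<and> fin (X \<inter> T) L" if x: "x \<in> X" for x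
  proof -
    have "\<exists>S T. open S \<and> open T \<and> x \<in> S \<and> y \<in> T \<and> fin (X \<inter> S) (X \<inter> T)" if "y \<in> X" for y
    proof -
      obtain U V where "open_X U" "x \<in> U" "open_X V" "y \<in> V" "fin U V"
        using point_pair_proper[OF x \<open>y \<in> X\<close>] unfolding fin_def by blast
      moreover from this obtain S T where "open S" "U = X \<inter> S" "open T" "V = X \<inter> T"
        unfolding openin_open by blast
      ultimately show ?thesis by blast
    qed
    then obtain S T where ST: "\<And>y. y \<in> X \<Longrightarrow> open (S y)" "\<And>y. y \<in> X \<Longrightarrow> open (T y)"
      "\<And>y. y \<in> X \<Longrightarrow> x \<in> S y" "\<And>y. y \<in> X \<Longrightarrow> y \<in> T y" "\<And>y. y \<in> X \<Longrightarrow> fin (X \<inter> S y) (X \<inter> T y)"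
      by metis
    have "L \<subseteq> (\<Union>y\<in>L. T y)" using ST(4) L by blast
    then obtain I where I: "I \<subseteq> L" "finite I" "L \<subseteq> (\<Union>y\<in>I. T y)"
      using compactE_image[of L L T] L ST(2) by (metis subsetD)
    have "fin (X \<inter> (\<Inter>y\<in>I. S y)) L"
    proof -
      have "finite (\<Union>y\<in>I. {g \<in> carrier G. \<phi> g ` (X \<inter> S y) \<inter> (X \<inter> T y) \<noteq> {}})"
        using I L ST(5) by (intro finite_UN_I) (auto simp: fin_def)
      moreover have "{g \<in> carrier G. \<phi> g ` (X \<inter> (\<Inter>y\<in>I. S y)) \<inter> L \<noteq> {}} \<subseteq> \<dots>"
      proof
        fix g assume "g \<in> {g \<in> carrier G. \<phi> g ` (X \<inter> (\<Inter>y\<in>I. S y)) \<inter> L \<noteq> {}}"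
        then obtain x where g: "g \<in> carrier G" "x \<in> X \<inter> (\<Inter>y\<in>I. S y)" "\<phi> g x \<in> L" by auto
        obtain y where "y \<in> I" "\<phi> g x \<in> T y" using I(3) g(3) by blast
        moreover from this have "\<phi> g x \<in> \<phi> g ` (X \<inter> S y) \<inter> (X \<inter> T y)"
          using g L(1) by auto
        ultimately show "g \<in> (\<Union>y\<in>I. {g \<in> carrier G. \<phi> g ` (X \<inter> S y) \<inter> (X \<inter> T y) \<noteq> {}})"
          using g(1) by auto
      qed
      ultimately show ?thesis unfolding fin_def by (rule rev_finite_subset)
    qed
    moreover have "open (\<Inter>y\<in>I. S y)" using I L ST(1) by (intro open_INT) auto
    moreover have "x \<in> (\<Inter>y\<in>I. S y)" using I L ST(3) by auto
    ultimately show ?thesis by blast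
  qed
  then obtain T where T: "\<And>x. x \<in> X \<Longrightarrow> open (T x)" "\<And>x. x \<in> X \<Longrightarrow> x \<in> T x" "\<And>x. x \<in> X \<Longrightarrow> fin (X \<inter> T x) L"
    by metis
  have "K \<subseteq> (\<Union>x\<in>K. T x)" using T(2) K by blast
  then obtain I where I: "I \<subseteq> K" "finite I" "K \<subseteq> (\<Union>x\<in>I. T x)"
    using compactE_image[of K K T] K T(1) by (metis subsetD)
  have "finite (\<Union>x\<in>I. {g \<in> carrier G. \<phi> g ` (X \<inter> T x) \<inter> L \<noteq> {}})"
    using I K T(3) by (intro finite_UN_I) (auto simp: fin_def)
  moreover have "{g \<in> carrier G. \<phi> g ` K \<inter> L \<noteq> {}} \<subseteq> \<dots>"
  proof
    fix g assume "g \<in> {g \<in> carrier G. \<phi> g ` K \<inter> L \<noteq> {}}"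
    then obtain k where g: "g \<in> carrier G" "k \<in> K" "\<phi> g k \<in> L" by auto
    obtain x where "x \<in> I" "k \<in> T x" using I(3) g(2) by blast
    then show "g \<in> (\<Union>x\<in>I. {g \<in> carrier G. \<phi> g ` (X \<inter> T x) \<inter> L \<noteq> {}})"
      using g K(1) by auto
  qed
  ultimately have "fin K L" unfolding fin_def by (rule rev_finite_subset)
  then show ?thesis using fin_mono K(2) L(2) unfolding fin_def by blast
qed

end

section \<open>Rays of the Cayley graph\<close>

locale semistable_action = acting +
  fixes J J0 C0 C zv ze
  assumes subgroup_J: "subgroup J G" and infinite_J: "infinite J"
    and generating: "finite_generating_set G J J0"
    and cayley: "equivariant_cayley_map G X \<phi> J J0 zv ze"
    and C0: "cpt C0" and C: "cpt C" "C0 \<subseteq> C"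
    and semistable: "\<And>D r s. \<lbrakk>cpt D; proper_edge_path_ray G J J0 r; proper_edge_path_ray G J J0 s;
       edge_source G (r 0) = edge_source G (s 0); ray_image ze r ` {0..} \<subseteq> X - C; ray_image ze s ` {0..} \<subseteq> X - C\<rbrakk> \<Longrightarrow>
           \<exists>a\<ge>0. \<exists>b\<ge>0. \<exists>\<delta>. path \<delta> \<and> path_image \<delta> \<subseteq> X - D \<and>
              pathstart \<delta> = ray_image ze r a \<and> pathfinish \<delta> = ray_image ze s b \<and>
              homotopic_paths (X - C0)
                ((\<lambda>t. ray_image ze r (a * t)) +++ \<delta> +++ reversepath (\<lambda>t. ray_image ze s (b * t)))
                (\<lambda>_. ray_image ze r 0)"
begin

definition Y where "Y = X - C0"

lemma Y_subset: "Y \<subseteq> X"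
  by (auto simp: Y_def)

lemma avoid_C: "X - C \<subseteq> Y"
  using C by (auto simp: Y_def)

lemma J_carrier: "g \<in> J \<Longrightarrow> g \<in> carrier G"
  using subgroup.subset[OF subgroup_J] by blast

lemma J_mult [simp, intro]: "\<lbrakk>g \<in> J; h \<in> J\<rbrakk> \<Longrightarrow> g \<otimes> h \<in> J"
  by (rule subgroup.m_closed[OF subgroup_J])

lemma J_one [simp, intro]: "\<one> \<in> J"
  by (rule subgroup.one_closed[OF subgroup_J])

lemma J_inv [simp, intro]: "g \<in> J \<Longrightarrow> inv g \<in> J"
  by (rule subgroup.m_inv_closed[OF subgroup_J])

lemma J0: "finite J0" "J0 \<subseteq> J" "generate G J0 = J"
  using generating by (auto simp: finite_generating_set_def)

lemma zv_in: "g \<in> J \<Longrightarrow> zv g \<in> X"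
  using cayley by (simp add: equivariant_cayley_map_def)

lemma zv_mult: "\<lbrakk>h \<in> J; g \<in> J\<rbrakk> \<Longrightarrow> zv (h \<otimes> g) = \<phi> h (zv g)"
  using cayley by (simp add: equivariant_cayley_map_def)

lemma zv_eq: "g \<in> J \<Longrightarrow> zv g = \<phi> g (zv \<one>)"
  using zv_mult[of g \<one>] J_carrier by simp

lemma ze: "\<lbrakk>g \<in> J; s \<in> J0\<rbrakk> \<Longrightarrow> path_in X (ze g s) \<and> pathstart (ze g s) = zv g \<and> pathfinish (ze g s) = zv (g \<otimes> s)"
  using cayley by (simp add: equivariant_cayley_map_def path_in_def)

lemma ze_mult: "\<lbrakk>h \<in> J; g \<in> J; s \<in> J0; t \<in> {0..1}\<rbrakk> \<Longrightarrow> ze (h \<otimes> g) s t = \<phi> h (ze g s t)"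
  using cayley by (simp add: equivariant_cayley_map_def)

lemma ze_image: "\<lbrakk>h \<in> J; g \<in> J; s \<in> J0\<rbrakk> \<Longrightarrow> path_image (ze (h \<otimes> g) s) = \<phi> h ` path_image (ze g s)"
  unfolding path_image_def image_image using ze_mult by (intro image_cong) auto

lemma finite_J_meeting: "\<lbrakk>precompact A; precompact B\<rbrakk> \<Longrightarrow> finite {g \<in> J. \<phi> g ` A \<inter> B \<noteq> {}}"
  by (rule finite_subset[OF _ proper_action[of A B]]) (auto dest: J_carrier)

definition touching :: "'a set \<Rightarrow> 'b set" where
  "touching K = {g \<in> J. \<exists>s\<in>J0. path_image (ze g s) \<inter> K \<noteq> {}}"

lemma finite_touching: "cpt K \<Longrightarrow> finite (touching K)"
proof -
  assume K: "cpt K"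
  have "touching K \<subseteq> (\<Union>s\<in>J0. {g \<in> J. \<phi> g ` path_image (ze \<one> s) \<inter> K \<noteq> {}})"
  proof
    fix g assume "g \<in> touching K"
    then obtain s where s: "g \<in> J" "s \<in> J0" "path_image (ze g s) \<inter> K \<noteq> {}" by (auto simp: touching_def)
    then have "path_image (ze g s) = \<phi> g ` path_image (ze \<one> s)"
      using ze_image[of g \<one> s] J_carrier by simp
    then show "g \<in> (\<Union>s\<in>J0. {g \<in> J. \<phi> g ` path_image (ze \<one> s) \<inter> K \<noteq> {}})" using s by auto
  qed
  moreover have "finite \<dots>"
    using J0 K ze[of \<one>] by (intro finite_UN_I finite_J_meeting precompact_cpt)
      (auto simp: path_in_def compact_path_image)
  ultimately show ?thesis by (rule finite_subset)
qed

definition cayley_edges :: "('b \<times> 'b) set" where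
  "cayley_edges = {(g, h). g \<in> J \<and> h \<in> J \<and> (\<exists>s\<in>J0. h = g \<otimes> s \<or> g = h \<otimes> s)}"

lemma sym_cayley_edges: "sym cayley_edges"
  by (auto simp: sym_def cayley_edges_def)

lemma finite_cayley_edges: "finite (cayley_edges `` {g})"
proof (cases "g \<in> J")
  case True
  have "cayley_edges `` {g} \<subseteq> (\<lambda>s. g \<otimes> s) ` J0 \<union> (\<lambda>s. g \<otimes> inv s) ` J0"
  proof
    fix h assume "h \<in> cayley_edges `` {g}"
    then obtain s where s: "h \<in> J" "s \<in> J0" "h = g \<otimes> s \<or> g = h \<otimes> s" by (auto simp: cayley_edges_def)
    then have "h \<in> carrier G" "s \<in> carrier G" using J_carrier J0 by auto
    then have "g = h \<otimes> s \<Longrightarrow> h = g \<otimes> inv s" by (simp add: m_assoc)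
    then show "h \<in> (\<lambda>s. g \<otimes> s) ` J0 \<union> (\<lambda>s. g \<otimes> inv s) ` J0" using s by auto
  qed
  then show ?thesis using J0(1) by (meson finite_Un finite_imageI finite_subset)
qed (auto simp: cayley_edges_def)

lemma cayley_connected:
  assumes "g \<in> J" "h \<in> J"
  shows "h \<in> reach cayley_edges J g"
proof -
  have step: "g \<otimes> k \<in> reach cayley_edges J g" if "k \<in> generate G J0" "g \<in> J" for g k
    using that
  proof (induction k arbitrary: g)
    case one
    then show ?case using J_carrier by simp
  next
    case (incl h)
    have "(g, g \<otimes> h) \<in> cayley_edges" using incl J0(2) by (auto simp: cayley_edges_def)
    then show ?case using incl J0(2) by (intro reach_step[OF reach_self]) auto
  next
    case (inv h)
    have "h \<in> carrier G" "g \<in> carrier G" using inv J0(2) J_carrier by auto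
    then have "g = (g \<otimes> inv h) \<otimes> h" by (simp add: m_assoc)
    moreover have "g \<otimes> inv h \<in> J" using inv J0(2) by auto
    ultimately have "(g, g \<otimes> inv h) \<in> cayley_edges" using inv J0(2) by (auto simp: cayley_edges_def)
    then show ?case using inv \<open>g \<otimes> inv h \<in> J\<close> by (intro reach_step[OF reach_self]) auto
  next
    case (eng h1 h2)
    have h: "h1 \<in> J" "h2 \<in> J" using eng J0 by auto
    have "g \<otimes> h1 \<otimes> h2 \<in> reach cayley_edges J (g \<otimes> h1)" using eng h by blast
    moreover have "g \<otimes> h1 \<otimes> h2 = g \<otimes> (h1 \<otimes> h2)" using eng h J_carrier by (simp add: m_assoc)
    ultimately show ?case using eng reach_trans by metis
  qed
  have "inv g \<otimes> h \<in> J" using assms by blast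
  then have "g \<otimes> (inv g \<otimes> h) \<in> reach cayley_edges J g" using step J0(3) assms by simp
  then show ?thesis using assms J_carrier by (simp add: m_assoc[symmetric])
qed

definition zray :: "'a set \<Rightarrow> 'b \<Rightarrow> (nat \<Rightarrow> 'b oriented_edge) \<Rightarrow> bool" where
  "zray K g e \<longleftrightarrow> proper_edge_path_ray G J J0 e \<and> edge_source G (e 0) = g \<and> ray_image ze e ` {0..} \<subseteq> X - K"

lemma edge_image_path:
  assumes "e \<in> J \<times> J0 \<times> UNIV"
  shows "path_in X (edge_image ze e)" "pathstart (edge_image ze e) = zv (edge_source G e)"
    "pathfinish (edge_image ze e) = zv (edge_target G e)" "path_image (edge_image ze e) = path_image (ze (fst e) (fst (snd e)))"
  using assms ze by (cases e; auto)+

lemma zray_of_vertices: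
  assumes f: "\<And>n. f n \<in> J - touching K" "\<And>n. (f n, f (Suc n)) \<in> cayley_edges" "inj f"
  shows "\<exists>e. zray K (f 0) e"
proof -
  have "\<exists>e\<in>J \<times> J0 \<times> UNIV. edge_source G e = f n \<and> edge_target G e = f (Suc n) \<and> fst e \<in> {f n, f (Suc n)}" for n
  proof -
    obtain s where s: "s \<in> J0" "f (Suc n) = f n \<otimes> s \<or> f n = f (Suc n) \<otimes> s"
      using f(2)[of n] by (auto simp: cayley_edges_def)
    then show ?thesis
    proof (elim disjE)
      assume "f (Suc n) = f n \<otimes> s"
      then show ?thesis using s f(1)[of n] by (intro bexI[of _ "(f n, s, True)"]) auto
    next
      assume "f n = f (Suc n) \<otimes> s"
      then show ?thesis using s f(1)[of "Suc n"] by (intro bexI[of _ "(f (Suc n), s, False)"]) auto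
    qed
  qed
  then obtain e where e: "\<And>n. e n \<in> J \<times> J0 \<times> UNIV" "\<And>n. edge_source G (e n) = f n"
    "\<And>n. edge_target G (e n) = f (Suc n)" "\<And>n. fst (e n) \<in> {f n, f (Suc n)}" by metis
  have "finite {n. edge_source G (e n) = v}" for v
  proof -
    have "{n. edge_source G (e n) = v} = f -` {v}" using e by auto
    then show ?thesis using f(3) by (simp add: finite_vimageI)
  qed
  then have "proper_edge_path_ray G J J0 e"
    using e by (auto simp: proper_edge_path_ray_def)
  moreover have "ray_image ze e t \<in> X - K" if "t \<ge> 0" for t
  proof -
    define n where "n = nat \<lfloor>t\<rfloor>"
    have fr: "frac t \<in> {0..1}" using frac_lt_1[of t] by (simp add: less_imp_le)
    have "fst (e n) \<in> J - touching K" using f(1)[of n] f(1)[of "Suc n"] e(4)[of n] by auto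
    then have "path_image (edge_image ze (e n)) \<inter> K = {}"
      using edge_image_path(4)[OF e(1)[of n]] e(1)[of n] by (auto simp: touching_def)
    moreover have "edge_image ze (e n) (frac t) \<in> path_image (edge_image ze (e n))" "edge_image ze (e n) (frac t) \<in> X"
      using fr path_in_pathD[OF edge_image_path(1)[OF e(1)[of n]] fr] by (auto simp: path_image_def)
    ultimately show ?thesis unfolding ray_image_def n_def by blast
  qed
  ultimately show ?thesis unfolding zray_def using e(2)[of 0] by blast
qed

text \<open>
  The Cayley graph is infinite, connected and locally finite, and by properness of the action only
  finitely many of its edges meet \<open>K\<close>.
\<close>
lemma finite_no_zray:
  assumes K: "cpt K"
  shows "finite {g \<in> J. \<nexists>e. zray K g e}"
proof -
  have "finite {g \<in> J. finite (reach cayley_edges (J - touching K) g)}"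
    using finite_touching[OF K] infinite_J cayley_connected finite_cayley_edges
    by (intro finite_trapped_vertices sym_cayley_edges) (auto simp: touching_def)
  moreover have "{g \<in> J. \<nexists>e. zray K g e} \<subseteq> touching K \<union> {g \<in> J. finite (reach cayley_edges (J - touching K) g)}"
  proof
    fix g assume g: "g \<in> {g \<in> J. \<nexists>e. zray K g e}"
    show "g \<in> touching K \<union> {g \<in> J. finite (reach cayley_edges (J - touching K) g)}"
    proof (rule ccontr)
      assume "\<not> ?thesis"
      then have "g \<in> J - touching K" "infinite (reach cayley_edges (J - touching K) g)" using g by auto
      then obtain f where "f 0 = g" "\<And>n. f n \<in> J - touching K" "\<And>n. (f n, f (Suc n)) \<in> cayley_edges" "inj f"
        using infinite_reach_ray[OF finite_cayley_edges] by metis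
      then show False using zray_of_vertices[of f K] g by auto
    qed
  qed
  ultimately show ?thesis using finite_touching[OF K] by (meson finite_Un finite_subset)
qed

lemma zray_proper: assumes "zray K g e" shows "proper_ray X (ray_image ze e)"
proof -
  have e: "\<And>n. e n \<in> J \<times> J0 \<times> UNIV" "\<And>n. edge_target G (e n) = edge_source G (e (Suc n))"
    "\<And>v. v \<in> J \<Longrightarrow> finite {n. edge_source G (e n) = v}"
    using assms by (auto simp: zray_def proper_edge_path_ray_def)
  have "proper_ray X (\<lambda>t. edge_image ze (e (nat \<lfloor>t\<rfloor>)) (frac t))"
  proof (rule proper_ray_concatenation[of X])
    show "path_in X (edge_image ze (e n))" for n by (rule edge_image_path(1)[OF e(1)])
    show "pathfinish (edge_image ze (e n)) = pathstart (edge_image ze (e (Suc n)))" for n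
      by (simp add: edge_image_path(2,3)[OF e(1)] e(2))
    fix L assume L: "compact L" "L \<subseteq> X"
    define B where "B = {n. edge_source G (e n) \<in> touching L}"
    have "B = (\<Union>v\<in>touching L. {n. edge_source G (e n) = v})" by (auto simp: B_def)
    then have "finite B" using finite_touching L e(3) by (auto simp: touching_def)
    then obtain N where N: "\<forall>n\<in>B. n < N" using finite_nat_set_iff_bounded by blast
    have "path_image (edge_image ze (e n)) \<inter> L = {}" if "n \<ge> N" for n
    proof (rule ccontr)
      assume ne: "path_image (edge_image ze (e n)) \<inter> L \<noteq> {}"
      obtain g s f where en: "e n = (g, s, f)" by (cases "e n")
      have "g \<in> touching L" using ne edge_image_path(4)[OF e(1)[of n]] e(1)[of n] en by (auto simp: touching_def)
      moreover have "g = edge_source G (e n) \<or> g = edge_source G (e (Suc n))"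
        using e(2)[of n] en by (cases f) auto
      ultimately have "n \<in> B \<or> Suc n \<in> B" by (auto simp: B_def)
      then show False using N \<open>n \<ge> N\<close> by auto
    qed
    then show "\<exists>N. \<forall>n\<ge>N. path_image (edge_image ze (e n)) \<inter> L = {}" by blast
  qed simp
  then show ?thesis by (simp add: ray_image_def[abs_def])
qed

lemma zray_start: "zray K g e \<Longrightarrow> ray_image ze e 0 = zv g"
  using edge_image_path(2)[of "e 0"] by (auto simp: zray_def proper_edge_path_ray_def ray_image_def pathstart_def)

lemma zray_ray_in: "zray K g e \<Longrightarrow> ray_in (X - K) (ray_image ze e)"
  using proper_ray_in[OF zray_proper] by (auto simp: ray_in_def zray_def)

lemma zray_ray_in_Y: "zray C g e \<Longrightarrow> ray_in Y (ray_image ze e)"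
  using zray_ray_in avoid_C ray_in_mono by blast

lemma zray_mono: "\<lbrakk>zray L g e; K \<subseteq> L\<rbrakk> \<Longrightarrow> zray K g e"
  by (auto simp: zray_def)

text \<open>
  Semistability is applied off the union of \<open>D\<close> and of initial parts of both rays that end after the
  last visits to \<open>D\<close>. Then the path \<open>\<delta>\<close> starts and ends beyond these visits, and the loop that
  is trivial in \<open>Y\<close> says that \<open>\<delta>\<close> joins the two rays.
\<close>
lemma zrays_agree:
  assumes r: "zray C g r" and s: "zray C g s" and u: "path_in Y u" "pathfinish u = zv g" and D: "cpt D"
  shows "agree Y (X - D) u (ray_image ze r) u (ray_image ze s)"
proof -
  let ?\<rho> = "ray_image ze r" and ?\<sigma> = "ray_image ze s"
  have pr: "proper_ray X ?\<rho>" "proper_ray X ?\<sigma>" using zray_proper r s by auto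
  note rY = zray_ray_in_Y[OF r] zray_ray_in_Y[OF s]
  note start = zray_start[OF r] zray_start[OF s]
  obtain a0 where a0: "a0 \<ge> 0" "?\<rho> ` {a0..} \<subseteq> X - D" using proper_ray_tail[OF pr(1)] D by blast
  obtain b0 where b0: "b0 \<ge> 0" "?\<sigma> ` {b0..} \<subseteq> X - D" using proper_ray_tail[OF pr(2)] D by blast
  define D' where "D' = D \<union> ?\<rho> ` {0..a0} \<union> ?\<sigma> ` {0..b0}"
  have "compact (?\<rho> ` {0..a0})" "compact (?\<sigma> ` {0..b0})"
    using rY by (auto simp: ray_in_def intro!: compact_continuous_image intro: continuous_on_subset)
  then have "cpt D'" using D rY Y_subset unfolding D'_def ray_in_def
    by (intro conjI compact_Un Un_least) (auto simp: image_subset_iff subset_iff)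
  then obtain a b \<delta> where ab: "a \<ge> 0" "b \<ge> 0" and \<delta>: "path \<delta>" "path_image \<delta> \<subseteq> X - D'"
    "pathstart \<delta> = ?\<rho> a" "pathfinish \<delta> = ?\<sigma> b"
    and hom: "homotopic_paths Y (seg ?\<rho> 0 a +++ \<delta> +++ reversepath (seg ?\<sigma> 0 b)) (\<lambda>_. ?\<rho> 0)"
    using semistable[of D' r s] r s unfolding zray_def seg_0 Y_def by auto
  have "?\<rho> a \<notin> D'" "?\<sigma> b \<notin> D'"
    using \<delta> pathstart_in_path_image[of \<delta>] pathfinish_in_path_image[of \<delta>] by auto
  then have "a0 \<le> a" "b0 \<le> b" using ab by (auto simp: D'_def not_le[symmetric])
  then have tails: "?\<rho> ` {a..} \<subseteq> X - D" "?\<sigma> ` {b..} \<subseteq> X - D"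
    using a0 b0 by (auto simp: image_subset_iff)
  have sY: "path_in Y (seg ?\<rho> 0 a)" "path_in Y (seg ?\<sigma> 0 b)" using ray_in_seg rY ab by auto
  have "path_in Y (\<delta> +++ reversepath (seg ?\<sigma> 0 b))"
    using homotopic_paths_path_in[OF hom] path_in_joinD[of Y "seg ?\<rho> 0 a" "\<delta> +++ reversepath (seg ?\<sigma> 0 b)"] \<delta> by simp
  then have \<delta>Y: "path_in Y \<delta>" using path_in_joinD[of Y \<delta> "reversepath (seg ?\<sigma> 0 b)"] \<delta> by simp
  have \<delta>F: "path_in (X - D) \<delta>" using \<delta> by (auto simp: path_in_def D'_def)
  have "homotopic_paths Y ((seg ?\<rho> 0 a +++ \<delta>) +++ reversepath (seg ?\<sigma> 0 b))
      (seg ?\<rho> 0 a +++ \<delta> +++ reversepath (seg ?\<sigma> 0 b))"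
    using sY \<delta>Y \<delta>(3,4) by (intro hom_assoc) (simp_all del: reversepath_seg)
  then have "homotopic_paths Y ((seg ?\<rho> 0 a +++ \<delta>) +++ reversepath (seg ?\<sigma> 0 b)) (\<lambda>_. ?\<rho> 0)"
    using hom by (rule homotopic_paths_trans)
  then have "homotopic_paths Y (seg ?\<rho> 0 a +++ \<delta>) ((\<lambda>_. ?\<rho> 0) +++ reversepath (reversepath (seg ?\<sigma> 0 b)))"
    using sY \<delta>Y \<delta>(3,4) by (intro hom_move_right) (auto simp del: reversepath_seg)
  then have "homotopic_paths Y (seg ?\<rho> 0 a +++ \<delta>) ((\<lambda>_. ?\<rho> 0) +++ seg ?\<sigma> 0 b)"
    by simp
  also have "homotopic_paths Y \<dots> (seg ?\<sigma> 0 b)" using sY start by (intro hom_lconst) auto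
  finally have *: "homotopic_paths Y (seg ?\<rho> 0 a +++ \<delta>) (seg ?\<sigma> 0 b)" .
  have "homotopic_paths Y ((u +++ seg ?\<rho> 0 a) +++ \<delta>) (u +++ (seg ?\<rho> 0 a +++ \<delta>))"
    using u sY \<delta>Y \<delta>(3) start by (intro hom_assoc) auto
  also have "homotopic_paths Y \<dots> (u +++ seg ?\<sigma> 0 b)"
    using u start by (intro hom_left[OF *]) auto
  finally have "homotopic_paths Y ((u +++ seg ?\<rho> 0 a) +++ \<delta>) (u +++ seg ?\<sigma> 0 b)" .
  then have "joined Y (X - D) (u +++ seg ?\<rho> 0 a) (u +++ seg ?\<sigma> 0 b)"
    unfolding joined_def using u sY start \<delta>Y \<delta>F \<delta>(3) by auto
  then show ?thesis unfolding agree_def using u rY start ab tails by auto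
qed

text \<open>
  Prolonging a path by \<open>p\<close> from \<open>zv g\<close> to \<open>zv h\<close> does not change its end, where the end is seen from \<open>zv g\<close> by
  a Cayley ray at \<open>g\<close>, and from \<open>zv h\<close> by a Cayley ray at \<open>h\<close>.
\<close>
definition crosses :: "'b \<Rightarrow> (real \<Rightarrow> 'a) \<Rightarrow> 'b \<Rightarrow> bool" where
  "crosses g p h \<longleftrightarrow> path_in Y p \<and> pathstart p = zv g \<and> pathfinish p = zv h \<and>
     (\<forall>D u r s. cpt D \<and> path_in Y u \<and> pathfinish u = zv g \<and> zray C g r \<and> zray C h s \<longrightarrow>
        agree Y (X - D) u (ray_image ze r) (u +++ p) (ray_image ze s))"

lemma crossesD:
  assumes "crosses g p h"
  shows "path_in Y p" "pathstart p = zv g" "pathfinish p = zv h"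
    "\<And>D u r s. \<lbrakk>cpt D; path_in Y u; pathfinish u = zv g; zray C g r; zray C h s\<rbrakk> \<Longrightarrow>
        agree Y (X - D) u (ray_image ze r) (u +++ p) (ray_image ze s)"
  using assms unfolding crosses_def by blast+

text \<open>
  The edge from \<open>g\<close> to \<open>g s\<close> misses \<open>C\<close>. So the edge followed by a Cayley ray at \<open>g s\<close> is again
  a Cayley ray at \<open>g\<close> off \<open>C\<close>, and it agrees with any other one.
\<close>
lemma crosses_edge:
  assumes g: "g \<in> J" "s \<in> J0" "g \<notin> touching C"
  shows "crosses g (ze g s) (g \<otimes> s)"
proof -
  let ?p = "ze g s"
  have p: "path_in X ?p" "pathstart ?p = zv g" "pathfinish ?p = zv (g \<otimes> s)" using ze g by auto
  have pC: "path_image ?p \<subseteq> X - C" using g p(1) by (auto simp: touching_def path_in_def)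
  then have pY: "path_in Y ?p" using p(1) avoid_C by (auto simp: path_in_def)
  have "agree Y (X - D) u (ray_image ze r) (u +++ ?p) (ray_image ze r')"
    if D: "cpt D" and u: "path_in Y u" "pathfinish u = zv g" and r: "zray C g r" and r': "zray C (g \<otimes> s) r'" for D u r r'
  proof -
    define e where "e = (\<lambda>n. case n of 0 \<Rightarrow> (g, s, True) | Suc m \<Rightarrow> r' m)"
    have e: "e 0 = (g, s, True)" "\<And>n. e (Suc n) = r' n" by (auto simp: e_def)
    have shift: "ray_image ze e (1 + t) = ray_image ze r' t" if "t \<ge> 0" for t
    proof -
      have "\<lfloor>1 + t\<rfloor> = 1 + \<lfloor>t\<rfloor>" by linarith
      then have "nat \<lfloor>1 + t\<rfloor> = Suc (nat \<lfloor>t\<rfloor>)" using that by (simp add: nat_add_distrib)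
      moreover have "frac (1 + t) = frac t" by (simp add: frac_def)
      ultimately show ?thesis by (simp add: ray_image_def e)
    qed
    have first: "ray_image ze e t = ?p t" if "t \<in> {0..1}" for t
    proof (cases "t = 1")
      case True
      then show ?thesis using shift[of 0] zray_start[OF r'] p(3) by (simp add: pathfinish_def)
    next
      case False
      then have "\<lfloor>t\<rfloor> = 0" using that by (simp add: floor_eq_iff)
      then show ?thesis by (simp add: ray_image_def e frac_def)
    qed
    have ze_e: "zray C g e"
      unfolding zray_def proper_edge_path_ray_def
    proof (intro conjI allI ballI)
      have R: "\<And>n. r' n \<in> J \<times> J0 \<times> UNIV" "\<And>n. edge_target G (r' n) = edge_source G (r' (Suc n))"
        "\<And>v. v \<in> J \<Longrightarrow> finite {n. edge_source G (r' n) = v}" "edge_source G (r' 0) = g \<otimes> s"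
        using r' by (auto simp: zray_def proper_edge_path_ray_def)
      show "e n \<in> J \<times> J0 \<times> UNIV" for n using R(1) g by (cases n) (auto simp: e)
      show "edge_target G (e n) = edge_source G (e (Suc n))" for n using R(2,4) by (cases n) (auto simp: e)
      show "finite {n. edge_source G (e n) = v}" if "v \<in> J" for v
      proof -
        have "{n. edge_source G (e n) = v} \<subseteq> insert 0 (Suc ` {n. edge_source G (r' n) = v})"
        proof
          fix n assume "n \<in> {n. edge_source G (e n) = v}"
          then show "n \<in> insert 0 (Suc ` {n. edge_source G (r' n) = v})" by (cases n) (auto simp: e)
        qed
        then show ?thesis using R(3)[OF that] by (meson finite_imageI finite_insert finite_subset)
      qed
      show "edge_source G (e 0) = g" by (simp add: e)
      show "ray_image ze e ` {0..} \<subseteq> X - C"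
      proof clarify
        fix t :: real assume "t \<ge> 0"
        show "ray_image ze e t \<in> X - C"
        proof (cases "t \<le> 1")
          case True
          then show ?thesis using first[of t] pC \<open>t \<ge> 0\<close> by (auto simp: path_image_def image_subset_iff)
        next
          case False
          then have "ray_image ze e t = ray_image ze r' (t - 1)" using shift[of "t - 1"] by simp
          then show ?thesis using r' False by (auto simp: zray_def image_subset_iff)
        qed
      qed
    qed
    note rayY = zray_ray_in_Y[OF ze_e] zray_ray_in_Y[OF r'] and st = zray_start[OF ze_e] zray_start[OF r']
    obtain b where b: "b \<ge> 0" "ray_image ze r' ` {b..} \<subseteq> X - D"
      using proper_ray_tail[OF zray_proper[OF r']] D by blast
    have tail: "ray_image ze e ` {1 + b..} \<subseteq> X - D"
    proof clarify
      fix t assume "t \<ge> 1 + b"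
      then show "ray_image ze e t \<in> X - D" using shift[of "t - 1"] b by (auto simp: image_subset_iff)
    qed
    let ?\<epsilon> = "ray_image ze e" and ?\<rho> = "ray_image ze r'"
    have s1: "homotopic_paths Y (seg ?\<epsilon> 0 1) ?p"
      using rayY(1) by (intro homotopic_paths_eq)
        (use first ray_in_seg[OF rayY(1), of 0 1] in \<open>auto simp: path_in_def seg_def linepath_def\<close>)
    have s2: "homotopic_paths Y (seg ?\<epsilon> 1 (1 + b)) (seg ?\<rho> 0 b)"
    proof (rule homotopic_paths_eq)
      show "path (seg ?\<epsilon> 1 (1 + b))" "path_image (seg ?\<epsilon> 1 (1 + b)) \<subseteq> Y"
        using ray_in_seg[OF rayY(1), of 1 "1 + b"] b by (auto simp: path_in_def)
      fix t :: real assume "t \<in> {0..1}"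
      then show "seg ?\<epsilon> 1 (1 + b) t = seg ?\<rho> 0 b t"
        using shift[of "t * b"] b by (simp add: seg_def linepath_def algebra_simps)
    qed
    have b0: "0 \<le> 1 + b" using b by simp
    have "homotopic_paths Y (u +++ seg ?\<epsilon> 0 (1 + b)) (u +++ (seg ?\<epsilon> 0 1 +++ seg ?\<epsilon> 1 (1 + b)))"
      using u st(1) b0 by (intro hom_left homotopic_paths_sym[OF ray_seg_join[OF rayY(1)]]) auto
    also have "homotopic_paths Y \<dots> (u +++ (?p +++ seg ?\<rho> 0 b))"
      using u st(1) by (intro hom_left[OF homotopic_paths_join[OF s1 s2]]) (simp_all del: seg_0_1)
    also have "homotopic_paths Y \<dots> ((u +++ ?p) +++ seg ?\<rho> 0 b)"
      using u pY p st b ray_in_seg[OF rayY(2)] by (intro homotopic_paths_sym[OF hom_assoc]) auto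
    finally have "joined Y (X - D) (u +++ seg ?\<epsilon> 0 (1 + b)) ((u +++ ?p) +++ seg ?\<rho> 0 b)"
      by (rule joined_homotopic) (use tail in auto)
    then have "agree Y (X - D) u ?\<epsilon> (u +++ ?p) ?\<rho>"
      unfolding agree_def using u pY p rayY st b tail b0
      by (intro conjI exI[of _ "1 + b"] exI[of _ b]) simp_all
    then show ?thesis using zrays_agree[OF r ze_e u D] agree_trans by blast
  qed
  then show ?thesis unfolding crosses_def using pY p by blast
qed

lemma crosses_sym:
  assumes "crosses g p h"
  shows "crosses h (reversepath p) g"
  unfolding crosses_def
proof (intro conjI allI impI)
  note p = crossesD[OF assms]
  show "path_in Y (reversepath p)" "pathstart (reversepath p) = zv h" "pathfinish (reversepath p) = zv g"
    using p by auto
  fix D u r s assume *: "cpt D \<and> path_in Y u \<and> pathfinish u = zv h \<and> zray C h r \<and> zray C g s"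
  then have "agree Y (X - D) (u +++ reversepath p) (ray_image ze s) ((u +++ reversepath p) +++ p) (ray_image ze r)"
    using p by (intro p(4)) auto
  then have "agree Y (X - D) ((u +++ reversepath p) +++ p) (ray_image ze r) (u +++ reversepath p) (ray_image ze s)"
    by (rule agree_sym)
  moreover have "homotopic_paths Y ((u +++ reversepath p) +++ p) u"
    using hom_rinv[of Y u "reversepath p"] * p by auto
  ultimately show "agree Y (X - D) u (ray_image ze r) (u +++ reversepath p) (ray_image ze s)"
    by (rule agree_homotopic)
qed

lemma crosses_trans:
  assumes "crosses g p h" "crosses h q k" "\<exists>e. zray C h e"
  shows "crosses g (p +++ q) k"
  unfolding crosses_def
proof (intro conjI allI impI)
  note p = crossesD[OF assms(1)] and q = crossesD[OF assms(2)]
  show "path_in Y (p +++ q)" "pathstart (p +++ q) = zv g" "pathfinish (p +++ q) = zv k"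
    using p q by auto
  fix D u r s assume *: "cpt D \<and> path_in Y u \<and> pathfinish u = zv g \<and> zray C g r \<and> zray C k s"
  obtain e where e: "zray C h e" using assms(3) by blast
  have "agree Y (X - D) u (ray_image ze r) (u +++ p) (ray_image ze e)"
    using * e by (intro p(4)) auto
  moreover have "agree Y (X - D) (u +++ p) (ray_image ze e) ((u +++ p) +++ q) (ray_image ze s)"
    using * e p by (intro q(4)) auto
  ultimately have "agree Y (X - D) u (ray_image ze r) ((u +++ p) +++ q) (ray_image ze s)"
    by (rule agree_trans)
  moreover have "homotopic_paths Y ((u +++ p) +++ q) (u +++ (p +++ q))"
    using * p q by (intro hom_assoc) auto
  ultimately show "agree Y (X - D) u (ray_image ze r) (u +++ (p +++ q)) (ray_image ze s)"
    using agree_homotopic agree_sym by blast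
qed

definition bad :: "'b set" where
  "bad = touching C \<union> {g \<in> J. \<nexists>e. zray C g e}"

lemma finite_bad: "finite bad"
  using finite_touching[OF C(1)] finite_no_zray[OF C(1)] by (simp add: bad_def)

text \<open>
  Write \<open>h\<close> as a word in the generators. Off \<open>C\<close>, the edge path that spells this word from \<open>g\<close> may be
  composed from crossing edges, provided that it does not visit bad vertices. It visits \<open>g \<otimes> \<pi>\<close> for
  finitely many \<open>\<pi>\<close> and stays in \<open>\<phi> g ` K\<close> for a compact \<open>K\<close> that depends on the word alone.
\<close>
lemma crosses_word:
  assumes "h \<in> J"
  shows "\<exists>K P. cpt K \<and> finite P \<and> P \<subseteq> J \<and>
     (\<forall>g\<in>J. (\<forall>\<pi>\<in>P. g \<otimes> \<pi> \<notin> bad) \<longrightarrow> (\<exists>p. path_in (\<phi> g ` K) p \<and> crosses g p (g \<otimes> h)))"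
proof -
  have "h \<in> generate G J0" using assms J0(3) by simp
  then show ?thesis
  proof (induction h)
    case one
    show ?case
    proof (intro exI[of _ "{zv \<one>}"] exI[of _ "{\<one>}"] conjI ballI impI)
      fix g assume g: "g \<in> J" "\<forall>\<pi>\<in>{\<one>}. g \<otimes> \<pi> \<notin> bad"
      then have nb: "g \<notin> bad" using J_carrier by simp
      then obtain e where e: "zray C g e" using g by (auto simp: bad_def)
      have zY: "zv g \<in> Y" using zray_ray_in_Y[OF e] zray_start[OF e] by (auto simp: ray_in_def)
      have "agree Y (X - D) u (ray_image ze r) (u +++ (\<lambda>_. zv g)) (ray_image ze s)"
        if "cpt D" "path_in Y u" "pathfinish u = zv g" "zray C g r" "zray C g s" for D u r s
      proof -
        have "agree Y (X - D) u (ray_image ze s) u (ray_image ze r)"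
          using that by (intro zrays_agree)
        moreover have "homotopic_paths Y u (u +++ (\<lambda>_. zv g))"
          using hom_rconst[of Y u "zv g"] that homotopic_paths_sym by metis
        ultimately show ?thesis using agree_homotopic agree_sym by blast
      qed
      then have "crosses g (\<lambda>_. zv g) (g \<otimes> \<one>)"
        unfolding crosses_def using zY g J_carrier by auto
      then show "\<exists>p. path_in (\<phi> g ` {zv \<one>}) p \<and> crosses g p (g \<otimes> \<one>)"
        using zv_eq[OF g(1)] by (intro exI[of _ "\<lambda>_. zv g"]) auto
    qed (use zv_in in auto)
  next
    case (incl s)
    show ?case
    proof (intro exI[of _ "path_image (ze \<one> s)"] exI[of _ "{\<one>}"] conjI ballI impI)
      show "compact (path_image (ze \<one> s))" "path_image (ze \<one> s) \<subseteq> X"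
        using ze[of \<one> s] incl by (auto simp: path_in_def compact_path_image)
      fix g assume g: "g \<in> J" "\<forall>\<pi>\<in>{\<one>}. g \<otimes> \<pi> \<notin> bad"
      have "path_in (\<phi> g ` path_image (ze \<one> s)) (ze g s)"
        using ze_image[of g \<one> s] ze[of g s] g incl J_carrier by (auto simp: path_in_def)
      moreover have "crosses g (ze g s) (g \<otimes> s)"
        using g incl J_carrier by (intro crosses_edge) (auto simp: bad_def)
      ultimately show "\<exists>p. path_in (\<phi> g ` path_image (ze \<one> s)) p \<and> crosses g p (g \<otimes> s)" by blast
    qed auto
  next
    case (inv s)
    have s: "s \<in> J" "inv s \<in> J" using inv J0(2) by auto
    show ?case
    proof (intro exI[of _ "path_image (ze (inv s) s)"] exI[of _ "{inv s}"] conjI ballI impI)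
      show "compact (path_image (ze (inv s) s))" "path_image (ze (inv s) s) \<subseteq> X"
        using ze[of "inv s" s] inv s by (auto simp: path_in_def compact_path_image)
      fix g assume g: "g \<in> J" "\<forall>\<pi>\<in>{inv s}. g \<otimes> \<pi> \<notin> bad"
      have gs: "g \<otimes> inv s \<in> J" "(g \<otimes> inv s) \<otimes> s = g" using g s J_carrier by (auto simp: m_assoc)
      have "path_in (\<phi> g ` path_image (ze (inv s) s)) (reversepath (ze (g \<otimes> inv s) s))"
        using ze_image[of g "inv s" s] ze[of "g \<otimes> inv s" s] g inv s gs by (auto simp: path_in_def)
      moreover have "crosses (g \<otimes> inv s) (ze (g \<otimes> inv s) s) ((g \<otimes> inv s) \<otimes> s)"
        using g inv gs by (intro crosses_edge) (auto simp: bad_def)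
      then have "crosses g (reversepath (ze (g \<otimes> inv s) s)) (g \<otimes> inv s)" using crosses_sym gs(2) by simp
      ultimately show "\<exists>p. path_in (\<phi> g ` path_image (ze (inv s) s)) p \<and> crosses g p (g \<otimes> inv s)" by blast
    qed (use s in auto)
  next
    case (eng h1 h2)
    have h: "h1 \<in> J" "h2 \<in> J" using eng J0 by auto
    obtain K1 P1 where IH1: "cpt K1 \<and> finite P1 \<and> P1 \<subseteq> J \<and> (\<forall>g\<in>J. (\<forall>\<pi>\<in>P1. g \<otimes> \<pi> \<notin> bad) \<longrightarrow>
        (\<exists>p. path_in (\<phi> g ` K1) p \<and> crosses g p (g \<otimes> h1)))"
      using eng.IH(1) by (elim exE) auto
    have 1: "cpt K1" "finite P1" "P1 \<subseteq> J" using IH1 by simp_all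
    note step1 = conjunct2[OF conjunct2[OF conjunct2[OF IH1]], rule_format]
    obtain K2 P2 where IH2: "cpt K2 \<and> finite P2 \<and> P2 \<subseteq> J \<and> (\<forall>g\<in>J. (\<forall>\<pi>\<in>P2. g \<otimes> \<pi> \<notin> bad) \<longrightarrow>
        (\<exists>p. path_in (\<phi> g ` K2) p \<and> crosses g p (g \<otimes> h2)))"
      using eng.IH(2) by (elim exE) auto
    have 2: "cpt K2" "finite P2" "P2 \<subseteq> J" using IH2 by simp_all
    note step2 = conjunct2[OF conjunct2[OF conjunct2[OF IH2]], rule_format]
    show ?case
    proof (intro exI[of _ "K1 \<union> \<phi> h1 ` K2"] exI[of _ "insert h1 (P1 \<union> (\<lambda>\<pi>. h1 \<otimes> \<pi>) ` P2)"] conjI ballI impI)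
      have "cpt (\<phi> h1 ` K2)" using act_cpt 2(1) h J_carrier by blast
      then show "compact (K1 \<union> \<phi> h1 ` K2)" "K1 \<union> \<phi> h1 ` K2 \<subseteq> X" using 1(1) by (auto intro: compact_Un)
      fix g assume g: "g \<in> J" "\<forall>\<pi>\<in>insert h1 (P1 \<union> (\<lambda>\<pi>. h1 \<otimes> \<pi>) ` P2). g \<otimes> \<pi> \<notin> bad"
      obtain p where p: "path_in (\<phi> g ` K1) p" "crosses g p (g \<otimes> h1)" using step1[of g] g by auto
      have gh: "g \<otimes> h1 \<in> J" "g \<otimes> h1 \<notin> bad" using g h by auto
      have "(g \<otimes> h1) \<otimes> \<pi> = g \<otimes> (h1 \<otimes> \<pi>)" if "\<pi> \<in> P2" for \<pi>
        using that 2(3) g h J_carrier by (intro m_assoc) auto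
      then have "\<forall>\<pi>\<in>P2. (g \<otimes> h1) \<otimes> \<pi> \<notin> bad" using g(2) by simp
      then obtain q where q: "path_in (\<phi> (g \<otimes> h1) ` K2) q" "crosses (g \<otimes> h1) q (g \<otimes> h1 \<otimes> h2)"
        using step2[OF gh(1)] by auto
      have "\<exists>e. zray C (g \<otimes> h1) e" using gh by (auto simp: bad_def)
      then have "crosses g (p +++ q) (g \<otimes> h1 \<otimes> h2)" using crosses_trans p(2) q(2) by blast
      moreover have "g \<otimes> h1 \<otimes> h2 = g \<otimes> (h1 \<otimes> h2)" using g h J_carrier by (simp add: m_assoc)
      moreover have "\<phi> (g \<otimes> h1) ` K2 = \<phi> g ` \<phi> h1 ` K2"
        using 2(1) g(1) h(1) J_carrier by (intro act_image_mult) auto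
      then have "path_in (\<phi> g ` (K1 \<union> \<phi> h1 ` K2)) (p +++ q)"
        using p q crossesD(2,3)[OF p(2)] crossesD(2)[OF q(2)]
        by (intro path_in_join) (auto intro: path_in_mono simp: image_Un)
      ultimately show "\<exists>p. path_in (\<phi> g ` (K1 \<union> \<phi> h1 ` K2)) p \<and> crosses g p (g \<otimes> (h1 \<otimes> h2))" by auto
    qed (use 1 2 h in auto)
  qed
qed

end

section \<open>The end of a path near the orbit\<close>

context semistable_action
begin

lemma act_comp_inv:
  assumes "g \<in> carrier G" "path_in X p" "t \<in> {0..1}"
  shows "(\<phi> g \<circ> (\<phi> (inv g) \<circ> p)) t = p t"
  using act_inv'[OF assms(1) path_in_pathD[OF assms(2,3)]] by simp

lemma act_paths_homotopic:
  assumes g: "g \<in> carrier G" and MK: "M \<subseteq> X" "K \<subseteq> X"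
    and hom: "\<And>p q. \<lbrakk>path_in M p; path_in M q; pathstart p = pathstart q; pathfinish p = pathfinish q\<rbrakk>
       \<Longrightarrow> homotopic_paths K p q"
    and p: "path_in (\<phi> g ` M) p" and q: "path_in (\<phi> g ` M) q"
    and pq: "pathstart p = pathstart q" "pathfinish p = pathfinish q"
  shows "homotopic_paths (\<phi> g ` K) p q"
proof -
  have pull_back: "path_in M (\<phi> (inv g) \<circ> r)" if "path_in (\<phi> g ` M) r" for r
  proof -
    have "path_in (\<phi> (inv g) ` \<phi> g ` M) (\<phi> (inv g) \<circ> r)"
      using that g act_subset[OF g MK(1)] by (intro act_path) auto
    moreover have "\<phi> (inv g) ` \<phi> g ` M = M"
      using act_image_mult[of "inv g" g M] act_image_one[OF MK(1)] g MK(1) by simp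
    ultimately show ?thesis by simp
  qed
  have "homotopic_paths K (\<phi> (inv g) \<circ> p) (\<phi> (inv g) \<circ> q)"
    using pull_back[OF p] pull_back[OF q] pq by (intro hom) (simp_all add: pathstart_compose pathfinish_compose)
  then have h: "homotopic_paths (\<phi> g ` K) (\<phi> g \<circ> (\<phi> (inv g) \<circ> p)) (\<phi> g \<circ> (\<phi> (inv g) \<circ> q))"
    using act_homotopic[OF g _ MK(2)] by blast
  have eq: "homotopic_paths (\<phi> g ` K) (\<phi> g \<circ> (\<phi> (inv g) \<circ> r)) r"
    if "path_in (\<phi> g ` K) (\<phi> g \<circ> (\<phi> (inv g) \<circ> r))" "path_in (\<phi> g ` M) r" for r
    using that act_comp_inv[OF g path_in_mono[OF that(2) act_subset[OF g MK(1)]]]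
    by (intro homotopic_paths_eq) (auto simp: path_in_def)
  have "path_in (\<phi> g ` K) (\<phi> g \<circ> (\<phi> (inv g) \<circ> p))" "path_in (\<phi> g ` K) (\<phi> g \<circ> (\<phi> (inv g) \<circ> q))"
    using homotopic_paths_path_in[OF h] by auto
  then show ?thesis
    using eq p q h homotopic_paths_sym homotopic_paths_trans by meson
qed

text \<open>
  \<open>sim u v\<close> stands for the statement that \<open>u\<close> and \<open>v\<close>, both with end point in \<open>R\<close>, determine the same end,
  up to the precision given by \<open>D\<close>. The end is not affected by homotopies, by paths inside \<open>R\<close>, or by
  paths off \<open>D'\<close>; and when \<open>u\<close> and \<open>v\<close> themselves end off \<open>D'\<close>, equal ends mean that they are joined off \<open>D\<close>.
\<close>
definition end_relation :: "'a set \<Rightarrow> 'a set \<Rightarrow> 'a set \<Rightarrow> ((real \<Rightarrow> 'a) \<Rightarrow> (real \<Rightarrow> 'a) \<Rightarrow> bool) \<Rightarrow> bool" where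
  "end_relation R D D' sim \<longleftrightarrow> cpt D' \<and> D \<subseteq> D' \<and>
     (\<forall>u v. sim u v \<longrightarrow> sim v u) \<and> (\<forall>u v w. sim u v \<longrightarrow> sim v w \<longrightarrow> sim u w) \<and>
     (\<forall>u v. path_in Y u \<longrightarrow> pathfinish u \<in> R \<longrightarrow> homotopic_paths Y u v \<longrightarrow> sim u v) \<and>
     (\<forall>u q. path_in Y u \<longrightarrow> path_in R q \<longrightarrow> pathstart q = pathfinish u \<longrightarrow> sim u (u +++ q)) \<and>
     (\<forall>u q. path_in Y u \<longrightarrow> path_in Y q \<longrightarrow> path_in (X - D') q \<longrightarrow> pathstart q = pathfinish u \<longrightarrow>
        pathstart q \<in> R \<longrightarrow> pathfinish q \<in> R \<longrightarrow> sim u (u +++ q)) \<and>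
     (\<forall>u v. sim u v \<longrightarrow> pathfinish u \<notin> D' \<longrightarrow> pathfinish v \<notin> D' \<longrightarrow> joined Y (X - D) u v)"

lemma end_relationD:
  assumes "end_relation R D D' sim"
  shows "cpt D'" "D \<subseteq> D'" "\<And>u v. sim u v \<Longrightarrow> sim v u" "\<And>u v w. \<lbrakk>sim u v; sim v w\<rbrakk> \<Longrightarrow> sim u w"
    "\<And>u v. \<lbrakk>path_in Y u; pathfinish u \<in> R; homotopic_paths Y u v\<rbrakk> \<Longrightarrow> sim u v"
    "\<And>u q. \<lbrakk>path_in Y u; path_in R q; pathstart q = pathfinish u\<rbrakk> \<Longrightarrow> sim u (u +++ q)"
    "\<And>u q. \<lbrakk>path_in Y u; path_in Y q; path_in (X - D') q; pathstart q = pathfinish u;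
        pathstart q \<in> R; pathfinish q \<in> R\<rbrakk> \<Longrightarrow> sim u (u +++ q)"
    "\<And>u v. \<lbrakk>sim u v; pathfinish u \<notin> D'; pathfinish v \<notin> D'\<rbrakk> \<Longrightarrow> joined Y (X - D) u v"
proof -
  note e = assms[unfolded end_relation_def]
  show "cpt D'" using conjunct1[OF e] .
  show "D \<subseteq> D'" using conjunct1[OF conjunct2[OF e]] .
  note e1 = conjunct2[OF conjunct2[OF e]]
  note e2 = conjunct2[OF e1] note e3 = conjunct2[OF e2] note e4 = conjunct2[OF e3]
  note e5 = conjunct2[OF e4] note e6 = conjunct2[OF e5]
  show "\<And>u v. sim u v \<Longrightarrow> sim v u" using conjunct1[OF e1] by simp
  show "\<And>u v w. \<lbrakk>sim u v; sim v w\<rbrakk> \<Longrightarrow> sim u w" using conjunct1[OF e2, rule_format] .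
  show "\<And>u v. \<lbrakk>path_in Y u; pathfinish u \<in> R; homotopic_paths Y u v\<rbrakk> \<Longrightarrow> sim u v"
    using conjunct1[OF e3, rule_format] .
  show "\<And>u q. \<lbrakk>path_in Y u; path_in R q; pathstart q = pathfinish u\<rbrakk> \<Longrightarrow> sim u (u +++ q)"
    using conjunct1[OF e4, rule_format] .
  show "\<And>u q. \<lbrakk>path_in Y u; path_in Y q; path_in (X - D') q; pathstart q = pathfinish u;
        pathstart q \<in> R; pathfinish q \<in> R\<rbrakk> \<Longrightarrow> sim u (u +++ q)" using conjunct1[OF e5, rule_format] .
  show "\<And>u v. \<lbrakk>sim u v; pathfinish u \<notin> D'; pathfinish v \<notin> D'\<rbrakk> \<Longrightarrow> joined Y (X - D) u v"
    using e6[rule_format] .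
qed

text \<open>
  Fix a path-connected open set \<open>V\<close> with compact closure containing the base vertex. A path \<open>u\<close> in
  \<open>Y\<close> that ends in a translate \<open>\<phi> g ` V\<close> far from \<open>C\<close> determines an end of the universal cover of
  \<open>Y\<close>: continue \<open>u\<close> inside the translate to the vertex \<open>zv g\<close> and then along a ray of the Cayley
  graph. Semistability makes this independent of all choices. In particular the end does not change
  while the end point of \<open>u\<close> moves inside the translates of \<open>V\<close> and stays away from a compact set.
\<close>
lemma end_invariant:
  assumes V: "open_X V" "path_connected V" "precompact V" "zv \<one> \<in> V"
  obtains E where "cpt E" "(\<Union>g\<in>J. \<phi> g ` V) - E \<subseteq> Y"
    "\<And>D. cpt D \<Longrightarrow> \<exists>D' sim. end_relation ((\<Union>g\<in>J. \<phi> g ` V) - E) D D' sim"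
proof -
  have VX: "V \<subseteq> X" using V(1) open_X_subset by blast
  define V' where "V' = closure V"
  have V': "cpt V'" "V \<subseteq> V'" using precompact_closure[OF V(3)] closure_subset by (auto simp: V'_def)
  define H where "H = {h \<in> J. \<phi> h ` V \<inter> V \<noteq> {}}"
  have finH: "finite H" unfolding H_def using finite_J_meeting[OF V(3) V(3)] .
  define word where "word h K P \<longleftrightarrow> cpt K \<and> finite P \<and> P \<subseteq> J \<and>
     (\<forall>g\<in>J. (\<forall>\<pi>\<in>P. g \<otimes> \<pi> \<notin> bad) \<longrightarrow> (\<exists>p. path_in (\<phi> g ` K) p \<and> crosses g p (g \<otimes> h)))" for h K P
  have "\<exists>K P. word h K P" if "h \<in> J" for h using crosses_word[OF that] unfolding word_def .
  then obtain K P where "\<And>h. h \<in> J \<Longrightarrow> word h (K h) (P h)" by metis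
  then have KP: "\<And>h. h \<in> J \<Longrightarrow> cpt (K h)" "\<And>h. h \<in> J \<Longrightarrow> finite (P h)" "\<And>h. h \<in> J \<Longrightarrow> P h \<subseteq> J"
    and cross: "\<And>h g. \<lbrakk>h \<in> J; g \<in> J; \<forall>\<pi>\<in>P h. g \<otimes> \<pi> \<notin> bad\<rbrakk> \<Longrightarrow> \<exists>p. path_in (\<phi> g ` K h) p \<and> crosses g p (g \<otimes> h)"
    unfolding word_def by simp_all
  define M where "M = V' \<union> (\<Union>h\<in>H. \<phi> h ` V' \<union> K h)"
  have "cpt (\<phi> h ` V' \<union> K h)" if "h \<in> H" for h
    using that KP(1)[of h] act_cpt[OF J_carrier V'(1), of h] by (auto simp: H_def intro: compact_Un)
  then have "cpt M" unfolding M_def by (rule cpt_Un[OF V'(1) cpt_UN[OF finH]])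
  then obtain N where N: "cpt N" "M \<subseteq> N"
    "\<And>p q. \<lbrakk>path_in M p; path_in M q; pathstart p = pathstart q; pathfinish p = pathfinish q\<rbrakk>
       \<Longrightarrow> homotopic_paths N p q" using compact_paths_homotopic by metis
  have MX: "M \<subseteq> X" "N \<subseteq> X" using N \<open>cpt M\<close> by auto
  \<comment> \<open>For a good \<open>g\<close> the words that lead to neighbouring translates cross, and the homotopies near \<open>\<phi> g ` V\<close>
    have room in \<open>Y\<close>. All but finitely many \<open>g\<close> are good, and \<open>E\<close> absorbs the others.\<close>
  define good where "good g \<longleftrightarrow> g \<in> J \<and> g \<notin> bad \<and> (\<forall>h\<in>H. \<forall>\<pi>\<in>P h. g \<otimes> \<pi> \<notin> bad) \<and> \<phi> g ` N \<inter> C0 = {}" for g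
  have good_J: "g \<in> J" "g \<in> carrier G" if "good g" for g using that J_carrier by (auto simp: good_def)
  have "finite {g \<in> J. \<not> good g}"
  proof -
    have "{g \<in> J. g \<otimes> \<pi> \<in> bad} \<subseteq> (\<lambda>b. b \<otimes> inv \<pi>) ` bad" if "\<pi> \<in> J" for \<pi>
    proof
      fix g assume g: "g \<in> {g \<in> J. g \<otimes> \<pi> \<in> bad}"
      then have "g = (g \<otimes> \<pi>) \<otimes> inv \<pi>" using J_carrier that by (simp add: m_assoc)
      then show "g \<in> (\<lambda>b. b \<otimes> inv \<pi>) ` bad" using g by blast
    qed
    then have fin: "finite {g \<in> J. g \<otimes> \<pi> \<in> bad}" if "\<pi> \<in> J" for \<pi>
      using that finite_bad by (meson finite_imageI finite_subset)
    have "{g \<in> J. \<not> good g} \<subseteq> bad \<union> (\<Union>h\<in>H. \<Union>\<pi>\<in>P h. {g \<in> J. g \<otimes> \<pi> \<in> bad}) \<union> {g \<in> J. \<phi> g ` N \<inter> C0 \<noteq> {}}"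
      unfolding good_def by blast
    moreover have "finite (\<Union>h\<in>H. \<Union>\<pi>\<in>P h. {g \<in> J. g \<otimes> \<pi> \<in> bad})"
    proof (intro finite_UN_I finH)
      fix h assume "h \<in> H"
      then have "h \<in> J" by (simp add: H_def)
      then show "finite (P h)" by (rule KP(2))
      fix \<pi> assume "\<pi> \<in> P h"
      then show "finite {g \<in> J. g \<otimes> \<pi> \<in> bad}" using fin KP(3)[OF \<open>h \<in> J\<close>] by blast
    qed
    moreover have "finite {g \<in> J. \<phi> g ` N \<inter> C0 \<noteq> {}}"
      using finite_J_meeting N(1) C0 by blast
    ultimately show ?thesis using finite_bad by (meson finite_Un finite_subset)
  qed
  note fin_not_good = this
  define E where "E = (\<Union>g\<in>{g \<in> J. \<not> good g}. \<phi> g ` V')"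
  have cptE: "cpt E"
  proof -
    have "cpt (\<phi> g ` V')" if "g \<in> J" for g using act_cpt[OF J_carrier[OF that] V'(1)] .
    then show ?thesis unfolding E_def by (intro cpt_UN[OF fin_not_good]) simp
  qed
  define R where "R = (\<Union>g\<in>J. \<phi> g ` V) - E"
  have R_good: "good g" if "x \<in> R" "x \<in> \<phi> g ` V" "g \<in> J" for x g
    using that V'(2) unfolding R_def E_def by blast
  have good_Y: "\<phi> g ` N \<subseteq> Y" if "good g" for g
    using that act_subset[OF good_J(2)[OF that] MX(2)] by (auto simp: Y_def good_def)
  have VN: "V \<subseteq> N" "V \<subseteq> M" using V'(2) N(2) by (auto simp: M_def)
  have VgY: "\<phi> g ` V \<subseteq> Y" if "good g" for g
    using good_Y[OF that] VN(1) by blast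
  have RY: "R \<subseteq> Y"
  proof
    fix x assume x: "x \<in> R"
    then obtain g where "g \<in> J" "x \<in> \<phi> g ` V" by (auto simp: R_def)
    then show "x \<in> Y" using R_good[OF x] VgY by blast
  qed
  have zvV: "zv g \<in> \<phi> g ` V" if "g \<in> J" for g using zv_eq[OF that] V(4) by blast
  have Vg_conn: "\<exists>d. path_in (\<phi> g ` V) d \<and> pathstart d = x \<and> pathfinish d = zv g" if "g \<in> J" "x \<in> \<phi> g ` V" for g x
    using path_connected_path_in[OF act_path_connected[OF J_carrier[OF that(1)] V(2) VX] that(2) zvV[OF that(1)]] .
  have Vg_hom: "homotopic_paths Y p q"
    if "good g" "path_in (\<phi> g ` M) p" "path_in (\<phi> g ` M) q" "pathstart p = pathstart q" "pathfinish p = pathfinish q" for g p q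
    using homotopic_paths_subset[OF act_paths_homotopic[OF good_J(2)[OF that(1)] MX N(3) that(2-5)] good_Y[OF that(1)]]
    by blast
  have inM: "path_in (\<phi> g ` M) p" if "path_in (\<phi> g ` V) p" for g p
    using that VN(2) by (meson image_mono path_in_mono)
  have inY: "path_in Y p" if "path_in (\<phi> g ` V) p" "good g" for g p
    using path_in_mono[OF that(1) VgY[OF that(2)]] .
  have main: "\<exists>D' sim. end_relation R D D' sim" if D: "cpt D" for D
  proof -
    define F where "F = X - D"
    have CD: "cpt (C \<union> D)" using C D by (auto intro: compact_Un)
    \<comment> \<open>The ray at \<open>g\<close> is chosen off \<open>D\<close> whenever possible, so that it serves the last two clauses of
      the relation for all but finitely many \<open>g\<close>.\<close>
    have "\<exists>e. zray C g e \<and> ((\<exists>e'. zray (C \<union> D) g e') \<longrightarrow> zray (C \<union> D) g e)" if "good g" for g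
    proof (cases "\<exists>e'. zray (C \<union> D) g e'")
      case True
      then show ?thesis using zray_mono[of "C \<union> D" g _ C] by blast
    next
      case False
      then show ?thesis using that by (auto simp: good_def bad_def)
    qed
    then obtain e where e: "\<And>g. good g \<Longrightarrow> zray C g (e g)"
      "\<And>g e'. \<lbrakk>good g; zray (C \<union> D) g e'\<rbrakk> \<Longrightarrow> zray (C \<union> D) g (e g)" by metis
    define \<rho> where "\<rho> g = ray_image ze (e g)" for g
    have \<rho>: "ray_in Y (\<rho> g)" "\<rho> g 0 = zv g" "proper_ray X (\<rho> g)" if "good g" for g
      using zray_ray_in_Y[OF e(1)[OF that]] zray_start[OF e(1)[OF that]] zray_proper[OF e(1)[OF that]] by (auto simp: \<rho>_def)
    \<comment> \<open>A leg \<open>d\<close> leads from the end point of \<open>u\<close> inside \<open>\<phi> g ` V\<close> to the vertex where the ray \<open>\<rho> g\<close> starts.\<close>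
    define leg where "leg u g d \<longleftrightarrow> good g \<and> path_in Y u \<and> path_in (\<phi> g ` V) d \<and> pathstart d = pathfinish u \<and> pathfinish d = zv g"
      for u g d
    have legD: "good g" "path_in Y u" "path_in (\<phi> g ` V) d" "pathstart d = pathfinish u" "pathfinish d = zv g"
      "path_in Y d" "path_in Y (u +++ d)" if "leg u g d" for u g d
      using that inY unfolding leg_def by auto
    define sim where "sim u v \<longleftrightarrow> (\<exists>g d h d'. leg u g d \<and> leg v h d' \<and> agree Y F (u +++ d) (\<rho> g) (v +++ d') (\<rho> h))" for u v
    have ag_refl: "agree Y F (u +++ d) (\<rho> g) (u +++ d) (\<rho> g)" if "leg u g d" for u g d
    proof -
      note l = legD[OF that]
      obtain a where "a \<ge> 0" "\<rho> g ` {a..} \<subseteq> F"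
        using proper_ray_tail[OF \<rho>(3)[OF l(1)]] D unfolding F_def by blast
      then show ?thesis using l \<rho>[OF l(1)] by (intro agree_refl[of Y "u +++ d" "\<rho> g" a]) auto
    qed
    have indep: "agree Y F (u +++ d) (\<rho> g) (u +++ d') (\<rho> h)" if l1: "leg u g d" and l2: "leg u h d'" for u g d h d'
    proof -
      note l = legD[OF l1] and l' = legD[OF l2]
      note gJ = good_J[OF l(1)] and hJ = good_J[OF l'(1)]
      define k where "k = inv g \<otimes> h"
      have k: "k \<in> J" "g \<otimes> k = h" "k \<in> carrier G"
        using gJ hJ by (auto simp: k_def m_assoc[symmetric])
      have "pathfinish u \<in> \<phi> g ` V \<inter> \<phi> h ` V"
        using path_in_ends(1)[OF l(3)] path_in_ends(1)[OF l'(3)] l(4) l'(4) by simp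
      then have "V \<inter> \<phi> k ` V \<noteq> {}" using act_meet_shift[OF gJ(2) hJ(2) VX VX] unfolding k_def by blast
      then have kH: "k \<in> H" using k by (auto simp: H_def)
      obtain p where p: "path_in (\<phi> g ` K k) p" "crosses g p h"
        using cross[OF k(1) gJ(1)] l(1) kH k(2) unfolding good_def by auto
      note c = crossesD[OF p(2)]
      have "agree Y F (u +++ d) (\<rho> g) ((u +++ d) +++ p) (\<rho> h)"
        using l e(1)[OF l(1)] e(1)[OF l'(1)] D unfolding \<rho>_def F_def by (intro c(4)) auto
      moreover have "homotopic_paths Y ((u +++ d) +++ p) (u +++ d')"
      proof -
        have "homotopic_paths Y ((u +++ d) +++ p) (u +++ (d +++ p))"
          using l c by (intro hom_assoc) auto
        also have "homotopic_paths Y \<dots> (u +++ d')"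
        proof (rule hom_left)
          have "\<phi> h ` V = \<phi> g ` \<phi> k ` V" using act_image_mult[OF gJ(2) k(3) VX] k(2) by simp
          also have "\<dots> \<subseteq> \<phi> g ` M" using V'(2) kH unfolding M_def by blast
          finally have 1: "path_in (\<phi> g ` M) d'" using l'(3) path_in_mono by blast
          have "\<phi> g ` K k \<subseteq> \<phi> g ` M" using kH unfolding M_def by blast
          then have "path_in (\<phi> g ` M) p" using p(1) path_in_mono by blast
          then have 2: "path_in (\<phi> g ` M) (d +++ p)" using inM[OF l(3)] l c by auto
          show "homotopic_paths Y (d +++ p) d'"
            using l l' c by (intro Vg_hom[OF l(1) 2 1]) auto
        qed (use l in auto)
        finally show ?thesis .
      qed
      ultimately show ?thesis using agree_homotopic agree_sym by blast
    qed
    have leg_ex: "\<exists>g d. leg u g d" if u: "path_in Y u" "pathfinish u \<in> R" for u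
    proof -
      obtain g where g: "g \<in> J" "pathfinish u \<in> \<phi> g ` V" using u(2) by (auto simp: R_def)
      then show ?thesis using R_good[OF u(2) g(2,1)] Vg_conn[OF g] u(1) unfolding leg_def by metis
    qed
    have sym: "sim v u" if "sim u v" for u v using that agree_sym unfolding sim_def by blast
    have trans: "sim u w" if "sim u v" "sim v w" for u v w
    proof -
      obtain g d h d' where 1: "leg u g d" "leg v h d'" "agree Y F (u +++ d) (\<rho> g) (v +++ d') (\<rho> h)"
        using \<open>sim u v\<close> unfolding sim_def by blast
      obtain h2 d2 k d3 where 2: "leg v h2 d2" "leg w k d3" "agree Y F (v +++ d2) (\<rho> h2) (w +++ d3) (\<rho> k)"
        using \<open>sim v w\<close> unfolding sim_def by blast
      have "agree Y F (u +++ d) (\<rho> g) (w +++ d3) (\<rho> k)"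
        using agree_trans[OF agree_trans[OF 1(3) indep[OF 1(2) 2(1)]] 2(3)] .
      then show ?thesis unfolding sim_def using 1(1) 2(2) by blast
    qed
    have hom: "sim u v" if "path_in Y u" "pathfinish u \<in> R" "homotopic_paths Y u v" for u v
    proof -
      obtain g d where l: "leg u g d" using leg_ex[OF \<open>path_in Y u\<close> \<open>pathfinish u \<in> R\<close>] by blast
      have l': "leg v g d" using l homotopic_paths_path_in[OF that(3)] homotopic_paths_ends[OF that(3)]
        by (auto simp: leg_def)
      have "homotopic_paths Y (u +++ d) (v +++ d)" using legD[OF l] that(3) by (intro hom_right) auto
      then have "agree Y F (v +++ d) (\<rho> g) (u +++ d) (\<rho> g)" using agree_homotopic[OF ag_refl[OF l]] by blast
      then show ?thesis unfolding sim_def using l l' agree_sym by blast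
    qed
    have small: "sim u (u +++ p)" if u: "path_in Y u" and p: "path_in (\<phi> g ` V) p" "good g" "pathstart p = pathfinish u" for u p g
    proof -
      obtain d where d: "path_in (\<phi> g ` V) d" "pathstart d = pathfinish p" "pathfinish d = zv g"
        using Vg_conn[OF good_J(1)[OF p(2)] path_in_ends(2)[OF p(1)]] by blast
      have l1: "leg u g (p +++ d)" using u p d by (auto simp: leg_def)
      have l2: "leg (u +++ p) g d" using u p d inY[OF p(1,2)] by (auto simp: leg_def)
      have "homotopic_paths Y (u +++ (p +++ d)) ((u +++ p) +++ d)"
        using u p d inY[OF p(1,2)] inY[OF d(1) p(2)] by (intro homotopic_paths_sym[OF hom_assoc]) auto
      then have "agree Y F ((u +++ p) +++ d) (\<rho> g) (u +++ (p +++ d)) (\<rho> g)"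
        using agree_homotopic[OF ag_refl[OF l1]] by blast
      then show ?thesis unfolding sim_def using l1 l2 agree_sym by blast
    qed
    have along: "sim u (u +++ q)" if u: "path_in Y u" and q: "path_in R q" "pathstart q = pathfinish u" for u q
    proof -
      have qR: "q t \<in> R" if "t \<in> {0..1}" for t using path_in_pathD[OF q(1) that] .
      have sY: "path_in Y (seg q s t)" if "s \<in> {0..1}" "t \<in> {0..1}" for s t
        using path_in_mono[OF path_in_seg_path[OF q(1) that] RY] .
      have q0: "pathfinish u = q 0" using q(2) by (simp add: pathstart_def)
      have comp: "homotopic_paths Y ((u +++ seg q 0 s) +++ seg q s t) (u +++ seg q 0 t)"
        if "s \<in> {0..1}" "t \<in> {0..1}" for s t
      proof -
        have "homotopic_paths Y ((u +++ seg q 0 s) +++ seg q s t) (u +++ (seg q 0 s +++ seg q s t))"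
          using u q0 sY that by (intro hom_assoc) auto
        also have "homotopic_paths Y \<dots> (u +++ seg q 0 t)"
          using u q0 that by (intro hom_left homotopic_seg_join_path[OF path_in_mono[OF q(1) RY]]) auto
        finally show ?thesis .
      qed
      have "sim (u +++ seg q 0 0) (u +++ seg q 0 1)"
      proof (rule connected_equivalence_relation[of "{0..1::real}" 0 1 "\<lambda>s t. sim (u +++ seg q 0 s) (u +++ seg q 0 t)"])
        fix t :: real assume t: "t \<in> {0..1}"
        obtain g where g: "g \<in> J" "q t \<in> \<phi> g ` V" using qR[OF t] by (auto simp: R_def)
        have "good g" using R_good[OF qR[OF t] g(2,1)] .
        have "open_X (\<phi> g ` V)" using act_open[OF J_carrier[OF g(1)] V(1)] .
        then obtain \<epsilon> where \<epsilon>: "\<epsilon> > 0" "\<And>s. s \<in> {0..1} \<inter> ball t \<epsilon> \<Longrightarrow> path_in (\<phi> g ` V) (seg q t s)"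
          using path_locally_in_open[OF path_in_mono[OF q(1) order_trans[OF RY Y_subset]] _ t g(2)] by metis
        have "sim (u +++ seg q 0 t) (u +++ seg q 0 s)" if s: "s \<in> {0..1} \<inter> ball t \<epsilon>" for s
        proof -
          have a: "path_in Y (u +++ seg q 0 t)" using u q0 sY t by auto
          then have "sim (u +++ seg q 0 t) ((u +++ seg q 0 t) +++ seg q t s)"
            using \<epsilon>(2)[OF s] \<open>good g\<close> by (intro small) auto
          moreover have "sim ((u +++ seg q 0 t) +++ seg q t s) (u +++ seg q 0 s)"
            using s t a sY[of t s] qR[of s] comp[of t s] by (intro hom) auto
          ultimately show ?thesis using trans by blast
        qed
        then show "\<exists>U. openin (top_of_set {0..1}) U \<and> t \<in> U \<and> (\<forall>s\<in>U. sim (u +++ seg q 0 t) (u +++ seg q 0 s))"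
          using t \<epsilon>(1) by (intro exI[of _ "{0..1} \<inter> ball t \<epsilon>"]) (auto simp: openin_open_Int)
      qed (auto intro: sym trans)
      moreover have "sim u (u +++ seg q 0 0)"
        using hom_rconst[OF u, of "q 0"] q0 qR[of 0] u by (intro hom) (auto intro: homotopic_paths_sym)
      ultimately show ?thesis using trans by auto
    qed
    define B where "B = {g \<in> J. \<phi> g ` V' \<inter> D \<noteq> {}} \<union> {g \<in> J. \<nexists>e. zray (C \<union> D) g e}"
    have "finite B"
      unfolding B_def using finite_no_zray[OF CD] finite_J_meeting[of V' D] V'(1) D by blast
    define D' where "D' = D \<union> (\<Union>g\<in>B. \<phi> g ` V')"
    have D': "cpt D'" "D \<subseteq> D'"
    proof -
      have "cpt (\<phi> g ` V')" if "g \<in> B" for g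
        using that act_cpt[OF J_carrier V'(1), of g] by (auto simp: B_def)
      then show "cpt D'" unfolding D'_def by (rule cpt_Un[OF D cpt_UN[OF \<open>finite B\<close>]])
      show "D \<subseteq> D'" by (simp add: D'_def)
    qed
    have far: "path_in F d \<and> ray_in F (\<rho> g)" if "leg u g d" "pathfinish u \<notin> D'" for u g d
    proof -
      note l = legD[OF that(1)]
      have gJ: "g \<in> J" using good_J(1)[OF l(1)] .
      have "pathfinish u \<in> \<phi> g ` V'" using path_in_ends(1)[OF l(3)] l(4) V'(2) by (auto simp: image_subset_iff)
      then have gB: "g \<notin> B" using that(2) by (auto simp: D'_def)
      then have "\<phi> g ` V' \<inter> D = {}" using gJ by (auto simp: B_def)
      then have "\<phi> g ` V \<subseteq> F" using V'(2) act_subset[OF J_carrier[OF gJ] VX] unfolding F_def by blast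
      moreover have "ray_in F (\<rho> g)"
      proof -
        obtain e' where "zray (C \<union> D) g e'" using gB gJ by (auto simp: B_def)
        then have "zray (C \<union> D) g (e g)" by (rule e(2)[OF l(1)])
        then show ?thesis using ray_in_mono[OF zray_ray_in, of "C \<union> D" g "e g" F] by (auto simp: \<rho>_def F_def)
      qed
      ultimately show ?thesis using l(3) path_in_mono by blast
    qed
    have deep: "sim u (u +++ q)" if u: "path_in Y u" and q: "path_in Y q" "path_in (X - D') q" "pathstart q = pathfinish u"
      "pathstart q \<in> R" "pathfinish q \<in> R" for u q
    proof -
      obtain g d where l: "leg u g d" using leg_ex[OF u] q by auto
      have uq: "path_in Y (u +++ q)" using u q by auto
      obtain h d' where l': "leg (u +++ q) h d'" using leg_ex[OF uq] q by auto
      have far1: "path_in F d" "ray_in F (\<rho> g)" using far[OF l] path_in_ends(1)[OF q(2)] q(3) by auto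
      have far2: "path_in F d'" "ray_in F (\<rho> h)" using far[OF l'] path_in_ends(2)[OF q(2)] by auto
      have qF: "path_in F q" using q(2) D'(2) path_in_mono[of "X - D'" q F] by (auto simp: F_def)
      note ll = legD[OF l] and ll' = legD[OF l']
      have "joined Y F u (u +++ d)" using u ll far1 by (intro joined_extend) auto
      moreover have "joined Y F u (u +++ q)" using u q qF by (intro joined_extend) auto
      moreover have "joined Y F (u +++ q) ((u +++ q) +++ d')" using uq ll' far2 by (intro joined_extend) auto
      ultimately have "joined Y F (u +++ d) ((u +++ q) +++ d')" using joined_sym joined_trans by blast
      then have "agree Y F (u +++ d) (\<rho> g) ((u +++ q) +++ d') (\<rho> h)"
        using ll ll' far1 far2 \<rho> by (intro joined_agree) auto
      then show ?thesis unfolding sim_def using l l' by blast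
    qed
    have sim_joined: "joined Y (X - D) u v" if s: "sim u v" and n: "pathfinish u \<notin> D'" "pathfinish v \<notin> D'" for u v
    proof -
      obtain g d h d' where l: "leg u g d" "leg v h d'" and ag: "agree Y F (u +++ d) (\<rho> g) (v +++ d') (\<rho> h)"
        using s unfolding sim_def by blast
      note f1 = far[OF l(1) n(1)] and f2 = far[OF l(2) n(2)]
      have "joined Y F (u +++ d) (v +++ d')" using agree_joined[OF ag] f1 f2 by blast
      moreover have "joined Y F u (u +++ d)" using legD[OF l(1)] f1 by (intro joined_extend) auto
      moreover have "joined Y F v (v +++ d')" using legD[OF l(2)] f2 by (intro joined_extend) auto
      ultimately show ?thesis using joined_sym joined_trans unfolding F_def by blast
    qed
    show ?thesis
      unfolding end_relation_def
      by (intro exI[of _ D'] exI[of _ sim] conjI D' allI impI)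
        (blast intro: sym, blast intro: trans, blast intro: hom, blast intro: along, blast intro: deep, blast intro: sim_joined)
  qed
  show ?thesis
    by (rule that[OF cptE RY[unfolded R_def] main[unfolded R_def]])
qed

end

section \<open>Components of the complement of a connected closed set\<close>

context tame_space
begin

lemma component_open: "\<lbrakk>open_X U; W \<in> components U\<rbrakk> \<Longrightarrow> open_X W"
  using locally_connected_open_component locally_path_connected locally_path_connected_imp_locally_connected by blast

lemma connected_open_path_connected: "\<lbrakk>open_X U; connected U\<rbrakk> \<Longrightarrow> path_connected U"
proof -
  assume U: "open_X U" "connected U"
  then have "locally path_connected U" using locally_open_subset locally_path_connected by blast
  then have "path_component_set U x = U" if "x \<in> U" for x
    using path_component_eq_connected_component_set[of U x] connected_component_eq_self[OF U(2) that] by simp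
  then show ?thesis by (simp add: path_connected_component_set)
qed

lemma closedin_cpt: "cpt K \<Longrightarrow> closedin (top_of_set X) K"
  by (simp add: closed_subset compact_imp_closed)

lemma open_minus_closed: "closedin (top_of_set X) N \<Longrightarrow> open_X (X - N)"
  by auto

definition fr :: "'a set \<Rightarrow> 'a set" where
  "fr W = X \<inter> closure W - W"

lemma meets_fr:
  assumes "open_X W" "connected B" "B \<subseteq> X" "B \<inter> W \<noteq> {}" "B - W \<noteq> {}"
  shows "B \<inter> fr W \<noteq> {}"
proof
  assume "B \<inter> fr W = {}"
  then have "B \<inter> W = B \<inter> closure W" using \<open>B \<subseteq> X\<close> closure_subset[of W] by (auto simp: fr_def)
  moreover have "closedin (top_of_set B) (B \<inter> closure W)" by (simp add: closedin_closed_Int)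
  moreover have "openin (top_of_set B) (B \<inter> W)"
    using assms(1,3) by (metis inf.absorb_iff2 inf_commute openin_subtopology_Int2 openin_subtopology subtopology_subtopology)
  ultimately have "B \<inter> W = {} \<or> B \<inter> W = B" using \<open>connected B\<close> unfolding connected_clopen by metis
  then show False using assms(4,5) by blast
qed

text \<open>
  The closure of \<open>W\<close> and the complement of \<open>W\<close> are connected closed sets that cover \<open>X\<close> and meet in the
  frontier of \<open>W\<close>, so this is connected by unicoherence.
\<close>
lemma component_frontier:
  assumes N: "closedin (top_of_set X) N" "connected N" "N \<noteq> {}" and W: "W \<in> components (X - N)"
  shows "open_X W" "W \<noteq> {}" "connected W" "fr W \<subseteq> N" "closedin (top_of_set X) (fr W)" "connected (fr W)" "fr W \<noteq> {}"
proof -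
  have op: "open_X (X - N)" using N(1) by (rule open_minus_closed)
  show oW: "open_X W" by (rule component_open[OF op W])
  show ne: "W \<noteq> {}" and cW: "connected W" using W in_components_nonempty in_components_connected by auto
  have WX: "W \<subseteq> X - N" using W in_components_subset by blast
  have NX: "N \<subseteq> X" using N(1) closedin_imp_subset by blast
  show "fr W \<subseteq> N"
  proof (rule ccontr)
    assume "\<not> fr W \<subseteq> N"
    then obtain y where y: "y \<in> X" "y \<in> closure W" "y \<notin> W" "y \<notin> N" by (auto simp: fr_def)
    then obtain W' where W': "W' \<in> components (X - N)" "y \<in> W'"
      by (metis DiffI UnionE Union_components)
    obtain T where T: "open T" "W' = X \<inter> T" using component_open[OF op W'(1)] unfolding openin_open by blast
    then have "T \<inter> W \<noteq> {}" using y(2) W'(2) by (metis IntD2 closure_iff_nhds_not_empty Int_commute order_refl)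
    then have "W' \<inter> W \<noteq> {}" using T WX by blast
    then have "W' = W" using components_nonoverlap[OF W'(1) W] by blast
    then show False using W' y by blast
  qed
  have eq: "fr W = (X \<inter> closure W) \<inter> (X - W)" by (auto simp: fr_def)
  have cl1: "closedin (top_of_set X) (X \<inter> closure W)" by (simp add: closedin_closed_Int)
  have cl2: "closedin (top_of_set X) (X - W)" using oW by auto
  show "closedin (top_of_set X) (fr W)" unfolding eq using cl1 cl2 by (rule closedin_Int)
  have c1: "connected (X \<inter> closure W)"
    by (rule connected_intermediate_closure[OF cW]) (use WX closure_subset[of W] in auto)
  have cX: "connected X" using path_connected path_connected_imp_connected by blast
  have c2: "connected (X - W)" by (rule component_diff_connected[OF N(2) cX NX W])
  have un: "X = (X \<inter> closure W) \<union> (X - W)" using WX closure_subset[of W] by auto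
  show "connected (fr W)"
    unfolding eq
    by (rule unicoherentD[OF simply_connected_unicoherent[OF simply_connected locally_path_connected] c1 c2 un cl1 cl2])
  show "fr W \<noteq> {}" using meets_fr[OF oW cX] ne N(3) NX WX by blast
qed

lemma component_subset_component:
  assumes "connected A" "A \<noteq> {}" "A \<subseteq> U"
  obtains Z where "Z \<in> components U" "A \<subseteq> Z"
  using exists_component_superset[of A U] assms by blast

lemma ends_meet:
  assumes "one_ended X" and K: "cpt K" and A: "connected A" "A \<subseteq> X - K" "\<not> precompact A"
    and B: "connected B" "B \<subseteq> X - K" "\<not> precompact B"
  obtains Z where "Z \<in> components (X - K)" "A \<subseteq> Z" "B \<subseteq> Z"
proof -
  have ne: "A \<noteq> {}" "B \<noteq> {}" using A(3) B(3) precompact_empty by blast+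
  obtain Z where Z: "Z \<in> components (X - K)" "A \<subseteq> Z" using component_subset_component[OF A(1) ne(1) A(2)] .
  obtain Z' where Z': "Z' \<in> components (X - K)" "B \<subseteq> Z'" using component_subset_component[OF B(1) ne(2) B(2)] .
  have "\<not> precompact Z" "\<not> precompact Z'" using A B Z Z' precompact_subset by blast+
  moreover have "\<exists>!U. U \<in> components (X - K) \<and> \<not> precompact U"
    using assms(1) K unfolding one_ended_def precompact_def by simp
  ultimately have "Z = Z'" using Z(1) Z'(1) by blast
  then show ?thesis using that Z Z' by blast
qed

text \<open>
  If the frontier of \<open>W\<close> were compact, then one component of its complement would contain both \<open>W\<close> and
  \<open>B\<close>. But a connected set that meets \<open>W\<close> and its complement also meets the frontier.
\<close>
lemma unbounded_frontier:
  assumes "one_ended X" and N: "closedin (top_of_set X) N" "connected N" "N \<noteq> {}" and W: "W \<in> components (X - N)"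
    and "\<not> precompact W" and B: "connected B" "B \<subseteq> X" "B \<inter> closure W = {}" "\<not> precompact B"
  shows "\<not> precompact (fr W)"
proof
  assume pre: "precompact (fr W)"
  note f = component_frontier[OF N W]
  obtain S where S: "closed S" "fr W = X \<inter> S" using f(5) unfolding closedin_closed by blast
  then have "closure (fr W) \<subseteq> S" by (simp add: closure_minimal)
  then have "closure (fr W) = fr W"
    using precompact_closure[OF pre] S(2) closure_subset[of "fr W"] by blast
  then have K: "cpt (fr W)" using precompact_closure[OF pre] by simp
  have "B \<subseteq> X - fr W" using B(2,3) by (auto simp: fr_def)
  moreover have "W \<subseteq> X - fr W" using f(1) open_X_subset by (auto simp: fr_def)
  ultimately obtain Z where Z: "Z \<in> components (X - fr W)" "W \<subseteq> Z" "B \<subseteq> Z"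
    using ends_meet[OF assms(1) K f(3) _ assms(6) B(1) _ B(4)] by metis
  have "B \<noteq> {}" using B(4) precompact_empty by blast
  moreover have "B \<inter> W = {}" using B(3) closure_subset[of W] by blast
  ultimately have "Z - W \<noteq> {}" using Z(3) by blast
  moreover have "Z \<subseteq> X - fr W" "connected Z" using Z(1) in_components_subset in_components_connected by blast+
  ultimately show False using meets_fr[OF f(1), of Z] f(2) Z(2) by blast
qed

end

section \<open>Translates of compact sets\<close>

context semistable_action
begin

definition orb :: "'a set \<Rightarrow> 'a set" where
  "orb A = (\<Union>g\<in>J. \<phi> g ` A)"

lemma orb_eq_translates: "orb A = translates \<phi> J A"
  by (simp add: orb_def translates_def)

lemma orb_mono: "A \<subseteq> B \<Longrightarrow> orb A \<subseteq> orb B"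
  by (auto simp: orb_def)

lemma orb_Un: "orb (A \<union> B) = orb A \<union> orb B"
  by (auto simp: orb_def)

lemma orb_UN: "orb (\<Union>i\<in>I. A i) = (\<Union>i\<in>I. orb (A i))"
  by (auto simp: orb_def)

lemma subset_orb: "A \<subseteq> X \<Longrightarrow> A \<subseteq> orb A"
  using act_image_one[of A] by (auto simp: orb_def)

lemma orb_subset: "A \<subseteq> X \<Longrightarrow> orb A \<subseteq> X"
  unfolding orb_def using act_subset[OF J_carrier] by blast

lemma orb_invariant: "\<lbrakk>g \<in> J; A \<subseteq> X; x \<in> X\<rbrakk> \<Longrightarrow> \<phi> g x \<in> orb A \<longleftrightarrow> x \<in> orb A"
proof -
  assume g: "g \<in> J" and A: "A \<subseteq> X" and x: "x \<in> X"
  have fwd: "\<phi> h y \<in> orb A" if "h \<in> J" "y \<in> orb A" for h y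
  proof -
    obtain k a where k: "k \<in> J" "a \<in> A" "y = \<phi> k a" using \<open>y \<in> orb A\<close> by (auto simp: orb_def)
    then have "\<phi> h y = \<phi> (h \<otimes> k) a" using act_mult[of h k a] J_carrier \<open>h \<in> J\<close> A by auto
    then show ?thesis using k \<open>h \<in> J\<close> unfolding orb_def by blast
  qed
  show ?thesis using fwd[OF g, of x] fwd[OF J_inv[OF g], of "\<phi> g x"] act_inv[OF J_carrier[OF g] x] by auto
qed

lemma orb_act: "\<lbrakk>g \<in> J; B \<subseteq> orb A; A \<subseteq> X\<rbrakk> \<Longrightarrow> \<phi> g ` B \<subseteq> orb A"
  using orb_invariant[of g A] orb_subset[of A] by blast

lemma orb_orb: "\<lbrakk>B \<subseteq> orb A; A \<subseteq> X\<rbrakk> \<Longrightarrow> orb B \<subseteq> orb A"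
  using orb_act[of _ B A] unfolding orb_def[of B] by blast

lemma orb_open: "open_X U \<Longrightarrow> open_X (orb U)"
  unfolding orb_def using act_open J_carrier by auto

text \<open>
  Only finitely many translates of \<open>K\<close> meet a small neighbourhood of a given point.
\<close>
lemma orb_closed: "cpt K \<Longrightarrow> closedin (top_of_set X) (orb K)"
proof -
  assume K: "cpt K"
  have "open_X (X - orb K)"
  proof (subst openin_subopen, rule ballI)
    fix x assume x: "x \<in> X - orb K"
    obtain U where U: "open_X U" "x \<in> U" "precompact U"
      using point_precompact_neighbourhood[of X x] x by auto
    define F where "F = {g \<in> J. \<phi> g ` K \<inter> U \<noteq> {}}"
    have "finite F" unfolding F_def using K U(3) finite_J_meeting by blast
    have "cpt (\<phi> g ` K)" if "g \<in> F" for g using that act_cpt[OF J_carrier K] by (auto simp: F_def)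
    then have "cpt (\<Union>g\<in>F. \<phi> g ` K)" by (rule cpt_UN[OF \<open>finite F\<close>])
    then have "open_X (X - (\<Union>g\<in>F. \<phi> g ` K))" using closedin_cpt open_minus_closed by blast
    then have "open_X (U \<inter> (X - (\<Union>g\<in>F. \<phi> g ` K)))" by (rule openin_Int[OF U(1)])
    moreover have "x \<in> U \<inter> (X - (\<Union>g\<in>F. \<phi> g ` K))" using x U by (auto simp: orb_def F_def)
    moreover have "U \<inter> (X - (\<Union>g\<in>F. \<phi> g ` K)) \<subseteq> X - orb K"
    proof
      fix y assume y: "y \<in> U \<inter> (X - (\<Union>g\<in>F. \<phi> g ` K))"
      have "g \<in> F" if "g \<in> J" "y \<in> \<phi> g ` K" for g using that y by (auto simp: F_def)
      then show "y \<in> X - orb K" using y by (auto simp: orb_def)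
    qed
    ultimately show "\<exists>T. open_X T \<and> x \<in> T \<and> T \<subseteq> X - orb K" by blast
  qed
  then show ?thesis using orb_subset K by (simp add: closedin_def)
qed

lemma bounded_iff_orb: "group_bounded X \<phi> J A \<longleftrightarrow> (\<exists>K. cpt K \<and> A \<subseteq> orb K)"
  by (auto simp: group_bounded_def orb_eq_translates)

lemma orb_not_precompact: "\<lbrakk>A \<noteq> {}; A \<subseteq> X\<rbrakk> \<Longrightarrow> \<not> precompact (orb A)"
proof
  assume A: "A \<noteq> {}" "A \<subseteq> X" and pre: "precompact (orb A)"
  then obtain x where x: "x \<in> A" "x \<in> X" by blast
  have "\<phi> g ` {x} \<inter> orb A \<noteq> {}" if "g \<in> J" for g
    using x that by (auto simp: orb_def)
  then have "{g \<in> J. \<phi> g ` {x} \<inter> orb A \<noteq> {}} = J" by blast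
  moreover have "precompact {x}" using x by (intro precompact_cpt) auto
  then have "finite {g \<in> J. \<phi> g ` {x} \<inter> orb A \<noteq> {}}" using pre by (rule finite_J_meeting)
  ultimately show False using infinite_J by simp
qed

text \<open>
  The translates by adjacent vertices of the connected Cayley graph share a vertex.
\<close>
lemma orb_connected:
  assumes A: "connected A" "A \<subseteq> X" "zv \<one> \<in> A" "\<And>s. s \<in> J0 \<Longrightarrow> zv s \<in> A"
  shows "connected (orb A)"
proof -
  let ?c = "connected_component_set (orb A) (zv \<one>)"
  have conn: "connected (\<phi> g ` A)" "\<phi> g ` A \<subseteq> orb A" if "g \<in> J" for g
    using act_connected[OF J_carrier[OF that] A(1,2)] that by (auto simp: orb_def)
  have step: "\<phi> g ` A \<subseteq> ?c" if "g \<in> J" "y \<in> ?c" "y \<in> \<phi> g ` A" for g y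
    using connected_component_maximal[OF that(3) conn[OF that(1)]] connected_component_eq[OF that(2)] by blast
  have mem: "zv g \<in> \<phi> g ` A" "\<And>s. s \<in> J0 \<Longrightarrow> zv (g \<otimes> s) \<in> \<phi> g ` A" if "g \<in> J" for g
    using zv_eq[OF that] zv_mult[OF that] A(3,4) J0(2) by auto
  have "zv \<one> \<in> orb A" using subset_orb[OF A(2)] A(3) by blast
  then have start: "zv \<one> \<in> ?c" by simp
  have "\<phi> g ` A \<subseteq> ?c" if "g \<in> J" for g
    using cayley_connected[OF J_one that]
  proof (induction rule: reach_induct)
    case self
    show ?case using step[OF J_one start mem(1)[OF J_one]] .
  next
    case (step y z)
    obtain s where s: "s \<in> J0" "z = y \<otimes> s \<or> y = z \<otimes> s" using step.hyps(2) by (auto simp: cayley_edges_def)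
    then have "\<exists>x. x \<in> \<phi> y ` A \<and> x \<in> \<phi> z ` A"
      using mem[of y] mem[of z] step.hyps(3,4) by blast
    then show ?case using \<open>\<And>y g. \<lbrakk>g \<in> J; y \<in> ?c; y \<in> \<phi> g ` A\<rbrakk> \<Longrightarrow> \<phi> g ` A \<subseteq> ?c\<close> step.IH step.hyps(4) by blast
  qed
  then have "orb A \<subseteq> ?c" by (auto simp: orb_def)
  then have "orb A = ?c" using connected_component_subset by blast
  then show ?thesis using connected_connected_component by metis
qed

end

section \<open>The layer around the translates of a compact set\<close>

context semistable_action
begin

text \<open>
  Choose connected compact sets \<open>C2\<close> and \<open>M\<close>, the first in the interior of the second, such that \<open>C2\<close> contains
  \<open>Cc\<close>, the base vertex and its neighbours, and let \<open>N = orb M\<close>. The frontiers of the components of \<open>X - N\<close>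
  lie in \<open>N\<close> but outside the translates of an open set \<open>O3\<close> between \<open>C2\<close> and \<open>M\<close>, hence in the translates of a
  compact set \<open>L0\<close>. The translates of finitely many small sets that cover \<open>L0\<close> and miss \<open>orb C2\<close> form
  the layer \<open>B\<close>. The set \<open>Q = orb C2\<close> supplies a second end that the frontier of an unbounded component would
  have to separate if it were compact.

  A component of \<open>X - N\<close> that is not inside \<open>\<Omega> = N \<union> (\<Union>v. B v)\<close> contains a translate of a point of a
  compact subset of \<open>X - N\<close>. So up to translation there are only finitely many of them, and the bounded ones
  among these can be put inside the translates of one precompact set \<open>V\<close>.
\<close>
lemma layer_exists:
  assumes Cc: "cpt Cc"
  obtains N \<Omega> :: "'a set" and VV and B :: "'b \<times> 'a \<Rightarrow> 'a set" and Q V where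
    "closedin (top_of_set X) N" "connected N" "N \<noteq> {}" "N \<subseteq> \<Omega>" "orb Cc \<subseteq> N"
    "\<And>v. v \<in> VV \<Longrightarrow> open_X (B v) \<and> path_connected (B v) \<and> precompact (B v) \<and> B v \<inter> orb Cc = {} \<and> B v \<inter> N \<noteq> {} \<and> B v \<subseteq> \<Omega>"
    "\<And>K. precompact K \<Longrightarrow> finite {v \<in> VV. B v \<inter> K \<noteq> {}}"
    "open_X \<Omega>" "\<And>x. x \<in> \<Omega> \<Longrightarrow> x \<notin> N \<Longrightarrow> \<exists>v\<in>VV. x \<in> B v"
    "\<And>W. W \<in> components (X - N) \<Longrightarrow> fr W \<subseteq> (\<Union>v\<in>VV. B v)"
    "connected Q" "Q \<subseteq> X" "\<not> precompact Q" "\<And>W. W \<in> components (X - N) \<Longrightarrow> Q \<inter> closure W = {}"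
    "open_X V" "path_connected V" "precompact V" "zv \<one> \<in> V" "\<Omega> \<subseteq> orb V"
    "\<And>W. W \<in> components (X - N) \<Longrightarrow> group_bounded X \<phi> J W \<Longrightarrow> W \<subseteq> orb V"
    "\<And>g. g \<in> J \<Longrightarrow> zv g \<in> \<Omega>"
proof -
  have b: "zv \<one> \<in> X" using zv_in by auto
  define C1 where "C1 = Cc \<union> insert (zv \<one>) (zv ` J0)"
  have "cpt (insert (zv \<one>) (zv ` J0))" using J0 zv_in by (auto intro: finite_imp_compact)
  then have "cpt C1" unfolding C1_def by (rule cpt_Un[OF Cc])
  then obtain O2 where O2: "open_X O2" "path_connected O2" "precompact O2" "C1 \<subseteq> O2"
    using compact_in_connected_open[OF _ b] by metis
  define C2 where "C2 = closure O2"
  have C2: "cpt C2" "connected C2" "C1 \<subseteq> C2"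
    using precompact_closure[OF O2(3)] path_connected_imp_connected[OF O2(2)] connected_imp_connected_closure
      closure_subset[of O2] O2(4) by (auto simp: C2_def)
  have orbC2: "connected (orb C2)" using C2 by (intro orb_connected) (auto simp: C1_def)
  obtain O3 where O3: "open_X O3" "path_connected O3" "precompact O3" "C2 \<subseteq> O3"
    using compact_in_connected_open[OF C2(1) b] by metis
  have O3X: "O3 \<subseteq> X" using O3(1) open_X_subset by blast
  define M where "M = closure O3"
  have M: "cpt M" "connected M" "O3 \<subseteq> M"
    using precompact_closure[OF O3(3)] path_connected_imp_connected[OF O3(2)] connected_imp_connected_closure
      closure_subset[of O3] by (auto simp: M_def)
  define N where "N = orb M"
  have C1M: "C1 \<subseteq> M" using C2(3) O3(4) M(3) by blast
  have N: "closedin (top_of_set X) N" "connected N" "N \<subseteq> X" "M \<subseteq> N"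
  proof -
    show "connected N" unfolding N_def using M C1M by (intro orb_connected) (auto simp: C1_def)
    show "closedin (top_of_set X) N" "N \<subseteq> X" "M \<subseteq> N"
      using orb_closed[OF M(1)] orb_subset[of M] subset_orb[of M] M(1) by (auto simp: N_def)
  qed
  have N_ne: "N \<noteq> {}" using N(4) C1M by (auto simp: C1_def)
  have oN: "orb O3 \<subseteq> N" using orb_mono[OF M(3)] by (simp add: N_def)
  have oO3: "open_X (orb O3)" by (rule orb_open[OF O3(1)])
  define L0 where "L0 = M - orb O3"
  have L0: "cpt L0"
  proof -
    obtain T where T: "open T" "orb O3 = X \<inter> T" using oO3 unfolding openin_open by blast
    then have "L0 = M - T" using M(1) by (auto simp: L0_def)
    then show ?thesis using M(1) T(1) by (auto intro: compact_diff)
  qed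
  have fr_orb: "fr W \<subseteq> orb L0" if W: "W \<in> components (X - N)" for W
  proof
    fix x assume x: "x \<in> fr W"
    then have "x \<in> N" using component_frontier(4)[OF N(1,2) N_ne W] by blast
    then obtain g m where g: "g \<in> J" "m \<in> M" "x = \<phi> g m" by (auto simp: N_def orb_def)
    have "x \<notin> orb O3"
    proof
      assume xo: "x \<in> orb O3"
      obtain T where T: "open T" "orb O3 = X \<inter> T" using oO3 unfolding openin_open by blast
      have "x \<in> closure W" using x by (simp add: fr_def)
      then have "T \<inter> W \<noteq> {}" using xo T by (metis IntD2 closure_iff_nhds_not_empty Int_commute order_refl)
      then show False using W in_components_subset[OF W] oN T by blast
    qed
    then have "m \<notin> orb O3" using orb_invariant[OF g(1) O3X, of m] g M(1) by auto
    then show "x \<in> orb L0" using g by (auto simp: orb_def L0_def)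
  qed
  have C2_orb: "orb C2 \<subseteq> orb O3" by (rule orb_mono[OF O3(4)])
  have oC2: "open_X (X - orb C2)" using orb_closed[OF C2(1)] open_minus_closed by blast
  have "\<exists>B. open_X B \<and> x \<in> B \<and> B \<subseteq> X - orb C2 \<and> path_connected B \<and> precompact B" if x: "x \<in> L0" for x
  proof -
    have "x \<in> X - orb C2" using x L0 C2_orb by (auto simp: L0_def)
    then show ?thesis by (rule point_precompact_neighbourhood[OF oC2]) blast
  qed
  then obtain b0 where b0: "\<And>x. x \<in> L0 \<Longrightarrow> open_X (b0 x)" "\<And>x. x \<in> L0 \<Longrightarrow> x \<in> b0 x"
    "\<And>x. x \<in> L0 \<Longrightarrow> b0 x \<subseteq> X - orb C2" "\<And>x. x \<in> L0 \<Longrightarrow> path_connected (b0 x)" "\<And>x. x \<in> L0 \<Longrightarrow> precompact (b0 x)"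
    by metis
  have "\<exists>T. open T \<and> b0 x = X \<inter> T" if "x \<in> L0" for x
    using b0(1)[OF that] unfolding openin_open by blast
  then obtain T where T: "\<And>x. x \<in> L0 \<Longrightarrow> open (T x)" "\<And>x. x \<in> L0 \<Longrightarrow> b0 x = X \<inter> T x" by metis
  have "L0 \<subseteq> (\<Union>x\<in>L0. T x)" using b0(2) T(2) by blast
  then obtain I where I: "I \<subseteq> L0" "finite I" "L0 \<subseteq> (\<Union>x\<in>I. T x)"
    using compactE_image[of L0 L0 T] L0 T(1) by (metis subsetD)
  define U0 where "U0 = (\<Union>i\<in>I. b0 i)"
  have L0U: "L0 \<subseteq> U0"
  proof
    fix x assume "x \<in> L0"
    then obtain i where "i \<in> I" "x \<in> T i" "x \<in> X" using I(3) L0 by blast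
    then show "x \<in> U0" using T(2)[of i] I(1) by (auto simp: U0_def)
  qed
  have U0: "open_X U0" "precompact U0" "U0 \<subseteq> X"
  proof -
    have "open_X (b0 i) \<and> precompact (b0 i)" if "i \<in> I" for i using that b0(1,5) I(1) by blast
    then show "open_X U0" "precompact U0" unfolding U0_def using I(2) by (auto intro!: precompact_UN)
    then show "U0 \<subseteq> X" using open_X_subset by blast
  qed
  define B where "B v = \<phi> (fst v) ` b0 (snd v)" for v :: "'b \<times> 'a"
  define VV where "VV = J \<times> I"
  define \<Omega> where "\<Omega> = orb O3 \<union> orb U0"
  have orbU0: "orb U0 = (\<Union>v\<in>VV. B v)"
    unfolding U0_def orb_UN by (force simp: orb_def VV_def B_def)
  have Cc2: "orb Cc \<subseteq> orb C2" using C2(3) by (intro orb_mono) (auto simp: C1_def)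
  have Bv: "open_X (B v) \<and> path_connected (B v) \<and> precompact (B v) \<and> B v \<inter> orb Cc = {} \<and> B v \<inter> N \<noteq> {} \<and> B v \<subseteq> \<Omega>"
    if v: "v \<in> VV" for v
  proof -
    have g: "fst v \<in> J" "fst v \<in> carrier G" "snd v \<in> L0" using v I J_carrier by (auto simp: VV_def)
    note bb = b0[OF g(3)]
    have bX: "b0 (snd v) \<subseteq> X" using bb(1) open_X_subset by blast
    have "\<phi> (fst v) ` b0 (snd v) \<inter> orb C2 = {}"
      using orb_invariant[OF g(1), of C2] C2(1) bb(3) by blast
    moreover have "\<phi> (fst v) (snd v) \<in> B v \<inter> N"
      using bb(2) g by (auto simp: B_def N_def orb_def L0_def)
    moreover have "B v \<subseteq> \<Omega>" using v orbU0 by (auto simp: \<Omega>_def)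
    ultimately show ?thesis
      unfolding B_def using act_open[OF g(2) bb(1)] act_path_connected[OF g(2) bb(4) bX] act_precompact[OF g(2) bb(5)] Cc2
      by blast
  qed
  have Bfin: "finite {v \<in> VV. B v \<inter> K \<noteq> {}}" if K: "precompact K" for K
  proof -
    have "{v \<in> VV. B v \<inter> K \<noteq> {}} \<subseteq> {g \<in> J. \<phi> g ` U0 \<inter> K \<noteq> {}} \<times> I"
      unfolding VV_def B_def U0_def image_UN by fastforce
    then show ?thesis using finite_J_meeting[OF U0(2) K] I(2) by (meson finite_SigmaI finite_subset)
  qed
  have \<Omega>_open: "open_X \<Omega>" unfolding \<Omega>_def using oO3 orb_open[OF U0(1)] by blast
  have N\<Omega>: "N \<subseteq> \<Omega>"
  proof -
    have "M \<subseteq> orb O3 \<union> U0" using L0U by (auto simp: L0_def)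
    also have "\<dots> \<subseteq> orb (O3 \<union> U0)" using subset_orb[OF U0(3)] by (auto simp: orb_Un)
    finally show ?thesis unfolding N_def \<Omega>_def orb_Un[symmetric] using O3X U0(3) by (intro orb_orb) auto
  qed
  have cover: "\<exists>v\<in>VV. x \<in> B v" if "x \<in> \<Omega>" "x \<notin> N" for x
    using that oN orbU0 unfolding \<Omega>_def by blast
  have fr_cov: "fr W \<subseteq> (\<Union>v\<in>VV. B v)" if "W \<in> components (X - N)" for W
    using fr_orb[OF that] orb_mono[OF L0U] orbU0 by blast
  have Q: "orb C2 \<inter> closure W = {}" if W: "W \<in> components (X - N)" for W
  proof (rule ccontr)
    assume "orb C2 \<inter> closure W \<noteq> {}"
    then obtain x where x: "x \<in> orb O3" "x \<in> closure W" using C2_orb by blast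
    obtain T where T: "open T" "orb O3 = X \<inter> T" using oO3 unfolding openin_open by blast
    have "T \<inter> W \<noteq> {}" using x T by (metis IntD2 closure_iff_nhds_not_empty Int_commute order_refl)
    then show False using in_components_subset[OF W] oN T by blast
  qed
  define K1 where "K1 = closure (O3 \<union> U0)"
  have K1: "cpt K1" "O3 \<union> U0 \<subseteq> K1"
    using precompact_closure[OF precompact_Un[OF O3(3) U0(2)]] closure_subset by (auto simp: K1_def)
  have \<Omega>K1: "\<Omega> \<subseteq> orb K1" unfolding \<Omega>_def orb_Un[symmetric] by (rule orb_mono[OF K1(2)])
  define K2 where "K2 = K1 - \<Omega>"
  have K2: "cpt K2"
  proof -
    obtain T where T: "open T" "\<Omega> = X \<inter> T" using \<Omega>_open unfolding openin_open by blast
    then have "K2 = K1 - T" using K1(1) by (auto simp: K2_def)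
    then show ?thesis using K1(1) T(1) by (auto intro: compact_diff)
  qed
  have opN: "open_X (X - N)" using N(1) open_minus_closed by blast
  define comp where "comp x = connected_component_set (X - N) x" for x
  have comp: "comp x \<in> components (X - N)" "open_X (comp x)" "x \<in> comp x" if "x \<in> K2" for x
  proof -
    have "x \<in> X - N" using that N\<Omega> K2 by (auto simp: K2_def)
    then show "comp x \<in> components (X - N)" "x \<in> comp x" by (auto simp: comp_def components_iff)
    then show "open_X (comp x)" using component_open[OF opN] by blast
  qed
  have "\<exists>T. open T \<and> comp x = X \<inter> T" if "x \<in> K2" for x
    using comp(2)[OF that] unfolding openin_open by blast
  then obtain S where S: "\<And>x. x \<in> K2 \<Longrightarrow> open (S x)" "\<And>x. x \<in> K2 \<Longrightarrow> comp x = X \<inter> S x" by metis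
  have "K2 \<subseteq> (\<Union>x\<in>K2. S x)" using comp(3) S(2) by blast
  then obtain F where F: "F \<subseteq> K2" "finite F" "K2 \<subseteq> (\<Union>x\<in>F. S x)"
    using compactE_image[of K2 K2 S] K2 S(1) by (metis subsetD)
  have "\<exists>D. cpt D \<and> (group_bounded X \<phi> J (comp x) \<longrightarrow> comp x \<subseteq> orb D)" for x
    unfolding bounded_iff_orb by blast
  then obtain D where D: "\<And>x. cpt (D x)" "\<And>x. group_bounded X \<phi> J (comp x) \<Longrightarrow> comp x \<subseteq> orb (D x)" by metis
  define M3 where "M3 = K1 \<union> (\<Union>x\<in>F. D x)"
  have M3: "cpt M3" unfolding M3_def by (intro cpt_Un K1 cpt_UN F D)
  have bdd: "W \<subseteq> orb M3" if W: "W \<in> components (X - N)" and bd: "group_bounded X \<phi> J W" for W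
  proof (cases "W \<subseteq> \<Omega>")
    case True
    then show ?thesis using \<Omega>K1 orb_mono[of K1 M3] by (auto simp: M3_def)
  next
    case False
    note f = component_frontier[OF N(1,2) N_ne W]
    have "W \<inter> \<Omega> \<noteq> {}"
    proof -
      obtain x where x: "x \<in> fr W" using f(7) by blast
      then have "x \<in> \<Omega>" "x \<in> closure W" using f(4) N\<Omega> by (auto simp: fr_def)
      moreover obtain T where T: "open T" "\<Omega> = X \<inter> T" using \<Omega>_open unfolding openin_open by blast
      ultimately have "T \<inter> W \<noteq> {}" by (metis IntD2 closure_iff_nhds_not_empty Int_commute order_refl)
      then show ?thesis using T in_components_subset[OF W] by blast
    qed
    then obtain y where y: "y \<in> W" "y \<in> fr \<Omega>"
      using meets_fr[OF \<Omega>_open f(3)] False in_components_subset[OF W] by blast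
    have "closure \<Omega> \<inter> X \<subseteq> orb K1"
    proof -
      obtain T where T: "closed T" "orb K1 = X \<inter> T" using orb_closed[OF K1(1)] unfolding closedin_closed by blast
      then show ?thesis using closure_minimal[of \<Omega> T] \<Omega>K1 by blast
    qed
    then have "y \<in> orb K1" "y \<notin> \<Omega>" using y by (auto simp: fr_def)
    then obtain g k where g: "g \<in> J" "k \<in> K1" "y = \<phi> g k" by (auto simp: orb_def)
    have kX: "k \<in> X" using g K1 by auto
    have "k \<notin> \<Omega>" using orb_invariant[OF g(1), of "O3 \<union> U0" k] \<open>y \<notin> \<Omega>\<close> g kX O3X U0(3) by (auto simp: \<Omega>_def orb_Un)
    then have "k \<in> K2" using g by (simp add: K2_def)
    then obtain x where x: "x \<in> F" "k \<in> S x" using F by blast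
    then have kc: "k \<in> comp x" using S(2) F kX by auto
    have xc: "comp x \<in> components (X - N)" using comp(1) x F by blast
    have image: "\<phi> h ` A \<subseteq> Z" if "h \<in> J" "connected A" "A \<subseteq> X - N" "Z \<in> components (X - N)" "\<phi> h ` A \<inter> Z \<noteq> {}" for h A Z
    proof (rule components_maximal[OF that(4)])
      show "connected (\<phi> h ` A)" using that act_connected[OF J_carrier] by blast
      show "\<phi> h ` A \<subseteq> X - N"
        using that(3) act_subset[OF J_carrier[OF that(1)], of A] orb_invariant[OF that(1), of M] M(1) unfolding N_def by blast
      show "Z \<inter> \<phi> h ` A \<noteq> {}" using that(5) by blast
    qed
    have "\<phi> (inv g) ` W \<subseteq> comp x"
    proof (rule image[OF J_inv[OF g(1)] f(3) in_components_subset[OF W] xc])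
      have "k = \<phi> (inv g) y" using act_inv[OF J_carrier[OF g(1)] kX] g(3) by simp
      then show "\<phi> (inv g) ` W \<inter> comp x \<noteq> {}" using y(1) kc by blast
    qed
    then have "W \<subseteq> \<phi> g ` comp x"
      using act_image_iff[OF J_carrier[OF g(1)], of "comp x"] in_components_subset[OF xc] in_components_subset[OF W] by blast
    moreover have "\<phi> g ` comp x \<subseteq> W"
      by (rule image[OF g(1) in_components_connected[OF xc] in_components_subset[OF xc] W]) (use kc g y in blast)
    ultimately have Weq: "W = \<phi> g ` comp x" by blast
    have "group_bounded X \<phi> J (comp x)"
    proof -
      obtain L where L: "cpt L" "W \<subseteq> orb L" using bd unfolding bounded_iff_orb by blast
      have "z \<in> orb L" if "z \<in> comp x" for z
        using orb_invariant[OF g(1), of L z] L Weq that in_components_subset[OF xc] by blast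
      then show ?thesis using L(1) unfolding bounded_iff_orb by blast
    qed
    then have "comp x \<subseteq> orb M3" using D(2)[of x] orb_mono[of "D x" M3] x(1) by (auto simp: M3_def)
    then show ?thesis unfolding Weq using orb_act[OF g(1)] M3 by blast
  qed
  obtain V where V: "open_X V" "path_connected V" "precompact V" "M3 \<subseteq> V" "zv \<one> \<in> V"
    using compact_in_connected_open[OF M3 b] by metis
  have M3V: "orb M3 \<subseteq> orb V" by (rule orb_mono[OF V(4)])
  have "\<Omega> \<subseteq> orb V" using \<Omega>K1 orb_mono[of K1 M3] M3V by (auto simp: M3_def)
  moreover have "W \<subseteq> orb V" if "W \<in> components (X - N)" "group_bounded X \<phi> J W" for W
    using bdd[OF that] M3V by blast
  moreover have "zv g \<in> \<Omega>" if "g \<in> J" for g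
  proof -
    have "zv \<one> \<in> O3" using C2(3) O3(4) by (auto simp: C1_def)
    then show ?thesis using zv_eq[OF that] that by (auto simp: \<Omega>_def orb_def)
  qed
  moreover have "orb Cc \<subseteq> N" using Cc2 C2_orb oN by blast
  moreover have "\<not> precompact (orb C2)" "orb C2 \<subseteq> X"
    using orb_not_precompact[of C2] orb_subset[of C2] C2 by (auto simp: C1_def)
  ultimately show ?thesis
    using that[of N \<Omega> VV B "orb C2" V, OF N(1,2) N_ne N\<Omega> _ Bv Bfin \<Omega>_open cover fr_cov orbC2 _ _ Q V(1,2,3,5)] by blast
qed

end

section \<open>Pushing loops towards infinity\<close>

lemma homotopic_square:
  fixes H :: "real \<times> real \<Rightarrow> 'a::topological_space"
  assumes H: "continuous_on ({0..1} \<times> {0..n}) H" "H \<in> {0..1} \<times> {0..n} \<rightarrow> S" and n: "n \<ge> 0"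
  shows "homotopic_paths S ((\<lambda>t. H (t, 0)) +++ (\<lambda>s. H (1, n * s))) ((\<lambda>s. H (0, n * s)) +++ (\<lambda>t. H (t, n)))"
proof -
  let ?R = "{0..1::real} \<times> {0..n}"
  let ?p = "linepath (0, 0) (1, 0) +++ linepath (1, 0) (1, n)" and ?q = "linepath (0, 0) (0, n) +++ linepath (0, n) (1, n)"
  have R: "convex ?R" by (intro convex_Times) auto
  have sub: "path_image ?p \<subseteq> ?R" "path_image ?q \<subseteq> ?R"
    using n R by (auto simp: path_image_join closed_segment_subset)
  have "homotopic_paths ?R ?p ?q"
  proof (rule homotopic_paths_linear)
    show "closed_segment (?p t) (?q t) \<subseteq> ?R" if "t \<in> {0..1}" for t
      using sub R that by (intro closed_segment_subset) (auto simp: path_image_def simp del: SigmaE2)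
  qed auto
  then have "homotopic_paths S (H \<circ> ?p) (H \<circ> ?q)"
    by (rule homotopic_paths_continuous_image[where h = H]) (use H in auto)
  moreover have "H \<circ> linepath (0, 0) (1, 0) = (\<lambda>t. H (t, 0))" "H \<circ> linepath (1, 0) (1, n) = (\<lambda>s. H (1, n * s))"
    "H \<circ> linepath (0, 0) (0, n) = (\<lambda>s. H (0, n * s))" "H \<circ> linepath (0, n) (1, n) = (\<lambda>t. H (t, n))"
    by (auto simp: fun_eq_iff linepath_def algebra_simps)
  ultimately show ?thesis by (simp add: path_compose_join)
qed

text \<open>
  Lebesgue's number lemma on the parameter interval.
\<close>
lemma path_partition:
  assumes p: "path_in X p" and UV: "openin (top_of_set X) U" "openin (top_of_set X) V" "path_image p \<subseteq> U \<union> V"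
  obtains n :: nat where "n > 0"
    "\<And>i. i < n \<Longrightarrow> p ` {real i / real n..real (Suc i) / real n} \<subseteq> U \<or> p ` {real i / real n..real (Suc i) / real n} \<subseteq> V"
proof -
  have cont: "continuous_on {0..1} p" "p \<in> {0..1} \<rightarrow> X" using p by (auto simp: path_in_def path_def path_image_def)
  have "\<exists>T. open T \<and> {0..1} \<inter> p -` W = {0..1} \<inter> T" if "openin (top_of_set X) W" for W
    using continuous_openin_preimage[OF cont that] unfolding openin_open by blast
  then obtain S T where S: "open S" "{0..1} \<inter> p -` U = {0..1} \<inter> S" and T: "open T" "{0..1} \<inter> p -` V = {0..1} \<inter> T"
    using UV(1,2) by metis
  have "{0..1} \<subseteq> \<Union> {S, T}"
  proof
    fix t :: real assume t: "t \<in> {0..1}"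
    then have "p t \<in> U \<or> p t \<in> V" using UV(3) by (auto simp: path_image_def image_subset_iff)
    then have "t \<in> {0..1} \<inter> p -` U \<or> t \<in> {0..1} \<inter> p -` V" using t by simp
    then show "t \<in> \<Union> {S, T}" using S(2) T(2) by auto
  qed
  then obtain \<delta> where \<delta>: "0 < \<delta>" "\<And>A. \<lbrakk>A \<subseteq> {0..1}; diameter A < \<delta>\<rbrakk> \<Longrightarrow> \<exists>B\<in>{S, T}. A \<subseteq> B"
    using Lebesgue_number_lemma[of "{0..1::real}" "{S, T}"] S(1) T(1) by (metis (no_types) compact_Icc insert_iff insert_not_empty singletonD)
  obtain n :: nat where n: "n > 0" "1 / real n < \<delta>"
    using \<delta>(1) by (metis nat_approx_posE of_nat_0_less_iff zero_less_Suc inverse_eq_divide)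
  show ?thesis
  proof (rule that[OF n(1)])
    fix i assume i: "i < n"
    let ?A = "{real i / real n..real (Suc i) / real n}"
    have le: "real i / real n \<le> real (Suc i) / real n" using n(1) by (simp add: divide_right_mono)
    have "real (Suc i) / real n - real i / real n = 1 / real n" by (simp add: diff_divide_distrib[symmetric])
    then have "diameter ?A < \<delta>" using n(2) le by (simp add: diameter_closed_interval)
    moreover have A: "?A \<subseteq> {0..1}" using i n(1) by (auto simp: field_simps)
    ultimately have "?A \<subseteq> S \<or> ?A \<subseteq> T" using \<delta>(2) by auto
    moreover have "p ` ?A \<subseteq> U" if "?A \<subseteq> S"
    proof -
      have "?A \<subseteq> {0..1} \<inter> p -` U" unfolding S(2) using A that by (rule Int_greatest)
      then show ?thesis by blast
    qed
    moreover have "p ` ?A \<subseteq> V" if "?A \<subseteq> T"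
    proof -
      have "?A \<subseteq> {0..1} \<inter> p -` V" unfolding T(2) using A that by (rule Int_greatest)
      then show ?thesis by blast
    qed
    ultimately show "p ` ?A \<subseteq> U \<or> p ` ?A \<subseteq> V" by blast
  qed
qed

context semistable_action
begin

text \<open>
  The loop is cut into pieces that run in \<open>\<Omega>\<close> and the bounded components, and pieces in \<open>X - N\<close>.
  Prolonging a path by a piece of the first kind preserves its end by \<open>end_invariant\<close>, by a piece
  of the second kind by co-semistability.
\<close>
lemma loops_push_out:
  assumes one_ended: "one_ended X" and Cc: "cpt Cc"
    and cosemistable: "\<And>U r. \<lbrakk>U \<in> components (X - orb Cc); \<not> group_bounded X \<phi> J U; proper_ray X r; r ` {0..} \<subseteq> U;
        group_bounded X \<phi> J (r ` {0..})\<rbrakk> \<Longrightarrow> co_semistable_in_component X U r C0"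
  obtains E where "cpt E"
    "\<And>D. cpt D \<Longrightarrow> \<exists>D' w Z. cpt D' \<and> D \<subseteq> D' \<and> E \<subseteq> D' \<and> connected Z \<and> Z \<subseteq> X - D' \<and> \<not> precompact Z \<and> w \<in> Z \<and>
       (\<forall>p. path_in (X - E) p \<longrightarrow> pathstart p = w \<longrightarrow> pathfinish p = w \<longrightarrow>
          (\<exists>q. path_in (X - D) q \<and> homotopic_paths Y p q))"
proof (rule layer_exists[OF Cc])
  fix N \<Omega> :: "'a set" and VV and B :: "'b \<times> 'a \<Rightarrow> 'a set" and Q V
  assume N: "closedin (top_of_set X) N" "connected N" "N \<noteq> {}" "N \<subseteq> \<Omega>" "orb Cc \<subseteq> N"
    and Bv: "\<And>v. v \<in> VV \<Longrightarrow> open_X (B v) \<and> path_connected (B v) \<and> precompact (B v) \<and> B v \<inter> orb Cc = {} \<and> B v \<inter> N \<noteq> {} \<and> B v \<subseteq> \<Omega>"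
    and Bfin: "\<And>K. precompact K \<Longrightarrow> finite {v \<in> VV. B v \<inter> K \<noteq> {}}"
    and \<Omega>: "open_X \<Omega>" "\<And>x. x \<in> \<Omega> \<Longrightarrow> x \<notin> N \<Longrightarrow> \<exists>v\<in>VV. x \<in> B v"
    and frB: "\<And>W. W \<in> components (X - N) \<Longrightarrow> fr W \<subseteq> (\<Union>v\<in>VV. B v)"
    and Q: "connected Q" "Q \<subseteq> X" "\<not> precompact Q" "\<And>W. W \<in> components (X - N) \<Longrightarrow> Q \<inter> closure W = {}"
    and V: "open_X V" "path_connected V" "precompact V" "zv \<one> \<in> V" "\<Omega> \<subseteq> orb V"
    and bdd: "\<And>W. W \<in> components (X - N) \<Longrightarrow> group_bounded X \<phi> J W \<Longrightarrow> W \<subseteq> orb V"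
    and zv\<Omega>: "\<And>g. g \<in> J \<Longrightarrow> zv g \<in> \<Omega>"
  obtain E1 where E1: "cpt E1" and RY: "orb V - E1 \<subseteq> Y"
    and inv: "\<And>D. cpt D \<Longrightarrow> \<exists>D' sim. end_relation (orb V - E1) D D' sim"
    using end_invariant[OF V(1-4)] unfolding orb_def by metis
  have VX: "V \<subseteq> X" using V(1) open_X_subset by blast
  have opN: "open_X (X - N)" by (rule open_minus_closed[OF N(1)])
  \<comment> \<open>The nerve of the layer, a locally finite graph; \<open>Vc v\<close> is the piece around \<open>v\<close> that remains of the layer off \<open>E1\<close>.\<close>
  define EG where "EG = {(v, w). v \<in> VV \<and> w \<in> VV \<and> B v \<inter> B w \<noteq> {}}"
  have symEG: "sym EG" by (auto simp: sym_def EG_def)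
  have finEG: "finite (EG `` {v})" for v
  proof (cases "v \<in> VV")
    case True
    have "EG `` {v} \<subseteq> {w \<in> VV. B w \<inter> B v \<noteq> {}}" by (auto simp: EG_def)
    then show ?thesis using Bfin[of "B v"] Bv[OF True] finite_subset by blast
  qed (simp add: EG_def)
  define F1 where "F1 = {v \<in> VV. B v \<inter> E1 \<noteq> {}}"
  have finF1: "finite F1" unfolding F1_def using Bfin E1 by blast
  define A where "A = VV - F1"
  have B_ne: "B v \<noteq> {}" if "v \<in> VV" for v using Bv[OF that] by blast
  define Vc where "Vc v = (\<Union>w\<in>reach EG A v. B w)" for v
  have reachA: "reach EG A v \<subseteq> VV" "reach EG A v \<subseteq> A" if "v \<in> A" for v
    using reach_subset[OF that] by (auto simp: A_def)
  have BR: "B v \<subseteq> orb V - E1" "B v \<subseteq> X - orb Cc" if "v \<in> A" for v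
  proof -
    have "v \<in> VV" "v \<notin> F1" using that by (auto simp: A_def)
    then show "B v \<subseteq> orb V - E1" "B v \<subseteq> X - orb Cc"
      using Bv[of v] V(5) open_X_subset[of "B v"] by (auto simp: F1_def)
  qed
  have VcR: "Vc v \<subseteq> orb V - E1" "Vc v \<subseteq> X - orb Cc" if "v \<in> A" for v
    using BR reachA(2)[OF that] unfolding Vc_def by blast+
  have Vc_pc: "path_connected (Vc v)" if v: "v \<in> A" for v
  proof -
    have vV: "v \<in> VV" using v by (simp add: A_def)
    then obtain x0 where x0: "x0 \<in> B v" using B_ne by blast
    have to: "\<forall>y\<in>B w. \<exists>q. path_in (Vc v) q \<and> pathstart q = x0 \<and> pathfinish q = y" if "w \<in> reach EG A v" for w
      using that
    proof (induction rule: reach_induct)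
      case self
      have "B v \<subseteq> Vc v" unfolding Vc_def by blast
      then show ?case using path_connected_path_in[of "B v" x0] Bv[OF vV] x0 path_in_mono by metis
    next
      case (step y z)
      obtain pt where pt: "pt \<in> B y" "pt \<in> B z" using step.hyps(2) by (auto simp: EG_def)
      obtain q where q: "path_in (Vc v) q" "pathstart q = x0" "pathfinish q = pt" using step.IH pt by blast
      have "z \<in> reach EG A v" using reach_step[OF step.hyps(1-4)] .
      then have sub: "B z \<subseteq> Vc v" unfolding Vc_def by blast
      show ?case
      proof
        fix x assume "x \<in> B z"
        then obtain q' where q': "path_in (B z) q'" "pathstart q' = pt" "pathfinish q' = x"
          using path_connected_path_in[of "B z" pt x] Bv[of z] step.hyps(4) pt by (auto simp: A_def)
        then show "\<exists>q. path_in (Vc v) q \<and> pathstart q = x0 \<and> pathfinish q = x"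
          using q path_in_mono[OF q'(1) sub] by (intro exI[of _ "q +++ q'"]) auto
      qed
    qed
    show ?thesis
      unfolding path_connected_def
    proof (intro ballI)
      fix x y assume "x \<in> Vc v" "y \<in> Vc v"
      then obtain p q where "path_in (Vc v) p" "pathstart p = x0" "pathfinish p = x"
        "path_in (Vc v) q" "pathstart q = x0" "pathfinish q = y" using to unfolding Vc_def by blast
      then show "\<exists>g. path g \<and> path_image g \<subseteq> Vc v \<and> pathstart g = x \<and> pathfinish g = y"
        by (intro exI[of _ "reversepath p +++ q"]) (auto simp: path_in_def path_image_join)
    qed
  qed
  have Vc_ray: "\<exists>\<sigma>. proper_ray X \<sigma> \<and> \<sigma> ` {0..} \<subseteq> Vc v \<and> \<sigma> 0 = x"
    if v: "v \<in> A" and inf: "infinite (reach EG A v)" and x: "x \<in> B v" for v x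
  proof -
    obtain f where f: "f 0 = v" "\<And>n. f n \<in> A" "\<And>n. (f n, f (Suc n)) \<in> EG" "inj f"
      using infinite_reach_ray[OF finEG v inf] by metis
    have fr: "f n \<in> reach EG A v" for n
      by (induction n) (use f in \<open>auto intro: reach_step\<close>)
    have fV: "f n \<in> VV" for n using f(2) by (auto simp: A_def)
    have "\<exists>y. y \<in> B (f n) \<and> y \<in> B (f (Suc n))" for n using f(3)[of n] by (auto simp: EG_def)
    then obtain y where y: "\<And>n. y n \<in> B (f n)" "\<And>n. y n \<in> B (f (Suc n))" by metis
    define P where "P n = (case n of 0 \<Rightarrow> x | Suc m \<Rightarrow> y m)" for n
    have P: "P n \<in> B (f n)" "P (Suc n) \<in> B (f n)" for n
      using y x f(1) by (auto simp: P_def split: nat.splits)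
    have "\<exists>p. path_in (B (f n)) p \<and> pathstart p = P n \<and> pathfinish p = P (Suc n)" for n
      using path_connected_path_in[of "B (f n)", OF _ P] Bv[OF fV] by blast
    then obtain p where p: "\<And>n. path_in (B (f n)) (p n)" "\<And>n. pathstart (p n) = P n" "\<And>n. pathfinish (p n) = P (Suc n)"
      by metis
    have sub: "B (f n) \<subseteq> Vc v" for n using fr unfolding Vc_def by blast
    have ray: "proper_ray X (\<lambda>t. p (nat \<lfloor>t\<rfloor>) (frac t))" "(\<lambda>t. p (nat \<lfloor>t\<rfloor>) (frac t)) ` {0..} \<subseteq> Vc v"
    proof -
      have a: "path_in (Vc v) (p n)" for n using path_in_mono[OF p(1) sub] .
      have b: "pathfinish (p n) = pathstart (p (Suc n))" for n by (simp add: p)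
      have c: "Vc v \<subseteq> X" using VcR(2)[OF v] by blast
      have d: "\<exists>N. \<forall>n\<ge>N. path_image (p n) \<inter> K = {}" if K: "compact K" "K \<subseteq> X" for K
      proof -
        have "finite {v \<in> VV. B v \<inter> K \<noteq> {}}" using Bfin K by blast
        then have "finite (f -` {v \<in> VV. B v \<inter> K \<noteq> {}})" using f(4) by (rule finite_vimageI)
        then obtain M where M: "\<forall>n\<in>f -` {v \<in> VV. B v \<inter> K \<noteq> {}}. n < M" using finite_nat_set_iff_bounded by blast
        have "path_image (p n) \<inter> K = {}" if "n \<ge> M" for n
        proof -
          have "B (f n) \<inter> K = {}" using M fV[of n] that by (metis (mono_tags, lifting) mem_Collect_eq not_less vimage_eq)
          then show ?thesis using p(1)[of n] by (auto simp: path_in_def)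
        qed
        then show ?thesis by blast
      qed
      show "proper_ray X (\<lambda>t. p (nat \<lfloor>t\<rfloor>) (frac t))" using proper_ray_concatenation(1)[of "Vc v" p X] a b c d by blast
      show "(\<lambda>t. p (nat \<lfloor>t\<rfloor>) (frac t)) ` {0..} \<subseteq> Vc v" using proper_ray_concatenation(2)[of "Vc v" p X] a b c d by blast
    qed
    moreover have "p (nat \<lfloor>0\<rfloor>) (frac 0) = x" using p(2)[of 0] by (simp add: P_def pathstart_def)
    ultimately show ?thesis by (intro exI[of _ "\<lambda>t. p (nat \<lfloor>t\<rfloor>) (frac t)"]) simp
  qed
  define GW where "GW W = {v \<in> VV. B v \<inter> fr W \<noteq> {}}" for W
  have GW_conn: "w \<in> reach EG (GW W) v" if W: "W \<in> components (X - N)" and v: "v \<in> GW W" "w \<in> GW W" for W v w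
  proof (rule ccontr)
    assume nr: "w \<notin> reach EG (GW W) v"
    note cf = component_frontier[OF N(1-3) W]
    define U1 where "U1 = (\<Union>v\<in>reach EG (GW W) v. B v)"
    define U2 where "U2 = (\<Union>v\<in>GW W - reach EG (GW W) v. B v)"
    have rs: "reach EG (GW W) v \<subseteq> GW W" by (rule reach_subset[OF v(1)])
    have "open_X (B a)" if "a \<in> GW W" for a using that Bv by (simp add: GW_def)
    then have op12: "open_X U1" "open_X U2" unfolding U1_def U2_def using rs by blast+
    have disj: "U1 \<inter> U2 = {}"
    proof (rule ccontr)
      assume "U1 \<inter> U2 \<noteq> {}"
      then obtain z where "z \<in> U1" "z \<in> U2" by blast
      then obtain a b where ab: "a \<in> reach EG (GW W) v" "b \<in> GW W" "b \<notin> reach EG (GW W) v" "B a \<inter> B b \<noteq> {}"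
        unfolding U1_def U2_def by blast
      moreover have "(a, b) \<in> EG" using ab rs by (auto simp: EG_def GW_def)
      ultimately show False using reach_step[of a EG "GW W" v b] rs by blast
    qed
    have cov: "fr W \<subseteq> U1 \<union> U2" using frB[OF W] by (auto simp: U1_def U2_def GW_def)
    have "fr W \<subseteq> X" by (auto simp: fr_def)
    then have "openin (top_of_set (fr W)) (fr W \<inter> U1)" "openin (top_of_set (fr W)) (fr W \<inter> U2)"
      using op12 by (auto simp: openin_open)
    moreover have "fr W \<inter> U1 \<noteq> {}" "fr W \<inter> U2 \<noteq> {}"
      using v nr by (auto simp: U1_def U2_def GW_def)
    moreover have "(fr W \<inter> U1) \<union> (fr W \<inter> U2) = fr W" "(fr W \<inter> U1) \<inter> (fr W \<inter> U2) = {}" using cov disj by auto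
    ultimately show False using cf(6) unfolding connected_openin_eq by blast
  qed
  have GW_inf: "infinite (GW W)" if W: "W \<in> components (X - N)" "\<not> group_bounded X \<phi> J W" for W
  proof
    assume "finite (GW W)"
    moreover have "precompact (B v)" if "v \<in> GW W" for v using Bv that by (auto simp: GW_def)
    ultimately have "precompact (\<Union>v\<in>GW W. B v)" by (rule precompact_UN)
    moreover have "fr W \<subseteq> (\<Union>v\<in>GW W. B v)" using frB[OF W(1)] unfolding GW_def by blast
    ultimately have pre: "precompact (fr W)" by (rule precompact_subset)
    have "\<not> precompact W"
    proof
      assume "precompact W"
      then obtain K where "cpt K" "W \<subseteq> K" by (auto simp: precompact_def)
      then show False using W(2) subset_orb[of K] unfolding bounded_iff_orb by blast
    qed
    then show False
      using unbounded_frontier[OF one_ended N(1-3) W(1) _ Q(1,2) Q(4)[OF W(1)] Q(3)] pre by blast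
  qed
  \<comment> \<open>\<open>T\<close> represents the finitely many pieces next to the gap; \<open>S\<close> collects the pieces of finite size, which \<open>E\<close> covers.\<close>
  define T where "T = {y \<in> A. \<exists>f\<in>F1. (y, f) \<in> EG}"
  have finT: "finite T"
  proof -
    have "T \<subseteq> (\<Union>f\<in>F1. EG `` {f})" using symEG by (auto simp: T_def dest: symD)
    then show ?thesis using finF1 finEG by (meson finite_UN finite_subset)
  qed
  define S where "S = {x \<in> VV. finite (reach EG A x) \<and> (\<exists>y\<in>reach EG A x. \<exists>f\<in>F1. (y, f) \<in> EG)}"
  have finS: "finite S" unfolding S_def A_def by (rule finite_bounded_components[OF symEG finF1 finEG])
  define link where "link v w D \<longleftrightarrow> (\<exists>p. path_in (X - orb Cc - D) p \<and> pathstart p \<in> Vc v \<and> pathfinish p \<in> Vc w)" for v w D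
  \<comment> \<open>If some compact set separates the two pieces, then \<open>Db v w\<close> does. As \<open>Db v w\<close> is part of \<open>E\<close>, an excursion off
    \<open>E\<close> shows that no compact set separates them.\<close>
  have "\<exists>D. cpt D \<and> ((\<exists>D. cpt D \<and> \<not> link v w D) \<longrightarrow> \<not> link v w D)" for v w
    by (cases "\<exists>D. cpt D \<and> \<not> link v w D") (blast, auto)
  then obtain Db where Db: "\<And>v w. cpt (Db v w)" "\<And>v w D. \<lbrakk>cpt D; \<not> link v w D\<rbrakk> \<Longrightarrow> \<not> link v w (Db v w)" by metis
  define E where "E = E1 \<union> C0 \<union> closure (\<Union>v\<in>F1 \<union> S. B v) \<union> (\<Union>y\<in>T. \<Union>y'\<in>T. Db y y')"
  have "precompact (\<Union>v\<in>F1 \<union> S. B v)"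
    using finF1 finS Bv by (intro precompact_UN) (auto simp: F1_def S_def)
  then have E: "cpt E" unfolding E_def
    by (intro cpt_Un cpt_UN E1 C0 Db finT precompact_closure)
  have E_sub: "E1 \<subseteq> E" "C0 \<subseteq> E" "\<And>v. v \<in> F1 \<union> S \<Longrightarrow> B v \<subseteq> E" "\<And>y y'. \<lbrakk>y \<in> T; y' \<in> T\<rbrakk> \<Longrightarrow> Db y y' \<subseteq> E"
    using closure_subset[of "\<Union>v\<in>F1 \<union> S. B v"] by (auto simp: E_def)
  have EY: "X - E \<subseteq> Y" using E_sub(2) by (auto simp: Y_def)
  have excursion: "\<exists>v w. v \<in> A \<and> w \<in> A \<and> infinite (reach EG A v) \<and> x \<in> B v \<and> y \<in> Vc w \<and> (\<forall>D. cpt D \<longrightarrow> link v w D)"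
    if W: "W \<in> components (X - N)" "\<not> group_bounded X \<phi> J W" and p: "path_in (W - E) p" "pathstart p = x" "pathfinish p = y"
      and xy: "x \<in> \<Omega>" "y \<in> \<Omega>" for W p x y
  proof -
    note cf = component_frontier[OF N(1-3) W(1)]
    have WN: "W \<subseteq> X - N" using W(1) in_components_subset by blast
    have xW: "x \<in> W" "x \<notin> E" "y \<in> W" "y \<notin> E" using path_in_ends[OF p(1)] p by auto
    have near: "v \<in> A \<and> v \<notin> S \<and> v \<in> GW W" if "v \<in> VV" "z \<in> B v" "z \<in> W" "z \<notin> E" for v z
    proof -
      have "v \<notin> F1 \<union> S" using E_sub(3)[of v] that by blast
      moreover have "B v \<inter> fr W \<noteq> {}"
      proof (rule meets_fr[OF cf(1)])
        note b = Bv[OF that(1)]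
        show "connected (B v)" using b by (simp add: path_connected_imp_connected)
        show "B v \<subseteq> X" using b by (simp add: open_X_subset)
        show "B v \<inter> W \<noteq> {}" using that by blast
        have "B v \<inter> N \<noteq> {}" using b by simp
        then show "B v - W \<noteq> {}" using WN by blast
      qed
      ultimately show ?thesis using that by (auto simp: A_def GW_def)
    qed
    obtain v where v: "v \<in> VV" "x \<in> B v" using \<Omega>(2)[OF xy(1)] xW WN by blast
    obtain w where w: "w \<in> VV" "y \<in> B w" using \<Omega>(2)[OF xy(2)] xW WN by blast
    have vA: "v \<in> A" "v \<notin> S" "v \<in> GW W" using near[OF v xW(1,2)] by auto
    have wA: "w \<in> A" "w \<notin> S" "w \<in> GW W" using near[OF w xW(3,4)] by auto
    have yVc: "y \<in> Vc w" using w(2) unfolding Vc_def by blast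
    have xVc: "x \<in> Vc v" using v(2) unfolding Vc_def by blast
    show ?thesis
    proof (cases "GW W \<inter> F1 = {}")
      case True
      then have sub: "GW W \<subseteq> A" by (auto simp: GW_def A_def)
      then have all: "GW W \<subseteq> reach EG A v"
        using GW_conn[OF W(1) vA(3)] reach_mono[OF sub] by blast
      then have inf: "infinite (reach EG A v)" using GW_inf[OF W] finite_subset by blast
      have "reach EG A w = reach EG A v" using reach_eq[OF symEG] all wA(3) by blast
      then have Vw: "Vc w = Vc v" by (simp add: Vc_def)
      have "link v w D" if D: "cpt D" for D
      proof -
        have "finite {u \<in> VV. B u \<inter> D \<noteq> {}}" using Bfin D by blast
        then have "\<not> reach EG A v \<subseteq> {u \<in> VV. B u \<inter> D \<noteq> {}}" using inf finite_subset by blast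
        then obtain u where u: "u \<in> reach EG A v" "B u \<inter> D = {}" using reachA(1)[OF vA(1)] by blast
        then obtain z where z: "z \<in> B u" using B_ne reachA(1)[OF vA(1)] by blast
        then have "z \<in> Vc v" using u unfolding Vc_def by blast
        then show ?thesis
          unfolding link_def Vw using z u(2) VcR(2)[OF vA(1)] by (intro exI[of _ "\<lambda>_. z"]) auto
      qed
      then show ?thesis using vA wA v yVc inf by blast
    next
      case False
      then obtain f where f: "f \<in> GW W" "f \<in> F1" by blast
      have GWV: "GW W \<subseteq> VV" by (auto simp: GW_def)
      have adj: "infinite (reach EG A a) \<and> (\<exists>y\<in>T. reach EG A y = reach EG A a)" if a: "a \<in> GW W" "a \<in> A" "a \<notin> S" for a
      proof -
        have "f \<in> reach EG VV a" using GW_conn[OF W(1) a(1) f(1)] reach_mono[OF GWV] by blast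
        then obtain y f' where y: "y \<in> reach EG A a" "f' \<in> F1" "(y, f') \<in> EG"
          using reach_meets_boundary[of f EG VV a F1] a(2) f(2) unfolding A_def by blast
        then have "infinite (reach EG A a)" using a unfolding S_def A_def by blast
        moreover have "y \<in> T" using y reachA(2)[OF a(2)] by (auto simp: T_def)
        ultimately show ?thesis using reach_eq[OF symEG y(1)] by blast
      qed
      obtain a where a: "a \<in> T" "reach EG A a = reach EG A v" and inf: "infinite (reach EG A v)"
        using adj[OF vA(3,1,2)] by blast
      obtain b where b: "b \<in> T" "reach EG A b = reach EG A w" using adj[OF wA(3,1,2)] by blast
      have Vab: "Vc a = Vc v" "Vc b = Vc w" using a b by (simp_all add: Vc_def)
      have "W - E \<subseteq> X - orb Cc - Db a b" using WN N(5) E_sub(4)[OF a(1) b(1)] by blast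
      then have "path_in (X - orb Cc - Db a b) p" by (rule path_in_mono[OF p(1)])
      then have "link a b (Db a b)" unfolding link_def Vab using p xVc yVc by blast
      then have "link a b D" if "cpt D" for D using Db(2)[OF that] by blast
      then have "\<forall>D. cpt D \<longrightarrow> link v w D" unfolding link_def Vab by blast
      then show ?thesis using vA wA v yVc inf by blast
    qed
  qed
  show ?thesis
  proof (rule that[OF E])
    fix D assume D: "cpt D"
    then obtain D1 sim where er: "end_relation (orb V - E1) D D1 sim" using inv by blast
    note D1 = end_relationD(1,2)[OF er] and sym = end_relationD(3)[OF er] and trans = end_relationD(4)[OF er]
      and hom = end_relationD(5)[OF er] and along = end_relationD(6)[OF er]
      and deep = end_relationD(7)[OF er] and simD = end_relationD(8)[OF er]
    \<comment> \<open>Co-semistability slides \<open>\<alpha>\<close> along the ray \<open>\<sigma>\<close> to a loop \<open>\<beta>\<close> off \<open>D1\<close>. Prolonging by the segment \<open>\<tau>\<close> of \<open>\<sigma>\<close>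
      is a move inside the translates, and prolonging by \<open>\<beta>\<close> is a move off \<open>D1\<close>.\<close>
    have loop: "sim u (u +++ \<alpha>)"
      if u: "path_in Y u" "pathfinish u = x" and v: "v \<in> A" "infinite (reach EG A v)" "x \<in> B v"
        and W: "W \<in> components (X - N)" "\<not> group_bounded X \<phi> J W"
        and \<alpha>: "path_in (X - orb Cc) \<alpha>" "pathstart \<alpha> = x" "pathfinish \<alpha> = x" "x \<in> W" for u \<alpha> x v W
    proof -
      obtain \<sigma> where \<sigma>: "proper_ray X \<sigma>" "\<sigma> ` {0..} \<subseteq> Vc v" "\<sigma> 0 = x" using Vc_ray[OF v] by blast
      note \<sigma>X = proper_ray_in[OF \<sigma>(1)]
      have \<sigma>R: "ray_in (orb V - E1) \<sigma>" using \<sigma>X \<sigma>(2) VcR(1)[OF v(1)] by (auto simp: ray_in_def)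
      have \<sigma>Y: "ray_in Y \<sigma>" using ray_in_mono[OF \<sigma>R RY] .
      have xC: "x \<in> X - orb Cc" using path_in_ends[OF \<alpha>(1)] \<alpha>(2) by auto
      define U where "U = connected_component_set (X - orb Cc) x"
      have U: "U \<in> components (X - orb Cc)" using xC by (auto simp: U_def components_iff)
      have inU: "S \<subseteq> U" if "connected S" "S \<subseteq> X - orb Cc" "x \<in> S" for S
        unfolding U_def using connected_component_maximal[OF that(3,1,2)] .
      have WU: "W \<subseteq> U"
        using inU[OF in_components_connected[OF W(1)] _ \<alpha>(4)] in_components_subset[OF W(1)] N(5) by blast
      have "\<not> group_bounded X \<phi> J U" using W(2) WU unfolding bounded_iff_orb by blast
      moreover have "\<sigma> ` {0..} \<subseteq> U"
      proof (rule inU)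
        show "connected (\<sigma> ` {0..})"
          using \<sigma>X by (intro connected_continuous_image) (auto simp: ray_in_def)
        show "\<sigma> ` {0..} \<subseteq> X - orb Cc" using \<sigma>(2) VcR(2)[OF v(1)] by blast
        show "x \<in> \<sigma> ` {0..}" using \<sigma>(3) by force
      qed
      moreover have "group_bounded X \<phi> J (\<sigma> ` {0..})"
      proof -
        obtain K where "cpt K" "V \<subseteq> K" using V(3) by (auto simp: precompact_def)
        then show ?thesis using \<sigma>R orb_mono[of V K] unfolding bounded_iff_orb ray_in_def by blast
      qed
      ultimately have co: "co_semistable_in_component X U \<sigma> C0" by (intro cosemistable[OF U _ \<sigma>(1)])
      have "path_image \<alpha> \<subseteq> U"
        using \<alpha> by (intro inU) (auto simp: path_in_def connected_path_image)
      then have "\<exists>n\<ge>0. \<exists>H :: real \<times> real \<Rightarrow> 'a.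
           continuous_on ({0..1} \<times> {0..n}) H \<and> H \<in> {0..1} \<times> {0..n} \<rightarrow> X - C0 \<and>
           (\<forall>t\<in>{0..1}. H (t, 0) = \<alpha> t) \<and> (\<forall>s\<in>{0..n}. H (0, s) = \<sigma> s \<and> H (1, s) = \<sigma> s) \<and> (\<forall>t\<in>{0..1}. H (t, n) \<in> X - D1)"
        using co[unfolded co_semistable_in_component_def, rule_format, of D1 \<alpha>] D1(1) \<alpha> \<sigma>(3)
        by (auto simp: path_in_def)
      then obtain n H where n: "n \<ge> 0" and H: "continuous_on ({0..1} \<times> {0..n}) H" "H \<in> {0..1} \<times> {0..n} \<rightarrow> Y"
        "\<And>t. t \<in> {0..1} \<Longrightarrow> H (t, 0) = \<alpha> t" "\<And>s. s \<in> {0..n} \<Longrightarrow> H (0, s) = \<sigma> s" "\<And>s. s \<in> {0..n} \<Longrightarrow> H (1, s) = \<sigma> s"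
        "\<And>t. t \<in> {0..1} \<Longrightarrow> H (t, n) \<in> X - D1" unfolding Y_def by blast
      define \<beta> where "\<beta> = (\<lambda>t. H (t, n))"
      define \<tau> where "\<tau> = seg \<sigma> 0 n"
      have sq: "homotopic_paths Y ((\<lambda>t. H (t, 0)) +++ (\<lambda>s. H (1, n * s))) ((\<lambda>s. H (0, n * s)) +++ \<beta>)"
        unfolding \<beta>_def by (rule homotopic_square[OF H(1,2) n])
      have end1: "\<beta> 0 = \<sigma> n" "\<beta> 1 = \<sigma> n" using H(4,5)[of n] n by (auto simp: \<beta>_def)
      have pf: "path_in Y (\<lambda>s. H (0, n * s)) \<and> path_in Y \<beta>"
        using homotopic_paths_path_in[OF sq] path_in_joinD[of Y "\<lambda>s. H (0, n * s)" \<beta>]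
        by (simp add: pathfinish_def pathstart_def \<beta>_def)
      have pf': "path_in Y (\<lambda>t. H (t, 0)) \<and> path_in Y (\<lambda>s. H (1, n * s))"
        using homotopic_paths_path_in[OF sq] path_in_joinD[of Y "\<lambda>t. H (t, 0)" "\<lambda>s. H (1, n * s)"]
        by (simp add: pathfinish_def pathstart_def)
      have ns: "n * s \<in> {0..n}" if "s \<in> {0..1}" for s using that n by (auto simp: mult_left_le)
      have e1: "homotopic_paths Y (\<lambda>t. H (t, 0)) \<alpha>"
        using pf' H(3) by (intro homotopic_paths_eq) (auto simp: path_in_def)
      have e2: "homotopic_paths Y (\<lambda>s. H (1, n * s)) \<tau>"
        using pf' H(5)[OF ns] by (intro homotopic_paths_eq) (auto simp: path_in_def \<tau>_def seg_0)
      have e3: "homotopic_paths Y (\<lambda>s. H (0, n * s)) \<tau>"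
        using pf H(4)[OF ns] by (intro homotopic_paths_eq) (auto simp: path_in_def \<tau>_def seg_0)
      have \<alpha>Y: "path_in Y \<alpha>" using homotopic_paths_path_in[OF e1] by simp
      have \<tau>Y: "path_in Y \<tau>" "path_in (orb V - E1) \<tau>" "pathstart \<tau> = x" "pathfinish \<tau> = \<sigma> n"
        using ray_in_seg[OF \<sigma>Y, of 0 n] ray_in_seg[OF \<sigma>R, of 0 n] n \<sigma>(3) by (auto simp: \<tau>_def)
      have be: "pathstart \<beta> = \<sigma> n" "pathfinish \<beta> = \<sigma> n" using end1 by (auto simp: pathstart_def pathfinish_def)
      have "homotopic_paths Y (\<alpha> +++ \<tau>) ((\<lambda>t. H (t, 0)) +++ (\<lambda>s. H (1, n * s)))"
        using e1 e2 by (intro homotopic_paths_sym[OF homotopic_paths_join]) (auto simp: pathstart_def pathfinish_def)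
      also note sq
      also have "homotopic_paths Y ((\<lambda>s. H (0, n * s)) +++ \<beta>) (\<tau> +++ \<beta>)"
        using e3 pf by (intro hom_right) (auto simp: pathstart_def pathfinish_def \<beta>_def)
      finally have conj: "homotopic_paths Y (\<alpha> +++ \<tau>) (\<tau> +++ \<beta>)" .
      have "\<beta> t \<in> X - D1" if "t \<in> {0..1}" for t using H(6)[OF that] by (simp add: \<beta>_def)
      then have \<beta>D: "path_in (X - D1) \<beta>" using pf by (auto simp: path_in_def path_image_def)
      have \<sigma>n: "\<sigma> n \<in> orb V - E1" using path_in_ends(2)[OF \<tau>Y(2)] \<tau>Y(4) by simp
      have 1: "sim u (u +++ \<tau>)" using u \<tau>Y by (intro along) auto
      have 2: "sim (u +++ \<tau>) ((u +++ \<tau>) +++ \<beta>)"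
        using u \<tau>Y pf \<beta>D be \<sigma>n by (intro deep) auto
      have "homotopic_paths Y ((u +++ \<tau>) +++ \<beta>) (u +++ (\<tau> +++ \<beta>))"
        using u \<tau>Y pf be by (intro hom_assoc) auto
      also have "homotopic_paths Y \<dots> (u +++ (\<alpha> +++ \<tau>))"
        using u \<tau>Y by (intro hom_left[OF homotopic_paths_sym[OF conj]]) auto
      also have "homotopic_paths Y \<dots> ((u +++ \<alpha>) +++ \<tau>)"
        using u \<tau>Y \<alpha>Y \<alpha> by (intro homotopic_paths_sym[OF hom_assoc]) auto
      finally have 3: "sim ((u +++ \<tau>) +++ \<beta>) ((u +++ \<alpha>) +++ \<tau>)"
        using u \<tau>Y pf be \<sigma>n by (intro hom) auto
      have 4: "sim (u +++ \<alpha>) ((u +++ \<alpha>) +++ \<tau>)" using u \<alpha>Y \<alpha> \<tau>Y by (intro along) auto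
      show ?thesis by (rule trans[OF trans[OF trans[OF 1 2] 3] sym[OF 4]])
    qed
    have exc: "sim u (u +++ p)"
      if u: "path_in Y u" "pathfinish u = pathstart p" and W: "W \<in> components (X - N)" "\<not> group_bounded X \<phi> J W"
        and p: "path_in (W - E) p" "pathstart p \<in> \<Omega>" "pathfinish p \<in> \<Omega>" for u p W
    proof -
      obtain v w where vw: "v \<in> A" "w \<in> A" "infinite (reach EG A v)" "pathstart p \<in> B v" "pathfinish p \<in> Vc w"
        and lk: "\<And>D. cpt D \<Longrightarrow> link v w D"
        using excursion[OF W p(1) refl refl p(2,3)] by blast
      have WN: "W \<subseteq> X - N" using W(1) in_components_subset by blast
      obtain pd where pd: "path_in (X - orb Cc - (D1 \<union> C0)) pd" "pathstart pd \<in> Vc v" "pathfinish pd \<in> Vc w"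
        using lk[OF cpt_Un[OF D1(1) C0]] unfolding link_def by blast
      have pVc: "pathstart p \<in> Vc v" using vw(4) unfolding Vc_def by blast
      obtain q1 where q1: "path_in (Vc v) q1" "pathstart q1 = pathstart p" "pathfinish q1 = pathstart pd"
        using path_connected_path_in[OF Vc_pc[OF vw(1)] pVc pd(2)] by blast
      obtain q2 where q2: "path_in (Vc w) q2" "pathstart q2 = pathfinish pd" "pathfinish q2 = pathfinish p"
        using path_connected_path_in[OF Vc_pc[OF vw(2)] pd(3) vw(5)] by blast
      have sub: "W - E \<subseteq> X - orb Cc" "W - E \<subseteq> Y" "X - orb Cc - (D1 \<union> C0) \<subseteq> X - orb Cc"
        "X - orb Cc - (D1 \<union> C0) \<subseteq> Y" "X - orb Cc - (D1 \<union> C0) \<subseteq> X - D1"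
        using WN N(5) EY by (auto simp: Y_def)
      have inC: "path_in (X - orb Cc) p" "path_in (X - orb Cc) q1" "path_in (X - orb Cc) q2" "path_in (X - orb Cc) pd"
        by (rule path_in_mono[OF p(1) sub(1)] path_in_mono[OF q1(1) VcR(2)[OF vw(1)]]
            path_in_mono[OF q2(1) VcR(2)[OF vw(2)]] path_in_mono[OF pd(1) sub(3)])+
      have inR: "path_in (orb V - E1) q1" "path_in (orb V - E1) q2"
        by (rule path_in_mono[OF q1(1) VcR(1)[OF vw(1)]] path_in_mono[OF q2(1) VcR(1)[OF vw(2)]])+
      have inY: "path_in Y p" "path_in Y q1" "path_in Y q2" "path_in Y pd"
        by (rule path_in_mono[OF p(1) sub(2)] path_in_mono[OF inR(1) RY] path_in_mono[OF inR(2) RY]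
            path_in_mono[OF pd(1) sub(4)])+
      have pdD: "path_in (X - D1) pd" by (rule path_in_mono[OF pd(1) sub(5)])
      \<comment> \<open>The excursion \<open>p\<close> closed up through the layer and along \<open>pd\<close>, which runs off \<open>D1\<close>.\<close>
      define \<alpha> where "\<alpha> = ((p +++ reversepath q2) +++ reversepath pd) +++ reversepath q1"
      have \<alpha>: "path_in (X - orb Cc) \<alpha>" "path_in Y \<alpha>" "pathstart \<alpha> = pathstart p" "pathfinish \<alpha> = pathstart p"
        using inC inY q1 q2 pd by (auto simp: \<alpha>_def)
      have xW: "pathstart p \<in> W" using path_in_ends(1)[OF p(1)] by blast
      have 1: "sim u (u +++ \<alpha>)"
        using loop[OF u vw(1,3,4) W \<alpha>(1,3,4) xW] .
      let ?u1 = "u +++ p" let ?u2 = "?u1 +++ reversepath q2" let ?u3 = "?u2 +++ reversepath pd"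
      have s1: "sim ?u1 ?u2" using u inY inR q2 by (intro along) auto
      have s2: "sim ?u2 ?u3"
        using u inY q2 pdD path_in_ends[OF inR(2)] path_in_ends[OF inR(1)] q1 by (intro deep) auto
      have s3: "sim ?u3 (?u3 +++ reversepath q1)" using u inY inR q1 q2 by (intro along) auto
      have "homotopic_paths Y (?u3 +++ reversepath q1) ((?u1 +++ (reversepath q2 +++ reversepath pd)) +++ reversepath q1)"
        using u inY q1 q2 by (intro hom_right hom_assoc) auto
      also have "homotopic_paths Y \<dots> ((u +++ (p +++ (reversepath q2 +++ reversepath pd))) +++ reversepath q1)"
        using u inY q1 q2 by (intro hom_right hom_assoc) auto
      also have "homotopic_paths Y \<dots> ((u +++ ((p +++ reversepath q2) +++ reversepath pd)) +++ reversepath q1)"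
        using u inY q1 q2 by (intro hom_right[OF hom_left[OF homotopic_paths_sym[OF hom_assoc]]]) auto
      also have "homotopic_paths Y \<dots> (u +++ \<alpha>)"
        unfolding \<alpha>_def using u inY q1 q2 by (intro hom_assoc) auto
      finally have s4: "sim (?u3 +++ reversepath q1) (u +++ \<alpha>)"
        using u inY q1 q2 path_in_ends(1)[OF inR(1)] by (intro hom) auto
      show ?thesis by (rule trans[OF 1 sym[OF trans[OF trans[OF s1 s2] trans[OF s3 s4]]]])
    qed
    define D' where "D' = D1 \<union> E"
    have D': "cpt D'" unfolding D'_def using cpt_Un[OF D1(1) E] .
    have "finite {g \<in> J. \<nexists>e. zray D' g e}" using finite_no_zray[OF D'] .
    then have "{g \<in> J. \<nexists>e. zray D' g e} \<noteq> J" using infinite_J by metis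
    then obtain g e where g: "g \<in> J" "zray D' g e" by blast
    define Z where "Z = ray_image ze e ` {0..}"
    define w where "w = zv g"
    have ray: "proper_ray X (ray_image ze e)" "ray_in (X - D') (ray_image ze e)" "ray_image ze e 0 = w"
      using zray_proper[OF g(2)] zray_ray_in[OF g(2)] zray_start[OF g(2)] by (auto simp: w_def)
    have Z: "connected Z" "Z \<subseteq> X - D'" "w \<in> Z"
      using ray by (auto simp: Z_def ray_in_def intro!: connected_continuous_image image_eqI[of _ _ 0])
    have Z_pre: "\<not> precompact Z"
    proof
      assume "precompact Z"
      then obtain K where K: "compact K" "K \<subseteq> X" "Z \<subseteq> K" by (auto simp: precompact_def)
      obtain a where "a \<ge> 0" "ray_image ze e ` {a..} \<subseteq> X - K" using proper_ray_tail[OF ray(1) K(1,2)] .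
      then show False using K(3) by (auto simp: Z_def image_subset_iff)
    qed
    have w: "w \<in> \<Omega>" "w \<notin> D'" "w \<in> orb V - E1"
      using zv\<Omega>[OF g(1)] Z V(5) E_sub(1) by (auto simp: w_def D'_def)
    have push: "\<exists>q. path_in (X - D) q \<and> homotopic_paths Y p q"
      if p: "path_in (X - E) p" "pathstart p = w" "pathfinish p = w" for p
    proof -
      define \<Omega>' where "\<Omega>' = \<Omega> \<union> \<Union>{W \<in> components (X - N). group_bounded X \<phi> J W}"
      have \<Omega>'V: "\<Omega>' \<subseteq> orb V" using V(5) bdd by (auto simp: \<Omega>'_def)
      have "open_X \<Omega>'" unfolding \<Omega>'_def using component_open[OF opN] \<Omega>(1) by blast
      moreover have pX: "path_in X p" using p(1) path_in_mono by blast
      moreover have "path_image p \<subseteq> \<Omega>' \<union> (X - N)" using pX N(4) by (auto simp: path_in_def \<Omega>'_def)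
      ultimately obtain n where n: "n > 0" and piece:
        "\<And>i. i < n \<Longrightarrow> p ` {real i / real n..real (Suc i) / real n} \<subseteq> \<Omega>' \<or> p ` {real i / real n..real (Suc i) / real n} \<subseteq> X - N"
        using path_partition[OF _ _ opN, of p \<Omega>'] by metis
      have pE: "p t \<in> X - E" if "t \<in> {0..1}" for t using path_in_pathD[OF p(1) that] .
      have pY: "path_in Y p" using p(1) EY path_in_mono by blast
      have sY: "path_in Y (seg p s t)" if "s \<in> {0..1}" "t \<in> {0..1}" for s t
        using path_in_seg_path[OF pY that] .
      have cont: "continuous_on {0..1} p" using p(1) by (simp add: path_in_def path_def)
      define ok where "ok t \<longleftrightarrow> p t \<in> \<Omega>' \<and> sim (seg p 0 0) (seg p 0 t)" for t
      have comp: "sim (seg p 0 s +++ seg p s t) (seg p 0 t)"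
        if "s \<in> {0..1}" "t \<in> {0..1}" "p t \<in> orb V" for s t
        using that sY pE[of t] E_sub(1) homotopic_seg_join_path[OF pY, of 0 s t] by (intro hom) auto
      have go: "ok t" if i: "ok s" and st: "0 \<le> s" "s \<le> t" "t \<le> 1" and im: "p ` {s..t} \<subseteq> \<Omega>'" for s t
      proof -
        have "path_in (orb V - E1) (seg p s t)"
        proof (rule path_in_seg[OF cont])
          show "p ` closed_segment s t \<subseteq> orb V - E1"
            using im \<Omega>'V pE E_sub(1) st by (auto simp: closed_segment_eq_real_ivl image_subset_iff)
          show "closed_segment s t \<subseteq> {0..1}" using st by (auto simp: closed_segment_eq_real_ivl)
        qed
        then have "sim (seg p 0 s) (seg p 0 s +++ seg p s t)"
          using sY st by (intro along) auto
        moreover have "p t \<in> \<Omega>'" using im st by auto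
        ultimately show ?thesis
          using i comp[of s t] st \<Omega>'V trans unfolding ok_def by (meson atLeastAtMost_iff order_trans subsetD)
      qed
      have jump: "ok t" if i: "ok s" and st: "0 \<le> s" "s \<le> t" "t \<le> 1" and im: "p ` {s..t} \<subseteq> X - N" and pt: "p t \<in> \<Omega>'" for s t
      proof -
        have "connected (p ` {s..t})"
          using st by (intro connected_continuous_image continuous_on_subset[OF cont]) auto
        moreover have "p ` {s..t} \<noteq> {}" using st by auto
        ultimately obtain W where W: "W \<in> components (X - N)" "p ` {s..t} \<subseteq> W"
          using component_subset_component[OF _ _ im] by blast
        show ?thesis
        proof (cases "group_bounded X \<phi> J W")
          case True
          then have "p ` {s..t} \<subseteq> \<Omega>'" using W by (auto simp: \<Omega>'_def)
          then show ?thesis using go[OF i st] by blast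
        next
          case False
          have unb: "p r \<in> \<Omega>" if pr: "p r \<in> \<Omega>'" "p r \<in> W" for r
          proof (rule ccontr)
            assume "p r \<notin> \<Omega>"
            then obtain W' where W': "W' \<in> components (X - N)" "group_bounded X \<phi> J W'" "p r \<in> W'"
              using pr(1) by (auto simp: \<Omega>'_def)
            then have "W' = W" using components_nonoverlap[OF W'(1) W(1)] pr(2) by blast
            then show False using W'(2) False by blast
          qed
          have ps: "p s \<in> \<Omega>" "p t \<in> \<Omega>" using unb i pt W(2) st by (auto simp: ok_def image_subset_iff)
          have "path_in (W - E) (seg p s t)"
          proof (rule path_in_seg[OF cont])
            show "p ` closed_segment s t \<subseteq> W - E"
              using W(2) pE st by (auto simp: closed_segment_eq_real_ivl image_subset_iff)
            show "closed_segment s t \<subseteq> {0..1}" using st by (auto simp: closed_segment_eq_real_ivl)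
          qed
          then have "sim (seg p 0 s) (seg p 0 s +++ seg p s t)"
            using sY st ps by (intro exc[OF _ _ W(1) False]) auto
          then show ?thesis
            using i comp[of s t] st \<Omega>'V trans pt unfolding ok_def by (meson atLeastAtMost_iff order_trans subsetD)
        qed
      qed
      have w\<Omega>': "p 0 \<in> \<Omega>'" "p 1 \<in> \<Omega>'" using p w by (auto simp: pathstart_def pathfinish_def \<Omega>'_def)
      have ok0: "ok 0"
      proof -
        have c: "path_in Y (\<lambda>_. p 0)" using sY[of 0 0] by simp
        have "sim (\<lambda>_. p 0) (\<lambda>_. p 0)"
          using w(3) p(2) by (intro hom[OF c _ hom_refl[OF c]]) (simp add: pathstart_def)
        then show ?thesis using w\<Omega>'(1) by (simp add: ok_def)
      qed
      \<comment> \<open>\<open>s\<close> is either the end of the \<open>i\<close>-th piece or the start of a sequence of pieces in \<open>X - N\<close>; these are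
        handled together once the path returns to \<open>\<Omega>'\<close>.\<close>
      have step: "\<exists>s. 0 \<le> s \<and> s \<le> real i / real n \<and> ok s \<and> (s = real i / real n \<or> p ` {s..real i / real n} \<subseteq> X - N)"
        if "i \<le> n" for i
        using that
      proof (induction i)
        case 0
        show ?case using ok0 by (intro exI[of _ 0]) auto
      next
        case (Suc i)
        define a where "a = real i / real n"
        define b where "b = real (Suc i) / real n"
        have ab: "0 \<le> a" "a \<le> b" "b \<le> 1" using Suc.prems n by (auto simp: a_def b_def field_simps)
        obtain s where s: "0 \<le> s" "s \<le> a" "ok s" "s = a \<or> p ` {s..a} \<subseteq> X - N"
          using Suc unfolding a_def by auto
        have pc: "p ` {a..b} \<subseteq> \<Omega>' \<or> p ` {a..b} \<subseteq> X - N" using piece[of i] Suc.prems by (simp add: a_def b_def)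
        have "\<exists>s. 0 \<le> s \<and> s \<le> b \<and> ok s \<and> (s = b \<or> p ` {s..b} \<subseteq> X - N)"
          using pc
        proof
          assume in\<Omega>: "p ` {a..b} \<subseteq> \<Omega>'"
          then have "p a \<in> \<Omega>'" using ab by auto
          then have "ok a" using s(4) jump[OF s(3,1,2)] s(3) ab by auto
          then have "ok b" using go[of a b] ab in\<Omega> by auto
          then show ?thesis using ab by (intro exI[of _ b]) auto
        next
          assume inN: "p ` {a..b} \<subseteq> X - N"
          have "{s..b} = {s..a} \<union> {a..b}" using s ab by auto
          then have "p ` {s..b} \<subseteq> X - N" using s(4) inN ab by (auto simp: image_Un)
          then show ?thesis using s ab by (intro exI[of _ s]) auto
        qed
        then show ?case by (simp add: b_def)
      qed
      obtain s where "0 \<le> s" "s \<le> 1" "ok s" "s = 1 \<or> p ` {s..1} \<subseteq> X - N"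
        using step[OF order_refl] n by auto
      then have "ok 1" using jump[of s 1] w\<Omega>'(2) by auto
      then have "sim (\<lambda>_. w) p" using p(2) by (simp add: ok_def pathstart_def)
      then have "joined Y (X - D) (\<lambda>_. w) p"
        using w(2) p(3) by (intro simD) (auto simp: D'_def)
      then obtain q where q: "path_in Y q" "path_in (X - D) q" "pathstart q = w" "homotopic_paths Y ((\<lambda>_. w) +++ q) p"
        unfolding joined_def by auto
      have "homotopic_paths Y p q"
        using homotopic_paths_sym[OF q(4)] hom_lconst[OF q(1)] q(3) homotopic_paths_trans by blast
      then show ?thesis using q(2) by blast
    qed
    show "\<exists>D' w Z. cpt D' \<and> D \<subseteq> D' \<and> E \<subseteq> D' \<and> connected Z \<and> Z \<subseteq> X - D' \<and> \<not> precompact Z \<and> w \<in> Z \<and>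
       (\<forall>p. path_in (X - E) p \<longrightarrow> pathstart p = w \<longrightarrow> pathfinish p = w \<longrightarrow>
          (\<exists>q. path_in (X - D) q \<and> homotopic_paths Y p q))"
      using D' D1(2) Z Z_pre push by (intro exI[of _ D'] exI[of _ w] exI[of _ Z]) (auto simp: D'_def)
  qed
qed

end

section \<open>From loops to rays\<close>

text \<open>
  A homotopy relative to the end points of \<open>p +++ q'\<close> to \<open>q +++ p'\<close> becomes a map of the square
  with sides \<open>p\<close>, \<open>q'\<close>, \<open>q\<close>, \<open>p'\<close>: the point \<open>(t, u)\<close> is at distance \<open>t + u\<close> from the corner along
  both pairs of sides, and \<open>u - t\<close> measures the position between them. The homotopy parameter
  \<open>((u - t) / w + 1) / 2\<close> is undefined at the two corners where \<open>w = 0\<close>, but there the homotopy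
  does not depend on it.
\<close>
lemma fill_square:
  fixes p q p' q' :: "real \<Rightarrow> 'a::metric_space"
  assumes "homotopic_paths S (p +++ q') (q +++ p')" "pathfinish p = pathstart q'" "pathfinish q = pathstart p'"
  obtains F where "continuous_on ({0..1} \<times> {0..1}) F" "F ` ({0..1} \<times> {0..1}) \<subseteq> S"
    "\<And>t. t \<in> {0..1} \<Longrightarrow> F (t, 0) = p t" "\<And>t. t \<in> {0..1} \<Longrightarrow> F (t, 1) = p' t"
    "\<And>t. t \<in> {0..1} \<Longrightarrow> F (0, t) = q t" "\<And>t. t \<in> {0..1} \<Longrightarrow> F (1, t) = q' t"
proof -
  let ?Q = "{0..1::real} \<times> {0..1::real}"
  obtain h where h: "continuous_on ?Q h" "h \<in> ?Q \<rightarrow> S" "\<And>x. x \<in> {0..1} \<Longrightarrow> h (0, x) = (p +++ q') x"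
    "\<And>x. x \<in> {0..1} \<Longrightarrow> h (1, x) = (q +++ p') x"
    and ends: "\<And>t. t \<in> {0..1} \<Longrightarrow> h (t, 0) = p 0 \<and> h (t, 1) = q' 1"
    using assms(1) unfolding homotopic_paths by (auto simp: pathstart_def pathfinish_def joinpaths_def)
  have pq: "p 1 = q' 0" "q 1 = p' 0" "q 0 = p 0" "p' 1 = q' 1"
    using assms homotopic_paths_ends[OF assms(1)] by (auto simp: pathstart_def pathfinish_def joinpaths_def)
  define w :: "real \<times> real \<Rightarrow> real" where "w x = min (fst x + snd x) (2 - (fst x + snd x))" for x
  define m :: "real \<times> real \<Rightarrow> real \<times> real" where "m x = (((snd x - fst x) / w x + 1) / 2, (fst x + snd x) / 2)" for x
  define F where "F x = h (m x)" for x
  have mQ: "m x \<in> ?Q" if "x \<in> ?Q" for x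
  proof -
    obtain t u where tu: "x = (t, u)" by (cases x)
    have x: "x = (t, u)" "0 \<le> t" "t \<le> 1" "0 \<le> u" "u \<le> 1" using that tu by auto
    have "\<bar>u - t\<bar> \<le> w x" "0 \<le> w x" using x by (auto simp: w_def min_def abs_if)
    then have "\<bar>(u - t) / w x\<bar> \<le> 1" by (cases "w x = 0") (auto simp: divide_le_eq)
    then have "- 1 \<le> (u - t) / w x" "(u - t) / w x \<le> 1" unfolding abs_le_iff by linarith+
    then show ?thesis using x by (auto simp: m_def)
  qed
  have corner: "F x' = p 0" if "x' = (0, 0)" for x' using that ends[of "1/2"] by (simp add: F_def m_def w_def)
  have corner': "F x' = q' 1" if "x' = (1, 1)" for x' using that ends[of "1/2"] by (simp add: F_def m_def w_def)
  have uc: "uniformly_continuous_on ?Q h"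
    using h(1) by (intro compact_uniformly_continuous compact_Times) auto
  have near: "\<exists>d>0. \<forall>x'\<in>?Q. dist x' c < d \<longrightarrow> dist (F x') (F c) < e" if c: "c = (0, 0) \<or> c = (1, 1)" and "e > 0" for c e
  proof -
    obtain d where d: "d > 0" "\<And>a b. \<lbrakk>a \<in> ?Q; b \<in> ?Q; dist a b < d\<rbrakk> \<Longrightarrow> dist (h a) (h b) < e"
      using uc \<open>e > 0\<close> unfolding uniformly_continuous_on_def by (metis dist_commute)
    have "dist (F x') (F c) < e" if x': "x' \<in> ?Q" "dist x' c < d" for x'
    proof -
      have y: "(fst (m x'), fst c) \<in> ?Q" using mQ[OF x'(1)] c by (auto simp: mem_Times_iff)
      have c01: "fst c = snd c" using c by auto
      have "\<bar>fst x' - fst c\<bar> \<le> dist x' c" "\<bar>snd x' - snd c\<bar> \<le> dist x' c"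
        using dist_fst_le[of x' c] dist_snd_le[of x' c] by (simp_all add: dist_real_def)
      then have "\<bar>snd (m x') - fst c\<bar> < d" using x'(2) c01 by (simp add: m_def abs_le_iff abs_less_iff field_simps)
      moreover have "dist (m x') (fst (m x'), fst c) = \<bar>snd (m x') - fst c\<bar>"
        by (simp add: dist_prod_def dist_real_def)
      ultimately have "dist (F x') (h (fst (m x'), fst c)) < e"
        unfolding F_def using d(2)[OF mQ[OF x'(1)] y] by simp
      moreover have "h (fst (m x'), fst c) = F c"
        using c ends[of "fst (m x')"] mQ[OF x'(1)] corner corner' by (auto simp: mem_Times_iff)
      ultimately show ?thesis by simp
    qed
    then show ?thesis using d(1) by blast
  qed
  have cont_off: "continuous_on (?Q - {(0,0), (1,1)}) F"
  proof -
    have "w x \<noteq> 0" if "x \<in> ?Q - {(0,0), (1,1)}" for x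
      using that by (cases x) (auto simp: w_def min_def split: if_splits)
    then have "continuous_on (?Q - {(0,0), (1,1)}) m"
      unfolding m_def w_def by (intro continuous_intros) (auto simp: w_def)
    moreover have "m ` (?Q - {(0,0), (1,1)}) \<subseteq> ?Q" by (rule image_subsetI, rule mQ) simp
    ultimately have "continuous_on (?Q - {(0,0), (1,1)}) (h \<circ> m)"
      by (intro continuous_on_compose continuous_on_subset[OF h(1)])
    then show ?thesis by (simp add: F_def[abs_def] o_def)
  qed
  show ?thesis
  proof
    show "continuous_on ?Q F"
      unfolding continuous_on_eq_continuous_within
    proof
      fix x assume x: "x \<in> ?Q"
      show "continuous (at x within ?Q) F"
      proof (cases "x = (0, 0) \<or> x = (1, 1)")
        case True
        then show ?thesis unfolding continuous_within_eps_delta using near by blast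
      next
        case False
        have "at x within ?Q = at x within (?Q - {(0,0), (1,1)})"
          by (rule at_within_nhd[of x "- {(0,0), (1,1)}"]) (use False in \<open>auto intro!: open_Compl\<close>)
        then show ?thesis using cont_off x False unfolding continuous_on_eq_continuous_within by auto
      qed
    qed
    show "F ` ?Q \<subseteq> S" using mQ h(2) by (auto simp: F_def)
    fix t :: real assume t: "t \<in> {0..1}"
    show "F (t, 0) = p t"
    proof (cases "t = 0")
      case False
      then have "m (t, 0) = (0, t / 2)" using t by (simp add: m_def w_def)
      then show ?thesis using h(3)[of "t / 2"] t by (simp add: F_def joinpaths_def)
    qed (simp add: corner)
    show "F (t, 1) = p' t"
    proof (cases "t = 1")
      case False
      then have "m (t, 1) = (1, (t + 1) / 2)" using t by (simp add: m_def w_def min_def)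
      then show ?thesis using h(4)[of "(t + 1) / 2"] t pq by (auto simp: F_def joinpaths_def add_divide_distrib)
    qed (simp add: corner' pq)
    show "F (0, t) = q t"
    proof (cases "t = 0")
      case False
      then have "m (0, t) = (1, t / 2)" using t by (simp add: m_def w_def)
      then show ?thesis using h(4)[of "t / 2"] t by (simp add: F_def joinpaths_def)
    qed (simp add: corner pq)
    show "F (1, t) = q' t"
    proof (cases "t = 1")
      case False
      then have "m (1, t) = (0, (1 + t) / 2)" using t by (simp add: m_def w_def min_def field_simps)
      then show ?thesis using h(3)[of "(1 + t) / 2"] t pq by (auto simp: F_def joinpaths_def add_divide_distrib)
    qed (simp add: corner')
  qed
qed

context tame_space
begin

text \<open>
  Loops off \<open>E\<close> at certain points \<open>w\<close> arbitrarily far out can be pushed off any \<open>D\<close> while avoiding \<open>K\<close>. Since \<open>w\<close>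
  lies in a connected set \<open>Z\<close> off \<open>D'\<close> that is not precompact, every proper ray can be connected with \<open>w\<close>
  off \<open>D'\<close> when \<open>X\<close> is one-ended.
\<close>
definition pushes :: "'a set \<Rightarrow> 'a set \<Rightarrow> bool" where
  "pushes K E \<longleftrightarrow> cpt E \<and> K \<subseteq> E \<and>
     (\<forall>D. cpt D \<longrightarrow> (\<exists>D' w Z. cpt D' \<and> D \<subseteq> D' \<and> E \<subseteq> D' \<and> connected Z \<and> Z \<subseteq> X - D' \<and> \<not> precompact Z \<and> w \<in> Z \<and>
       (\<forall>p. path_in (X - E) p \<longrightarrow> pathstart p = w \<longrightarrow> pathfinish p = w \<longrightarrow>
          (\<exists>q. path_in (X - D) q \<and> homotopic_paths (X - K) p q))))"

lemma ray_tail: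
  assumes "proper_ray X r" "a \<ge> 0"
  shows "connected (r ` {a..})" "\<not> precompact (r ` {a..})"
proof -
  have "continuous_on {a..} r" using proper_ray_in[OF assms(1)] assms(2) by (auto simp: ray_in_def elim: continuous_on_subset)
  then show "connected (r ` {a..})" by (intro connected_continuous_image) auto
  show "\<not> precompact (r ` {a..})"
  proof
    assume "precompact (r ` {a..})"
    then obtain K where K: "compact K" "K \<subseteq> X" "r ` {a..} \<subseteq> K" by (auto simp: precompact_def)
    obtain b where b: "b \<ge> 0" "r ` {b..} \<subseteq> X - K" using proper_ray_tail[OF assms(1) K(1,2)] .
    have "r (max a b) \<in> K" using K(3) by auto
    moreover have "r (max a b) \<in> X - K" using b(2) by (auto simp: image_subset_iff)
    ultimately show False by blast
  qed
qed

lemma connect_far: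
  assumes "one_ended X" "cpt K" and A: "connected A" "A \<subseteq> X - K" "\<not> precompact A"
    and B: "connected B" "B \<subseteq> X - K" "\<not> precompact B" and ab: "a \<in> A" "b \<in> B"
  shows "\<exists>c. path_in (X - K) c \<and> pathstart c = a \<and> pathfinish c = b"
proof -
  obtain Z where Z: "Z \<in> components (X - K)" "A \<subseteq> Z" "B \<subseteq> Z" using ends_meet[OF assms(1-8)] .
  have op: "open_X (X - K)" using closedin_cpt[OF assms(2)] open_minus_closed by blast
  have "path_connected Z"
    using connected_open_path_connected[OF component_open[OF op Z(1)] in_components_connected[OF Z(1)]] .
  then obtain c where "path_in Z c" "pathstart c = a" "pathfinish c = b"
    using path_connected_path_in[of Z a b] Z ab by blast
  then show ?thesis using path_in_mono in_components_subset[OF Z(1)] by blast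
qed

lemma two_ray_tails:
  assumes r: "proper_ray X r" and s: "proper_ray X s" and K: "cpt K"
  obtains a where "a \<ge> c" "a \<ge> 0" "r ` {a..} \<subseteq> X - K" "s ` {a..} \<subseteq> X - K"
proof -
  obtain a where a: "a \<ge> 0" "r ` {a..} \<subseteq> X - K" using proper_ray_tail[OF r] K by blast
  obtain b where b: "b \<ge> 0" "s ` {b..} \<subseteq> X - K" using proper_ray_tail[OF s] K by blast
  show ?thesis by (rule that[of "max c (max a b)"]) (use a b in \<open>auto simp: image_subset_iff\<close>)
qed

text \<open>
  Conjugating by paths far out turns the path \<open>\<delta>\<close> between the rays into a loop, which can be pushed.
\<close>
lemma ray_step:
  assumes oe: "one_ended X" and r: "proper_ray X r" and s: "proper_ray X s" and push: "pushes K E" and E': "cpt E'"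
    and t: "t \<ge> 0" "r ` {t..} \<subseteq> X - E" "s ` {t..} \<subseteq> X - E"
    and \<delta>: "path_in (X - E) \<delta>" "pathstart \<delta> = r t" "pathfinish \<delta> = s t"
  obtains t' \<delta>' where "t' \<ge> t + 1" "r ` {t'..} \<subseteq> X - E'" "s ` {t'..} \<subseteq> X - E'"
    "path_in (X - E') \<delta>'" "pathstart \<delta>' = r t'" "pathfinish \<delta>' = s t'"
    "homotopic_paths (X - K) (seg r t t' +++ \<delta>') (\<delta> +++ seg s t t')"
proof -
  have "\<exists>D' w Z. cpt D' \<and> E' \<subseteq> D' \<and> E \<subseteq> D' \<and> connected Z \<and> Z \<subseteq> X - D' \<and> \<not> precompact Z \<and> w \<in> Z \<and>
       (\<forall>p. path_in (X - E) p \<longrightarrow> pathstart p = w \<longrightarrow> pathfinish p = w \<longrightarrow>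
          (\<exists>q. path_in (X - E') q \<and> homotopic_paths (X - K) p q))"
    using push[unfolded pushes_def, THEN conjunct2, THEN conjunct2, THEN spec, THEN mp, OF E'] .
  then obtain D' w Z where *: "cpt D' \<and> E' \<subseteq> D' \<and> E \<subseteq> D' \<and> connected Z \<and> Z \<subseteq> X - D' \<and> \<not> precompact Z \<and> w \<in> Z \<and>
       (\<forall>p. path_in (X - E) p \<longrightarrow> pathstart p = w \<longrightarrow> pathfinish p = w \<longrightarrow>
          (\<exists>q. path_in (X - E') q \<and> homotopic_paths (X - K) p q))"
    by (elim exE) (rule that)
  then have D': "cpt D'" "E' \<subseteq> D'" "E \<subseteq> D'" and Z: "connected Z" "Z \<subseteq> X - D'" "\<not> precompact Z" "w \<in> Z"
    by simp_all
  have loops: "\<exists>q. path_in (X - E') q \<and> homotopic_paths (X - K) p q"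
    if "path_in (X - E) p" "pathstart p = w" "pathfinish p = w" for p
    using conjunct2[OF conjunct2[OF conjunct2[OF conjunct2[OF conjunct2[OF conjunct2[OF conjunct2[OF *]]]]]], rule_format, OF that] .
  have KE: "K \<subseteq> E" using push by (simp add: pushes_def)
  obtain t' where t': "t' \<ge> t + 1" "t' \<ge> 0" "r ` {t'..} \<subseteq> X - D'" "s ` {t'..} \<subseteq> X - D'"
    using two_ray_tails[OF r s D'(1)] .
  have mem: "r t' \<in> r ` {t'..}" "s t' \<in> s ` {t'..}" by auto
  have far: "\<not> precompact (r ` {t'..})" "\<not> precompact (s ` {t'..})" "connected (r ` {t'..})" "connected (s ` {t'..})"
    using ray_tail[OF r t'(2)] ray_tail[OF s t'(2)] by blast+
  note c1 = connect_far[OF oe D'(1) Z(1-3) far(3) t'(3) far(1) Z(4) mem(1)]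
  obtain c1 where c1: "path_in (X - D') c1 \<and> pathstart c1 = w \<and> pathfinish c1 = r t'"
    using c1 by (rule exE)
  note c2 = connect_far[OF oe D'(1) far(4) t'(4) far(2) Z(1-3) mem(2) Z(4)]
  obtain c2 where c2: "path_in (X - D') c2 \<and> pathstart c2 = s t' \<and> pathfinish c2 = w"
    using c2 by (rule exE)
  note c1 = conjunct1[OF c1] conjunct1[OF conjunct2[OF c1]] conjunct2[OF conjunct2[OF c1]]
  note c2 = conjunct1[OF c2] conjunct1[OF conjunct2[OF c2]] conjunct2[OF conjunct2[OF c2]]
  have seg_E: "path_in (X - E) (seg x a b)" if "proper_ray X x" "x ` {t..} \<subseteq> X - E" "a \<ge> t" "b \<ge> t" for x a b
  proof (rule path_in_seg)
    show "continuous_on {0..} x" using proper_ray_in[OF that(1)] by (simp add: ray_in_def)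
    have "closed_segment a b \<subseteq> {t..}" using that(3,4) by (auto simp: closed_segment_eq_real_ivl)
    then show "x ` closed_segment a b \<subseteq> X - E" "closed_segment a b \<subseteq> {0..}" using that(2) t(1) by auto
  qed
  have R: "path_in (X - E) (seg r t' t)" "path_in (X - E) (seg r t t')" and S: "path_in (X - E) (seg s t t')"
    using seg_E[OF r t(2)] seg_E[OF s t(3)] t'(1) by auto
  have sub: "X - D' \<subseteq> X - E" "X - D' \<subseteq> X - E'" "X - E \<subseteq> X - K" using D' KE by auto
  have cE: "path_in (X - E) c1" "path_in (X - E) c2" using c1(1) c2(1) sub(1) path_in_mono by blast+
  define p where "p = (c1 +++ (seg r t' t +++ (\<delta> +++ seg s t t'))) +++ c2"
  have "path_in (X - E) p" "pathstart p = w" "pathfinish p = w"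
    using cE R S \<delta> c1 c2 by (auto simp: p_def)
  then obtain q where q: "path_in (X - E') q" "homotopic_paths (X - K) p q" using loops by blast
  have qe: "pathstart q = w" "pathfinish q = w"
    using homotopic_paths_ends[OF q(2)] \<open>pathstart p = w\<close> \<open>pathfinish p = w\<close> by auto
  have qK: "path_in (X - K) q" using homotopic_paths_path_in[OF q(2)] by blast
  have K: "path_in (X - K) c1" "path_in (X - K) c2" "path_in (X - K) (seg r t' t)" "path_in (X - K) (seg s t t')" "path_in (X - K) \<delta>"
    using cE R S \<delta> sub(3) path_in_mono by blast+
  define \<delta>' where "\<delta>' = reversepath c1 +++ (q +++ reversepath c2)"
  have rs: "path_in (X - K) (seg r t t')" using R(2) sub(3) path_in_mono by blast
  have cE': "path_in (X - E') c1" "path_in (X - E') c2" using c1(1) c2(1) sub(2) path_in_mono by blast+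
  have "homotopic_paths (X - K) \<delta>' (reversepath c1 +++ (p +++ reversepath c2))"
    unfolding \<delta>'_def using K q(2) qK qe c1 c2
    by (intro hom_left[OF hom_right[OF homotopic_paths_sym[OF q(2)]]]) auto
  also have "homotopic_paths (X - K) \<dots> (reversepath c1 +++ (c1 +++ (seg r t' t +++ (\<delta> +++ seg s t t'))))"
    unfolding p_def using K \<delta> c1 c2 by (intro hom_left[OF hom_rinv]) auto
  also have "homotopic_paths (X - K) \<dots> (seg r t' t +++ (\<delta> +++ seg s t t'))"
    using K \<delta> c1 by (intro hom_linv) auto
  finally have 1: "homotopic_paths (X - K) \<delta>' (seg r t' t +++ (\<delta> +++ seg s t t'))" .
  have "homotopic_paths (X - K) (seg r t t' +++ \<delta>') (seg r t t' +++ (seg r t' t +++ (\<delta> +++ seg s t t')))"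
    using rs c1 by (intro hom_left[OF 1]) (auto simp: \<delta>'_def)
  also have "homotopic_paths (X - K) \<dots> (\<delta> +++ seg s t t')"
    using hom_linv[of "X - K" "\<delta> +++ seg s t t'" "seg r t' t"] K \<delta> by simp
  finally have 2: "homotopic_paths (X - K) (seg r t t' +++ \<delta>') (\<delta> +++ seg s t t')" .
  show ?thesis
  proof (rule that[OF t'(1) _ _ _ _ _ 2])
    show "r ` {t'..} \<subseteq> X - E'" "s ` {t'..} \<subseteq> X - E'" using t'(3,4) sub(2) by auto
    show "path_in (X - E') \<delta>'" "pathstart \<delta>' = r t'" "pathfinish \<delta>' = s t'"
      using cE' q qe c1 c2 by (auto simp: \<delta>'_def)
  qed
qed

text \<open>
  The squares between consecutive connecting paths are laid side by side. The \<open>n\<close>-th one avoids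
  the \<open>n\<close>-th set of a compact exhaustion, which makes the resulting homotopy proper.
\<close>
lemma rays_properly_homotopic:
  assumes oe: "one_ended X" and push: "\<And>K. cpt K \<Longrightarrow> \<exists>E. pushes K E"
    and r: "proper_ray X r" and s: "proper_ray X s"
  shows "properly_homotopic_rays X r s"
proof -
  obtain K :: "nat \<Rightarrow> 'a set" where K: "\<And>n. cpt (K n)" "\<And>n. K n \<subseteq> K (Suc n)" "\<And>C. cpt C \<Longrightarrow> \<exists>n. C \<subseteq> K n"
    using compact_exhaustion by blast
  have "\<exists>E. pushes (K n) E" for n using push K(1) by blast
  then obtain E where E: "\<And>n. pushes (K n) (E n)" by metis
  have cE: "cpt (E n)" for n using E by (simp add: pushes_def)
  have rX: "ray_in X r" "ray_in X s" using proper_ray_in r s by auto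
  \<comment> \<open>In the first square the homotopy comes from simple connectivity and avoids nothing.\<close>
  define S where "S n = (if n = 0 then X else X - K n)" for n
  define P where "P n x \<longleftrightarrow> (n = 0 \<longrightarrow> fst x = 0) \<and> fst x \<ge> 0 \<and> path_in X (snd x) \<and> pathstart (snd x) = r (fst x) \<and> pathfinish (snd x) = s (fst x) \<and>
      (n > 0 \<longrightarrow> path_in (X - E n) (snd x) \<and> r ` {fst x..} \<subseteq> X - E n \<and> s ` {fst x..} \<subseteq> X - E n)"
    for n :: nat and x :: "real \<times> (real \<Rightarrow> 'a)"
  define R where "R n x y \<longleftrightarrow> fst x + 1 \<le> fst y \<and>
      homotopic_paths (S n) (seg r (fst x) (fst y) +++ snd y) (snd x +++ seg s (fst x) (fst y))"
    for n :: nat and x y :: "real \<times> (real \<Rightarrow> 'a)"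
  have "\<exists>x. \<forall>n. P n (x n) \<and> R n (x n) (x (Suc n))"
  proof (rule dependent_nat_choice)
    have "r 0 \<in> X" "s 0 \<in> X" using rX by (auto simp: ray_in_def)
    then obtain \<delta> where "path_in X \<delta>" "pathstart \<delta> = r 0" "pathfinish \<delta> = s 0"
      using path_connected_path_in[OF path_connected] by blast
    then show "\<exists>x. P 0 x" by (intro exI[of _ "(0, \<delta>)"]) (simp add: P_def)
    fix x n assume x: "P n x"
    obtain t \<delta> where xt: "x = (t, \<delta>)" by (cases x)
    show "\<exists>y. P (Suc n) y \<and> R n x y"
    proof (cases "n = 0")
      case True
      obtain t' where t': "t' \<ge> t + 1" "t' \<ge> 0" "r ` {t'..} \<subseteq> X - E 1" "s ` {t'..} \<subseteq> X - E 1"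
        using two_ray_tails[OF r s cE] .
      have mem: "r t' \<in> r ` {t'..}" "s t' \<in> s ` {t'..}" by auto
      obtain \<delta>' where \<delta>': "path_in (X - E 1) \<delta>'" "pathstart \<delta>' = r t'" "pathfinish \<delta>' = s t'"
        using connect_far[OF oe cE[of 1] ray_tail(1)[OF r t'(2)] t'(3) ray_tail(2)[OF r t'(2)]
            ray_tail(1)[OF s t'(2)] t'(4) ray_tail(2)[OF s t'(2)] mem] by (elim exE conjE) rule
      have \<delta>X: "path_in X \<delta>'" using \<delta>'(1) path_in_mono by blast
      have x': "t = 0" "path_in X \<delta>" "pathstart \<delta> = r t" "pathfinish \<delta> = s t" using x True by (auto simp: P_def xt)
      have "path_in X (seg r t t' +++ \<delta>')" "path_in X (\<delta> +++ seg s t t')"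
        using ray_in_seg[OF rX(1), of t t'] ray_in_seg[OF rX(2), of t t'] t'(2) x' \<delta>X \<delta>' by auto
      then have "homotopic_paths X (seg r t t' +++ \<delta>') (\<delta> +++ seg s t t')"
        using x' \<delta>' by (intro simply_connected_homotopic_paths[OF simply_connected]) (auto simp: path_in_def)
      then show ?thesis
        using t' \<delta>' \<delta>X True by (intro exI[of _ "(t', \<delta>')"]) (simp add: P_def R_def S_def xt)
    next
      case False
      have x': "t \<ge> 0" "path_in (X - E n) \<delta>" "pathstart \<delta> = r t" "pathfinish \<delta> = s t"
        "r ` {t..} \<subseteq> X - E n" "s ` {t..} \<subseteq> X - E n" using x False by (auto simp: P_def xt)
      obtain t' \<delta>' where y: "t' \<ge> t + 1" "r ` {t'..} \<subseteq> X - E (Suc n)" "s ` {t'..} \<subseteq> X - E (Suc n)"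
        "path_in (X - E (Suc n)) \<delta>'" "pathstart \<delta>' = r t'" "pathfinish \<delta>' = s t'"
        "homotopic_paths (X - K n) (seg r t t' +++ \<delta>') (\<delta> +++ seg s t t')"
        using ray_step[OF oe r s E cE x'(1,5,6,2,3,4)] .
      have "path_in X \<delta>'" using y(4) path_in_mono by blast
      then show ?thesis
        using y x'(1) False by (intro exI[of _ "(t', \<delta>')"]) (simp add: P_def R_def S_def xt)
    qed
  qed
  then obtain x where x: "\<And>n. P n (x n)" "\<And>n. R n (x n) (x (Suc n))" by blast
  define T where "T n = fst (x n)" for n
  define \<delta> where "\<delta> n = snd (x n)" for n
  have T: "T 0 = 0" "\<And>n. T n \<ge> 0" "\<And>n. T n + 1 \<le> T (Suc n)"
    using x(1) x(2) by (auto simp: P_def R_def T_def)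
  have \<delta>: "pathstart (\<delta> n) = r (T n)" "pathfinish (\<delta> n) = s (T n)" for n
    using x(1)[of n] by (auto simp: P_def T_def \<delta>_def)
  have hom: "homotopic_paths (S n) (seg r (T n) (T (Suc n)) +++ \<delta> (Suc n)) (\<delta> n +++ seg s (T n) (T (Suc n)))" for n
    using x(2)[of n] by (simp add: R_def T_def \<delta>_def)
  define sq where "sq n F \<longleftrightarrow> continuous_on ({0..1} \<times> {0..1}) F \<and> F ` ({0..1} \<times> {0..1}) \<subseteq> S n \<and>
      (\<forall>t\<in>{0..1}. F (t, 0) = seg r (T n) (T (Suc n)) t \<and> F (t, 1) = seg s (T n) (T (Suc n)) t \<and>
         F (0, t) = \<delta> n t \<and> F (1, t) = \<delta> (Suc n) t)" for n and F :: "real \<times> real \<Rightarrow> 'a"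
  have "\<exists>F. sq n F" for n
    by (rule fill_square[OF hom[of n]]) (auto simp: \<delta> sq_def)
  then obtain F where F: "\<And>n. sq n (F n)" by metis
  define a where "a n = (\<lambda>x::real \<times> real. ((fst x - T n) / (T (Suc n) - T n), snd x))" for n
  have pos: "T (Suc n) - T n > 0" for n using T(3)[of n] by linarith
  have aQ: "a n x \<in> {0..1} \<times> {0..1}" if "x \<in> {T n..T (Suc n)} \<times> {0..1}" for n x
    using that pos[of n] by (auto simp: a_def mem_Times_iff divide_le_eq)
  define f where "f n = F n \<circ> a n" for n
  have f_im: "f n ` ({T n..T (Suc n)} \<times> {0..1}) \<subseteq> S n" for n
  proof clarify
    fix t u assume "t \<in> {T n..T (Suc n)}" "u \<in> {0..1::real}"
    then have "a n (t, u) \<in> {0..1} \<times> {0..1}" by (intro aQ) auto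
    then have "F n (a n (t, u)) \<in> F n ` ({0..1} \<times> {0..1})" by (rule imageI)
    then show "f n (t, u) \<in> S n" using F[of n] unfolding f_def sq_def o_def by blast
  qed
  interpret g: gluing T "{0..1::real}" f
  proof
    show "continuous_on ({T n..T (Suc n)} \<times> {0..1}) (f n)" for n
      unfolding f_def
    proof (rule continuous_on_compose)
      show "continuous_on ({T n..T (Suc n)} \<times> {0..1}) (a n)"
        unfolding a_def using pos[of n] by (intro continuous_intros) auto
      show "continuous_on (a n ` ({T n..T (Suc n)} \<times> {0..1})) (F n)"
      proof (rule continuous_on_subset)
        show "continuous_on ({0..1} \<times> {0..1}) (F n)" using F[of n] unfolding sq_def by (rule conjunct1)
        show "a n ` ({T n..T (Suc n)} \<times> {0..1}) \<subseteq> {0..1} \<times> {0..1}" by (rule image_subsetI) (rule aQ)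
      qed
    qed
    show "f n (T (Suc n), z) = f (Suc n) (T (Suc n), z)" if "z \<in> {0..1}" for n z
      using F[of n] F[of "Suc n"] that pos[of n] by (simp add: f_def a_def sq_def)
  qed (use T in auto)
  have side: "glued T f (t, 0) = r t \<and> glued T f (t, 1) = s t" if t: "t \<ge> 0" for t
  proof -
    obtain n where n: "T n \<le> t" "t \<le> T (Suc n)" using g.piece_exists[OF t] .
    define \<tau> where "\<tau> = (t - T n) / (T (Suc n) - T n)"
    have \<tau>: "\<tau> \<in> {0..1}" using n pos[of n] by (simp add: \<tau>_def divide_le_eq)
    have "(1 - \<tau>) * T n + \<tau> * T (Suc n) = T n + \<tau> * (T (Suc n) - T n)" by (simp add: algebra_simps)
    also have "\<dots> = t" using pos[of n] by (simp add: \<tau>_def)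
    finally have "linepath (T n) (T (Suc n)) \<tau> = t" by (simp add: linepath_def)
    moreover have "glued T f (t, 0) = f n (t, 0)" "glued T f (t, 1) = f n (t, 1)"
      using n by (auto intro!: g.glued_on_piece)
    moreover have "a n (t, u) = (\<tau>, u)" for u by (simp add: a_def \<tau>_def)
    ultimately show ?thesis using F[of n] \<tau> by (simp add: f_def sq_def seg_def)
  qed
  have "proper_map_on ({0..} \<times> {0..1}) X (glued T f)"
  proof (rule g.proper_map_on_glued)
    show "f n ` ({T n..T (Suc n)} \<times> {0..1}) \<subseteq> X" for n using f_im[of n] by (auto simp: S_def split: if_splits)
    fix C assume C: "compact C" "C \<subseteq> X"
    then obtain m where m: "C \<subseteq> K m" using K(3) by blast
    have "f n ` ({T n..T (Suc n)} \<times> {0..1}) \<inter> C = {}" if "n \<ge> Suc m" for n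
    proof -
      have "K m \<subseteq> K n" using lift_Suc_mono_le[of K m n, OF K(2)] that by simp
      then show ?thesis using f_im[of n] m that by (auto simp: S_def split: if_splits)
    qed
    then show "\<exists>N. \<forall>n\<ge>N. f n ` ({T n..T (Suc n)} \<times> {0..1}) \<inter> C = {}" by blast
  qed auto
  then show ?thesis unfolding properly_homotopic_rays_def using side by blast
qed

end

theorem corollary9p1:
  fixes X :: "'a::metric_space set"
    and G :: "('g, 'm) monoid_scheme"
    and \<phi> :: "'g \<Rightarrow> 'a \<Rightarrow> 'a"
  assumes "one_ended X"
    and "simply_connected X"
    and "locally compact X"
    and "metric_ANR X"
    and "group G"
    and "covering_transformation_action G X \<phi>"
    and "\<And>C0. compact C0 \<Longrightarrow> C0 \<subseteq> X \<Longrightarrow> C0 \<noteq> {} \<Longrightarrow>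
           \<exists>J. finitely_generated_subgroup G J \<and> infinite J \<and>
               semistable_in G X \<phi> J C0 \<and> co_semistable_in X \<phi> J C0"
  shows "semistable_fundamental_group_at_infinity X"
proof -
  interpret group G by fact
  interpret acting X G \<phi>
    by unfold_locales (use assms in auto)
  have push: "\<exists>E. pushes K E" if K: "cpt K" and x0: "x0 \<in> X" for K x0
  proof -
    \<comment> \<open>The hypotheses concern non-empty compact sets.\<close>
    define C0 where "C0 = insert x0 K"
    have C0: "cpt C0" "C0 \<noteq> {}" using K x0 by (auto simp: C0_def)
    obtain J where J: "finitely_generated_subgroup G J" "infinite J" "semistable_in G X \<phi> J C0" "co_semistable_in X \<phi> J C0"
      using assms(7) C0 by blast
    obtain C J0 zv ze where C: "compact C" "C \<subseteq> X" "finite_generating_set G J J0" "equivariant_cayley_map G X \<phi> J J0 zv ze"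
      and semi: "\<forall>D r s. compact D \<and> D \<subseteq> X \<and>
           proper_edge_path_ray G J J0 r \<and> proper_edge_path_ray G J J0 s \<and>
           edge_source G (r 0) = edge_source G (s 0) \<and>
           ray_image ze r ` {0..} \<subseteq> X - C \<and> ray_image ze s ` {0..} \<subseteq> X - C \<longrightarrow>
           (\<exists>a\<ge>0. \<exists>b\<ge>0. \<exists>\<delta>. path \<delta> \<and> path_image \<delta> \<subseteq> X - D \<and>
              pathstart \<delta> = ray_image ze r a \<and> pathfinish \<delta> = ray_image ze s b \<and>
              homotopic_paths (X - C0)
                ((\<lambda>t. ray_image ze r (a * t)) +++ \<delta> +++
                  reversepath (\<lambda>t. ray_image ze s (b * t)))
                (\<lambda>_. ray_image ze r 0))"
      using J(3) unfolding semistable_in_def by (elim exE conjE) auto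
    interpret S: semistable_action X G \<phi> J J0 C0 "C \<union> C0" zv ze
    proof (intro semistable_action.intro semistable_action_axioms.intro)
      show "acting X G \<phi>" by unfold_locales
      show "subgroup J G" using J(1) by (simp add: finitely_generated_subgroup_def)
      fix D r s
      assume "compact D \<and> D \<subseteq> X" "proper_edge_path_ray G J J0 r" "proper_edge_path_ray G J J0 s"
        "edge_source G (r 0) = edge_source G (s 0)" "ray_image ze r ` {0..} \<subseteq> X - (C \<union> C0)" "ray_image ze s ` {0..} \<subseteq> X - (C \<union> C0)"
      then show "\<exists>a\<ge>0. \<exists>b\<ge>0. \<exists>\<delta>. path \<delta> \<and> path_image \<delta> \<subseteq> X - D \<and>
              pathstart \<delta> = ray_image ze r a \<and> pathfinish \<delta> = ray_image ze s b \<and>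
              homotopic_paths (X - C0)
                ((\<lambda>t. ray_image ze r (a * t)) +++ \<delta> +++ reversepath (\<lambda>t. ray_image ze s (b * t)))
                (\<lambda>_. ray_image ze r 0)"
        by (intro semi[rule_format] conjI) auto
    qed (insert J C C0, auto)
    obtain Cc where Cc: "cpt Cc" and co: "\<And>U r. \<lbrakk>U \<in> components (X - translates \<phi> J Cc); \<not> group_bounded X \<phi> J U;
        proper_ray X r; r ` {0..} \<subseteq> U; group_bounded X \<phi> J (r ` {0..})\<rbrakk> \<Longrightarrow> co_semistable_in_component X U r C0"
      using J(4) unfolding co_semistable_in_def by blast
    obtain E where E: "cpt E" and away: "\<forall>D. cpt D \<longrightarrow> (\<exists>D' w Z. cpt D' \<and> D \<subseteq> D' \<and> E \<subseteq> D' \<and>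
       connected Z \<and> Z \<subseteq> X - D' \<and> \<not> precompact Z \<and> w \<in> Z \<and>
       (\<forall>p. path_in (X - E) p \<longrightarrow> pathstart p = w \<longrightarrow> pathfinish p = w \<longrightarrow>
          (\<exists>q. path_in (X - D) q \<and> homotopic_paths S.Y p q)))"
    proof (rule S.loops_push_out[OF assms(1) Cc co[folded S.orb_eq_translates]])
      fix E
      assume "cpt E" and "\<And>D. cpt D \<Longrightarrow> \<exists>D' w Z. cpt D' \<and> D \<subseteq> D' \<and> E \<subseteq> D' \<and> connected Z \<and> Z \<subseteq> X - D' \<and> \<not> precompact Z \<and> w \<in> Z \<and>
       (\<forall>p. path_in (X - E) p \<longrightarrow> pathstart p = w \<longrightarrow> pathfinish p = w \<longrightarrow>
          (\<exists>q. path_in (X - D) q \<and> homotopic_paths S.Y p q))"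
      then show thesis by (intro that allI impI)
    qed
    have YK: "S.Y \<subseteq> X - K" unfolding S.Y_def by (auto simp: C0_def)
    have "pushes K (E \<union> K)"
      unfolding pushes_def
    proof (intro conjI allI impI)
      show "compact (E \<union> K)" "E \<union> K \<subseteq> X" using cpt_Un[OF E K] by auto
      fix D assume D: "cpt D"
      obtain D' w Z where *: "cpt D' \<and> D \<union> K \<subseteq> D' \<and> E \<subseteq> D' \<and> connected Z \<and> Z \<subseteq> X - D' \<and> \<not> precompact Z \<and> w \<in> Z \<and>
         (\<forall>p. path_in (X - E) p \<longrightarrow> pathstart p = w \<longrightarrow> pathfinish p = w \<longrightarrow>
          (\<exists>q. path_in (X - (D \<union> K)) q \<and> homotopic_paths S.Y p q))"
        using away[rule_format, OF cpt_Un[OF D K]] by (elim exE) (rule that)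
      then have q: "\<exists>q. path_in (X - (D \<union> K)) q \<and> homotopic_paths S.Y p q"
        if "path_in (X - E) p" "pathstart p = w" "pathfinish p = w" for p
        using conjunct2[OF conjunct2[OF conjunct2[OF conjunct2[OF conjunct2[OF conjunct2[OF conjunct2[OF *]]]]]], rule_format, OF that] by simp
      have "\<exists>q. path_in (X - D) q \<and> homotopic_paths (X - K) p q"
        if p: "path_in (X - (E \<union> K)) p" "pathstart p = w" "pathfinish p = w" for p
      proof -
        have "path_in (X - E) p" by (rule path_in_mono[OF p(1)]) auto
        from q[OF this p(2,3)] obtain q' where q': "path_in (X - (D \<union> K)) q'" "homotopic_paths S.Y p q'" by (elim exE conjE) (rule that)
        have "path_in (X - D) q'" by (rule path_in_mono[OF q'(1)]) auto
        then show ?thesis using homotopic_paths_subset[OF q'(2) YK] by blast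
      qed
      then show "\<exists>D' w Z. cpt D' \<and> D \<subseteq> D' \<and> E \<union> K \<subseteq> D' \<and> connected Z \<and> Z \<subseteq> X - D' \<and> \<not> precompact Z \<and> w \<in> Z \<and>
         (\<forall>p. path_in (X - (E \<union> K)) p \<longrightarrow> pathstart p = w \<longrightarrow> pathfinish p = w \<longrightarrow>
            (\<exists>q. path_in (X - D) q \<and> homotopic_paths (X - K) p q))"
        using * by (intro exI[of _ D'] exI[of _ w] exI[of _ Z]) simp
    qed auto
    then show ?thesis by blast
  qed
  show ?thesis
    unfolding semistable_fundamental_group_at_infinity_def
  proof (intro allI impI, elim conjE)
    fix r s assume rs: "proper_ray X r" "proper_ray X s"
    then have "r 0 \<in> X" using proper_ray_in[OF rs(1)] by (auto simp: ray_in_def)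
    then show "properly_homotopic_rays X r s"
      using push by (intro rays_properly_homotopic assms(1) rs) blast
  qed
qed

end
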